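(* For every cardinal number $\tau$, the complete normal contact algebra $(RC(\mathbb{I}^\tau),\rho_{\mathbb{I}^\tau})$ of the Tychonoff cube $\mathbb{I}^\tau$ ($\mathbb{I}=[0,1]$, product topology) is CA-isomorphic to the $\mathbf{DHC}$-sum (coproduct in the category $\mathbf{DHC}$) of $\tau$ copies of the complete normal contact algebra $(\tilde{A},\tilde{\sigma}')$ constructed in the context. Therefore this $\mathbf{DHC}$-sum completely determines the space $\mathbb{I}^\tau$: every compact Hausdorff space $Y$ with $(RC(Y),\rho_Y)$ CA-isomorphic to this sum is homeomorphic to $\mathbb{I}^\tau$.
   Context: **Contact algebras.** A contact algebra $(B,C)$ is a Boolean algebra $B$ (complement $a^*$) with a binary relation $C$ such that: (C1) $a\neq 0\Rightarrow aCa$; (C2) $aCb\Rightarrow a\neq 0$ and $b\ne 0$; (C3) $aCb\Rightarrow bCa$; (C4) $aC(b\vee c)$ iff $aCb$ or $aCc$. Write $a(-C)b$ for "not $aCb$", and $a\ll_C b$ iff $a(-C)b^*$. It is a normal contact algebra if also (C5) $a(-C)b$ implies $a(-C)c$ and $b(-C)c^*$ for some $c\in B$; (C6) if $a\neq 1$ there is $b\neq 0$ with $b(-C)a$. It is a complete normal contact algebra (CNCA) if moreover $B$ is complete. $(B_1,C_1)$ and $(B_2,C_2)$ are CA-isomorphic if there is a Boolean isomorphism $\varphi:B_1\to B_2$ with $aC_1b\iff\varphi(a)C_2\varphi(b)$. **Standard algebras.** For a topological space $X$: $RC(X)$ is the complete Boolean algebra of regular closed subsets ($F=\mathrm{cl}(\mathrm{int}F)$),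 with $F\vee G=F\cup G$, $F\wedge G=\mathrm{cl}(\mathrm{int}(F\cap G))$, $F^*=\mathrm{cl}(X\setminus F)$; $F\rho_X G$ iff $F\cap G\neq\emptyset$. For $X$ compact Hausdorff, $(RC(X),\rho_X)$ is a CNCA. **The category $\mathbf{DHC}$.** Objects: CNCAs. Morphisms $\varphi:(A,C)\to(B,C')$: functions $\varphi:A\to B$ such that (DVAL1) $\varphi(0)=0$; (DVAL2) $\varphi(a\wedge b)=\varphi(a)\wedge\varphi(b)$; (DVAL3) $a\ll_C b$ implies $(\varphi(a^* ))^*\ll_{C'}\varphi(b)$; (DVAL4) $\varphi(a)=\bigvee\{\varphi(b): b\ll_C a\}$ for all $a\in A$. Composition: $\varphi_2\diamond\varphi_1=(\varphi_2\circ\varphi_1)\check{}$, where for a function $\psi$ from $(A,C)$ one sets $\psi\check{}(a)=\bigvee\{\psi(b): b\ll_C a\}$. **Construction of $(\tilde{A},\tilde{\sigma},\widetilde{\mathbb{B}})$.** Let $\mathbb{Z}_0=\mathbb{Z}\setminus\{0\}$ with the usual order; for $p\in\mathbb{Z}_0$ let $p^-,p^+$ be its immediate predecessor and successor in $\mathbb{Z}_0$ (so $1^-=-1$, $(-1)^+=1$), $succ(p)=\{q\in\mathbb{Z}_0: q>p\}$, $pred(p)=\{q\in\mathbb{Z}_0: q<p\}$. For $i\in\mathbb{N}^+$ let $A_i=P(\mathbb{Z}_0)$ (power set Boolean algebra). Let $(A,(\varphi_i)_{i\in\mathbb{N}^+})$ be the sum (coproduct, free product) of the Boolean algebras $A_i$,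 with canonical monomorphisms $\varphi_i:A_i\to A$, and let $\tilde{A}\supseteq A$ be the (MacNeille) completion of $A$. Let $B_0$ be the set of all elements $b=\varphi_1(\{n_1\})\wedge\dots\wedge\varphi_k(\{n_k\})$, $k\in\mathbb{N}^+$, $n_1,\dots,n_k\in\mathbb{Z}_0$. For such $b$ put $b_-=\varphi_1(\{n_1\})\wedge\dots\wedge\varphi_{k-1}(\{n_{k-1}\})\wedge\varphi_k(\{n_k^-\})$ and, for $r\in\mathbb{N}^+$, $q_{br}=(b_-\wedge\varphi_{k+1}(succ(r)))\vee(b\wedge\varphi_{k+1}(pred(-r)))$. Let $B_1=\{q_{br}: b\in B_0, r\in\mathbb{N}^+\}$ and let $\widetilde{\mathbb{B}}$ be the ideal of $\tilde{A}$ generated by $B_0\cup B_1$. The relation $\tilde{\sigma}$ on $\tilde{A}$ is symmetric and defined as follows. Let $b=\bigwedge_{i=1}^k\varphi_i(\{n_i\})$, $b'=\bigwedge_{i=1}^l\varphi_i(\{n'_i\})$ be in $B_0$ and $r,r'\in\mathbb{N}^+$. (i) If $k\le l$: $b\tilde{\sigma}b'$ iff $n_i=n'_i$ for all $i<k$ and [$n'_k\in\{n_k^-,n_k,n_k^+\}$ if $k=l$; $n'_k=n_k$ if $k<l$]. (ii) If $k\le l$: $q_{br}\tilde{\sigma}q_{b'r'}$ iff $n_i=n'_i$ for all $i<k$ and [$n'_k=n_k$ if $l=k$; ($n'_k=n_k$ and $n'_{k+1}\le -r$) or ($n'_k=n_k^-$ and $n'_{k+1}>r$) if $l=k+1$;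 ($n'_k=n_k$ and $n'_{k+1}<-r$) or ($n'_k=n_k^-$ and $n'_{k+1}>r$) if $l>k+1$]. (iii) If $k>l$: $q_{br}\tilde{\sigma}b'$ iff $n_i=n'_i$ for all $i\in\{1,\dots,l\}$. If $k\le l$: $q_{br}\tilde{\sigma}b'$ iff $n_i=n'_i$ for all $i<k$ and [$n'_k\in\{n_k^-,n_k\}$ if $l=k$; ($n'_{k+1}\ge r$ and $n'_k=n_k^-$) or ($n'_{k+1}\le -r$ and $n'_k=n_k$) if $l=k+1$; ($n'_{k+1}>r$ and $n'_k=n_k^-$) or ($n'_{k+1}<-r$ and $n'_k=n_k$) if $l>k+1$]. (iv) For $c,d\in\widetilde{\mathbb{B}}$: $c(-\tilde{\sigma})d$ iff there are $k,l\in\mathbb{N}^+$ and $c_1,\dots,c_k,d_1,\dots,d_l\in B_0\cup B_1$ with $c\le\bigvee_i c_i$, $d\le\bigvee_j d_j$ and $c_i(-\tilde{\sigma})d_j$ for all $i,j$. (v) For $a,b\in\tilde{A}$: $a\tilde{\sigma}b$ iff there are $c,d\in\widetilde{\mathbb{B}}$ with $c\le a$, $d\le b$, $c\tilde{\sigma}d$. **Construction of $\tilde{\sigma}'$.** For $n\in\mathbb{N}^+$ put $u_n^\uparrow=\varphi_1(succ(n))$, $u_n^\downarrow=\varphi_1(pred(-n))$, and $B_2=\{u_n^\uparrow,u_n^\downarrow: n\in\mathbb{N}^+\}$. For $a,b\in B_0\cup B_1\cup B_2$ put $a\tilde{\sigma}'b$ iff $a\tilde{\sigma}b$. For $c,d\in\tilde{A}$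 put $c(-\tilde{\sigma}')d$ iff $c=0$, or $d=0$, or there are $k,l\in\mathbb{N}^+$ and $c_1,\dots,c_k,d_1,\dots,d_l\in B_0\cup B_1\cup B_2$ with $c\le\bigvee_{i=1}^k c_i$, $d\le\bigvee_{j=1}^l d_j$ and $c_i(-\tilde{\sigma}')d_j$ for all $i,j$. *)

theory Defs
  imports "HOL-Analysis.Analysis" "HOL-Algebra.Complete_Lattice"
begin

section \<open>Boolean algebras with a carrier\<close>

text \<open>
  Boolean algebras are bounded distributive complemented lattices in the carrier-based sense of
  \<^theory>\<open>HOL-Algebra.Lattice\<close>; a type-class rendering would not cover the algebras
  \<open>RC(X)\<close> of a variable space, nor quantification over algebras.
  The one-element algebra is allowed.
\<close>

locale boolean_alg = bounded_lattice L for L (structure) +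
  assumes distrib: "\<lbrakk>x \<in> carrier L; y \<in> carrier L; z \<in> carrier L\<rbrakk>
      \<Longrightarrow> x \<sqinter> (y \<squnion> z) = (x \<sqinter> y) \<squnion> (x \<sqinter> z)"
    and compl_exists: "x \<in> carrier L \<Longrightarrow> \<exists>y\<in>carrier L. x \<sqinter> y = \<bottom> \<and> x \<squnion> y = \<top>"

definition cmpl :: "('a, 'm) gorder_scheme \<Rightarrow> 'a \<Rightarrow> 'a" where
  "cmpl L x = (THE y. y \<in> carrier L \<and> x \<sqinter>\<^bsub>L\<^esub> y = \<bottom>\<^bsub>L\<^esub> \<and> x \<squnion>\<^bsub>L\<^esub> y = \<top>\<^bsub>L\<^esub>)"

text \<open>Homomorphisms are extensional functions, so that equality of homomorphisms is equality.\<close>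

definition bool_hom :: "('a, 'm) gorder_scheme \<Rightarrow> ('b, 'n) gorder_scheme \<Rightarrow> ('a \<Rightarrow> 'b) set" where
  "bool_hom A B = {f \<in> carrier A \<rightarrow>\<^sub>E carrier B.
     f \<bottom>\<^bsub>A\<^esub> = \<bottom>\<^bsub>B\<^esub> \<and> f \<top>\<^bsub>A\<^esub> = \<top>\<^bsub>B\<^esub> \<and>
     (\<forall>x\<in>carrier A. f (cmpl A x) = cmpl B (f x)) \<and>
     (\<forall>x\<in>carrier A. \<forall>y\<in>carrier A. f (x \<sqinter>\<^bsub>A\<^esub> y) = f x \<sqinter>\<^bsub>B\<^esub> f y \<and> f (x \<squnion>\<^bsub>A\<^esub> y) = f x \<squnion>\<^bsub>B\<^esub> f y)}"

text \<open>
  \<open>boolean_sum TYPE('c) J A B \<phi>\<close>: \<open>B\<close> with injections \<open>\<phi> i\<close> is the sum (coproduct) of the Boolean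
  algebras \<open>A i\<close>, where the universal property is tested on the Boolean algebras whose elements
  have type \<open>'c\<close> (HOL formulas cannot quantify over types).
\<close>

definition boolean_sum ::
  "'c itself \<Rightarrow> 'j set \<Rightarrow> ('j \<Rightarrow> 'a gorder) \<Rightarrow> 'b gorder \<Rightarrow> ('j \<Rightarrow> 'a \<Rightarrow> 'b) \<Rightarrow> bool" where
  "boolean_sum (_ :: 'c itself) J A B \<phi> \<longleftrightarrow>
     boolean_alg B \<and>
     (\<forall>i\<in>J. boolean_alg (A i) \<and> \<phi> i \<in> bool_hom (A i) B) \<and>
     (\<forall>(D :: 'c gorder) f. boolean_alg D \<and> (\<forall>i\<in>J. f i \<in> bool_hom (A i) D) \<longrightarrow>
        (\<exists>!h. h \<in> bool_hom B D \<and> (\<forall>i\<in>J. compose (carrier (A i)) h (\<phi> i) = f i)))"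

text \<open>
  \<open>L\<close> is the MacNeille completion of its Boolean subalgebra \<open>A\<close>: it is complete, and \<open>A\<close> is both
  join-dense and meet-dense in it.
\<close>

definition macneille_completion :: "'a gorder \<Rightarrow> 'a gorder \<Rightarrow> bool" where
  "macneille_completion A L \<longleftrightarrow>
     boolean_alg A \<and> boolean_alg L \<and> complete_lattice L \<and>
     carrier A \<subseteq> carrier L \<and>
     (\<forall>x\<in>carrier A. \<forall>y\<in>carrier A. x \<sqsubseteq>\<^bsub>A\<^esub> y \<longleftrightarrow> x \<sqsubseteq>\<^bsub>L\<^esub> y) \<and>
     \<bottom>\<^bsub>L\<^esub> \<in> carrier A \<and> \<top>\<^bsub>L\<^esub> \<in> carrier A \<and>
     (\<forall>x\<in>carrier A. cmpl L x \<in> carrier A) \<and>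
     (\<forall>x\<in>carrier A. \<forall>y\<in>carrier A. x \<sqinter>\<^bsub>L\<^esub> y \<in> carrier A \<and> x \<squnion>\<^bsub>L\<^esub> y \<in> carrier A) \<and>
     (\<forall>x\<in>carrier L. x = \<Squnion>\<^bsub>L\<^esub> {a \<in> carrier A. a \<sqsubseteq>\<^bsub>L\<^esub> x}) \<and>
     (\<forall>x\<in>carrier L. x = \<Sqinter>\<^bsub>L\<^esub> {a \<in> carrier A. x \<sqsubseteq>\<^bsub>L\<^esub> a})"

definition is_ideal :: "('a, 'm) gorder_scheme \<Rightarrow> 'a set \<Rightarrow> bool" where
  "is_ideal L J \<longleftrightarrow> J \<subseteq> carrier L \<and> \<bottom>\<^bsub>L\<^esub> \<in> J \<and>
     (\<forall>x\<in>J. \<forall>y\<in>carrier L. y \<sqsubseteq>\<^bsub>L\<^esub> x \<longrightarrow> y \<in> J) \<and>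
     (\<forall>x\<in>J. \<forall>y\<in>J. x \<squnion>\<^bsub>L\<^esub> y \<in> J)"

definition ideal_generated :: "('a, 'm) gorder_scheme \<Rightarrow> 'a set \<Rightarrow> 'a set" where
  "ideal_generated L S = \<Inter>{J. is_ideal L J \<and> S \<subseteq> J}"


section \<open>Contact algebras and the category DHC\<close>

record 'a contact_alg = "'a gorder" +
  contact :: "'a \<Rightarrow> 'a \<Rightarrow> bool"

definition well_inside :: "('a, 'm) contact_alg_scheme \<Rightarrow> 'a \<Rightarrow> 'a \<Rightarrow> bool" where
  "well_inside B a b \<longleftrightarrow> \<not> contact B a (cmpl B b)"

locale contact_algebra = boolean_alg B for B (structure) +
  assumes C1: "\<lbrakk>a \<in> carrier B; a \<noteq> \<bottom>\<rbrakk> \<Longrightarrow> contact B a a"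
    and C2: "\<lbrakk>a \<in> carrier B; b \<in> carrier B; contact B a b\<rbrakk> \<Longrightarrow> a \<noteq> \<bottom> \<and> b \<noteq> \<bottom>"
    and C3: "\<lbrakk>a \<in> carrier B; b \<in> carrier B; contact B a b\<rbrakk> \<Longrightarrow> contact B b a"
    and C4: "\<lbrakk>a \<in> carrier B; b \<in> carrier B; c \<in> carrier B\<rbrakk>
      \<Longrightarrow> contact B a (b \<squnion> c) \<longleftrightarrow> contact B a b \<or> contact B a c"

locale normal_contact_algebra = contact_algebra +
  assumes C5: "\<lbrakk>a \<in> carrier B; b \<in> carrier B; \<not> contact B a b\<rbrakk>
      \<Longrightarrow> \<exists>c\<in>carrier B. \<not> contact B a c \<and> \<not> contact B b (cmpl B c)"
    and C6: "\<lbrakk>a \<in> carrier B; a \<noteq> \<top>\<rbrakk>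
      \<Longrightarrow> \<exists>b\<in>carrier B. b \<noteq> \<bottom> \<and> \<not> contact B b a"

locale cnca = normal_contact_algebra + complete_lattice B

definition CA_isomorphic ::
  "('a, 'm) contact_alg_scheme \<Rightarrow> ('b, 'n) contact_alg_scheme \<Rightarrow> bool" where
  "CA_isomorphic A B \<longleftrightarrow>
     (\<exists>f \<in> bool_hom A B. bij_betw f (carrier A) (carrier B) \<and>
        (\<forall>x\<in>carrier A. \<forall>y\<in>carrier A. contact A x y \<longleftrightarrow> contact B (f x) (f y)))"

definition check ::
  "('a, 'm) contact_alg_scheme \<Rightarrow> ('b, 'n) contact_alg_scheme \<Rightarrow> ('a \<Rightarrow> 'b) \<Rightarrow> 'a \<Rightarrow> 'b" where
  "check A B \<psi> = (\<lambda>a\<in>carrier A. \<Squnion>\<^bsub>B\<^esub> {\<psi> b | b. b \<in> carrier A \<and> well_inside A b a})"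

definition dhc_hom ::
  "('a, 'm) contact_alg_scheme \<Rightarrow> ('b, 'n) contact_alg_scheme \<Rightarrow> ('a \<Rightarrow> 'b) set" where
  "dhc_hom A B = {\<phi> \<in> carrier A \<rightarrow>\<^sub>E carrier B.
     \<phi> \<bottom>\<^bsub>A\<^esub> = \<bottom>\<^bsub>B\<^esub> \<and>
     (\<forall>a\<in>carrier A. \<forall>b\<in>carrier A. \<phi> (a \<sqinter>\<^bsub>A\<^esub> b) = \<phi> a \<sqinter>\<^bsub>B\<^esub> \<phi> b) \<and>
     (\<forall>a\<in>carrier A. \<forall>b\<in>carrier A.
        well_inside A a b \<longrightarrow> well_inside B (cmpl B (\<phi> (cmpl A a))) (\<phi> b)) \<and>
     (\<forall>a\<in>carrier A. \<phi> a = \<Squnion>\<^bsub>B\<^esub> {\<phi> b | b. b \<in> carrier A \<and> well_inside A b a})}"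

text \<open>\<open>dhc_comp A D \<phi>\<^sub>2 \<phi>\<^sub>1\<close> is the DHC-composition of \<open>\<phi>\<^sub>1\<close> from \<open>A\<close> with \<open>\<phi>\<^sub>2\<close> into \<open>D\<close>.\<close>

definition dhc_comp :: "('a, 'm) contact_alg_scheme \<Rightarrow> ('d, 'n) contact_alg_scheme \<Rightarrow>
    ('b \<Rightarrow> 'd) \<Rightarrow> ('a \<Rightarrow> 'b) \<Rightarrow> 'a \<Rightarrow> 'd" where
  "dhc_comp A D \<phi>\<^sub>2 \<phi>\<^sub>1 = check A D (\<phi>\<^sub>2 \<circ> \<phi>\<^sub>1)"

text \<open>
  \<open>dhc_sum TYPE('t) I A S \<iota>\<close>: the object \<open>S\<close> with injections \<open>\<iota> i\<close> is a DHC-sum of the objects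
  \<open>A i\<close>, \<open>i \<in> I\<close>, where the universal property is tested on the objects whose elements have
  type \<open>'t\<close>. Testing on the types of \<open>S\<close> and of another sum \<open>S'\<close> already determines \<open>S\<close> up to
  isomorphism.
\<close>

definition dhc_sum :: "'t itself \<Rightarrow> 'i set \<Rightarrow> ('i \<Rightarrow> 'a contact_alg) \<Rightarrow> 's contact_alg \<Rightarrow>
    ('i \<Rightarrow> 'a \<Rightarrow> 's) \<Rightarrow> bool" where
  "dhc_sum (_ :: 't itself) I A S \<iota> \<longleftrightarrow>
     cnca S \<and>
     (\<forall>i\<in>I. cnca (A i) \<and> \<iota> i \<in> dhc_hom (A i) S) \<and>
     (\<forall>(T :: 't contact_alg) f. cnca T \<and> (\<forall>i\<in>I. f i \<in> dhc_hom (A i) T) \<longrightarrow>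
        (\<exists>!h. h \<in> dhc_hom S T \<and> (\<forall>i\<in>I. dhc_comp (A i) T h (\<iota> i) = f i)))"


section \<open>Regular closed sets and the Tychonoff cube\<close>

text \<open>The Boolean operations of \<open>RC(X)\<close> are those induced by inclusion; see the lemmas below.\<close>

definition RC :: "'x topology \<Rightarrow> 'x set contact_alg" where
  "RC X = \<lparr>carrier = {F. F \<subseteq> topspace X \<and> F = X closure_of (X interior_of F)},
           eq = (=), le = (\<subseteq>), contact = (\<lambda>F G. F \<inter> G \<noteq> {})\<rparr>"

definition tychonoff_cube :: "'i set \<Rightarrow> ('i \<Rightarrow> real) topology" where
  "tychonoff_cube I = product_topology (\<lambda>_. top_of_set {0..1}) I"

lemma RC_simps [simp]:
  "F \<in> carrier (RC X) \<longleftrightarrow> F \<subseteq> topspace X \<and> F = X closure_of (X interior_of F)"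
  "eq (RC X) = (=)" "le (RC X) = (\<subseteq>)" "contact (RC X) F G \<longleftrightarrow> F \<inter> G \<noteq> {}"
  by (auto simp: RC_def)

lemma RC_partial_order: "partial_order (RC X)"
  by unfold_locales auto

lemma RC_closed: "F \<in> carrier (RC X) \<Longrightarrow> closedin X F"
  by (metis RC_simps(1) closedin_closure_of)

lemma RC_closure_of_open:
  assumes "openin X U" shows "X closure_of U \<in> carrier (RC X)"
proof -
  have "X closure_of U \<subseteq> X closure_of (X interior_of (X closure_of U))"
    using assms by (intro closure_of_mono interior_of_maximal closure_of_subset openin_subset)
  moreover have "X closure_of (X interior_of (X closure_of U)) \<subseteq> X closure_of U"
    by (meson closedin_closure_of closure_of_minimal interior_of_subset)
  ultimately show ?thesis
    by (simp add: closure_of_subset_topspace subset_antisym)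
qed

lemma RC_join:
  assumes F: "F \<in> carrier (RC X)" and G: "G \<in> carrier (RC X)"
  shows "F \<squnion>\<^bsub>RC X\<^esub> G = F \<union> G"
proof -
  interpret partial_order "RC X" by (rule RC_partial_order)
  have "F \<union> G = X closure_of (X interior_of F \<union> X interior_of G)"
    using F G by (simp add: closure_of_Un)
  hence "F \<union> G \<in> carrier (RC X)"
    by (metis RC_closure_of_open openin_Un openin_interior_of)
  hence "least (RC X) (F \<union> G) (Upper (RC X) {F, G})"
    using F G by (auto simp del: RC_simps(1) simp: least_def Upper_def)
  thus ?thesis
    unfolding join_def sup_def by (metis least_unique someI)
qed

lemma RC_meet:
  assumes F: "F \<in> carrier (RC X)" and G: "G \<in> carrier (RC X)"
  shows "F \<sqinter>\<^bsub>RC X\<^esub> G = X closure_of (X interior_of (F \<inter> G))"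
proof -
  interpret partial_order "RC X" by (rule RC_partial_order)
  let ?M = "X closure_of (X interior_of (F \<inter> G))"
  have M: "?M \<in> carrier (RC X)"
    by (simp del: RC_simps(1) add: RC_closure_of_open)
  have sub: "?M \<subseteq> F \<inter> G"
    by (meson F G RC_closed closedin_Int closure_of_minimal interior_of_subset)
  have "H \<subseteq> ?M" if "H \<in> carrier (RC X)" "H \<subseteq> F" "H \<subseteq> G" for H
    using that closure_of_mono[of "X interior_of H" "X interior_of (F \<inter> G)" X]
      interior_of_mono[of H "F \<inter> G" X] by auto
  with M sub F G have "greatest (RC X) ?M (Lower (RC X) {F, G})"
    by (auto simp del: RC_simps(1) simp: greatest_def Lower_def)
  thus ?thesis
    unfolding meet_def inf_def by (metis greatest_unique someI)
qed

lemma RC_bottom_top: "\<bottom>\<^bsub>RC X\<^esub> = {}" "\<top>\<^bsub>RC X\<^esub> = topspace X"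
proof -
  interpret partial_order "RC X" by (rule RC_partial_order)
  have "least (RC X) {} (carrier (RC X))" "greatest (RC X) (topspace X) (carrier (RC X))"
    by (auto simp: least_def greatest_def)
  thus "\<bottom>\<^bsub>RC X\<^esub> = {}" "\<top>\<^bsub>RC X\<^esub> = topspace X"
    unfolding bottom_def top_def by (metis least_unique someI, metis greatest_unique someI)
qed

lemma RC_cmpl:
  assumes F: "F \<in> carrier (RC X)"
  shows "cmpl (RC X) F = X closure_of (topspace X - F)"
proof -
  have op: "openin X (topspace X - F)"
    using F RC_closed by blast
  let ?G = "X closure_of (topspace X - F)"
  have G: "?G \<in> carrier (RC X)" using op by (rule RC_closure_of_open)
  have FG: "F \<union> ?G = topspace X"
    using F closure_of_subset[of "topspace X - F" X] closure_of_subset_topspace[of X]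
    by fastforce
  have intG: "?G = topspace X - X interior_of F"
    by (simp add: closure_of_complement)
  have disj: "X interior_of (F \<inter> ?G) = {}"
    unfolding interior_of_Int by (metis Diff_disjoint Int_mono interior_of_subset
        intG subset_empty subset_refl)
  have uniq: "H = ?G"
    if H: "H \<in> carrier (RC X)" and m: "X closure_of (X interior_of (F \<inter> H)) = {}"
      and j: "F \<union> H = topspace X" for H
  proof
    show "?G \<subseteq> H"
      using j by (intro closure_of_minimal RC_closed[OF H]) auto
    have "X interior_of (F \<inter> H) = {}"
      using m closure_of_eq_empty_gen[of X "X interior_of (F \<inter> H)"]
        interior_of_subset_topspace[of X "F \<inter> H"] closure_of_subset[of "X interior_of (F \<inter> H)" X]
      by auto
    hence "X interior_of H \<inter> X interior_of F = {}"
      by (simp add: interior_of_Int inf_commute)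
    hence "X interior_of H \<inter> F = {}"
      using F openin_Int_closure_of_eq_empty[of X "X interior_of H" "X interior_of F"] by simp
    hence "X interior_of H \<subseteq> topspace X - F"
      using interior_of_subset_topspace by fastforce
    thus "H \<subseteq> ?G"
      using H closure_of_mono by (metis RC_simps(1))
  qed
  show ?thesis
    unfolding cmpl_def
  proof (rule the_equality)
    show "?G \<in> carrier (RC X) \<and> F \<sqinter>\<^bsub>RC X\<^esub> ?G = \<bottom>\<^bsub>RC X\<^esub> \<and> F \<squnion>\<^bsub>RC X\<^esub> ?G = \<top>\<^bsub>RC X\<^esub>"
      unfolding RC_join[OF F G] RC_meet[OF F G] RC_bottom_top using G FG disj by simp
  next
    fix H
    assume *: "H \<in> carrier (RC X) \<and> F \<sqinter>\<^bsub>RC X\<^esub> H = \<bottom>\<^bsub>RC X\<^esub> \<and> F \<squnion>\<^bsub>RC X\<^esub> H = \<top>\<^bsub>RC X\<^esub>"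
    hence H: "H \<in> carrier (RC X)" by blast
    show "H = ?G"
      using * uniq[OF H] unfolding RC_join[OF F H] RC_meet[OF F H] RC_bottom_top by blast
  qed
qed


section \<open>The completed sum of power set algebras and its contact relations\<close>

definition Z0 :: "int set" where
  "Z0 = UNIV - {0}"

text \<open>Immediate predecessor and successor in \<^const>\<open>Z0\<close>, and its open rays.\<close>

definition prd :: "int \<Rightarrow> int" where
  "prd p = (if p = 1 then - 1 else p - 1)"

definition scc :: "int \<Rightarrow> int" where
  "scc p = (if p = - 1 then 1 else p + 1)"

definition succs :: "int \<Rightarrow> int set" where
  "succs p = {q \<in> Z0. q > p}"

definition preds :: "int \<Rightarrow> int set" where
  "preds p = {q \<in> Z0. q < p}"

definition powerset_Z0 :: "int set gorder" where
  "powerset_Z0 = \<lparr>carrier = Pow Z0, eq = (=), le = (\<subseteq>)\<rparr>"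

text \<open>
  Throughout, \<open>L\<close> is the completed sum and \<open>\<phi> i\<close> (for \<open>i \<ge> 1\<close>) the \<open>i\<close>-th canonical
  monomorphism. A tuple \<open>(n\<^sub>1, \<dots>, n\<^sub>k)\<close> is coded by \<open>k\<close> and a function \<open>n\<close>, of which only the
  values at \<open>1, \<dots>, k\<close> matter.
\<close>

definition is_tuple :: "nat \<Rightarrow> (nat \<Rightarrow> int) \<Rightarrow> bool" where
  "is_tuple k n \<longleftrightarrow> k \<ge> 1 \<and> (\<forall>i\<in>{1..k}. n i \<in> Z0)"

definition cell :: "'a gorder \<Rightarrow> (nat \<Rightarrow> int set \<Rightarrow> 'a) \<Rightarrow> nat \<Rightarrow> (nat \<Rightarrow> int) \<Rightarrow> 'a" where
  "cell L \<phi> k n = \<Sqinter>\<^bsub>L\<^esub> ((\<lambda>i. \<phi> i {n i}) ` {1..k})"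

definition qelem :: "'a gorder \<Rightarrow> (nat \<Rightarrow> int set \<Rightarrow> 'a) \<Rightarrow> nat \<Rightarrow> (nat \<Rightarrow> int) \<Rightarrow> nat \<Rightarrow> 'a" where
  "qelem L \<phi> k n r =
     (cell L \<phi> k (n(k := prd (n k))) \<sqinter>\<^bsub>L\<^esub> \<phi> (k + 1) (succs (int r))) \<squnion>\<^bsub>L\<^esub>
     (cell L \<phi> k n \<sqinter>\<^bsub>L\<^esub> \<phi> (k + 1) (preds (- int r)))"

definition B0 :: "'a gorder \<Rightarrow> (nat \<Rightarrow> int set \<Rightarrow> 'a) \<Rightarrow> 'a set" where
  "B0 L \<phi> = {cell L \<phi> k n | k n. is_tuple k n}"

definition B1 :: "'a gorder \<Rightarrow> (nat \<Rightarrow> int set \<Rightarrow> 'a) \<Rightarrow> 'a set" where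
  "B1 L \<phi> = {qelem L \<phi> k n r | k n r. is_tuple k n \<and> r \<ge> 1}"

definition B2 :: "(nat \<Rightarrow> int set \<Rightarrow> 'a) \<Rightarrow> 'a set" where
  "B2 \<phi> = {\<phi> 1 (succs (int n)) | n. n \<ge> (1::nat)} \<union> {\<phi> 1 (preds (- int n)) | n. n \<ge> (1::nat)}"

definition BB :: "'a gorder \<Rightarrow> (nat \<Rightarrow> int set \<Rightarrow> 'a) \<Rightarrow> 'a set" where
  "BB L \<phi> = ideal_generated L (B0 L \<phi> \<union> B1 L \<phi>)"

text \<open>
  The conditions (on codes) for contact of two elements of \<^const>\<open>B0\<close>, of two elements of
  \<^const>\<open>B1\<close> (both for \<open>k \<le> l\<close>), and of an element of \<^const>\<open>B1\<close> with one of \<^const>\<open>B0\<close>.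
\<close>

definition cond_bb :: "nat \<Rightarrow> (nat \<Rightarrow> int) \<Rightarrow> nat \<Rightarrow> (nat \<Rightarrow> int) \<Rightarrow> bool" where
  "cond_bb k n l n' \<longleftrightarrow> (\<forall>i\<in>{1..<k}. n i = n' i) \<and>
     (if k = l then n' k \<in> {prd (n k), n k, scc (n k)} else n' k = n k)"

definition cond_qq :: "nat \<Rightarrow> (nat \<Rightarrow> int) \<Rightarrow> nat \<Rightarrow> nat \<Rightarrow> (nat \<Rightarrow> int) \<Rightarrow> bool" where
  "cond_qq k n r l n' \<longleftrightarrow> (\<forall>i\<in>{1..<k}. n i = n' i) \<and>
     (if l = k then n' k = n k
      else if l = k + 1 then
        (n' k = n k \<and> n' (k + 1) \<le> - int r) \<or> (n' k = prd (n k) \<and> n' (k + 1) > int r)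
      else
        (n' k = n k \<and> n' (k + 1) < - int r) \<or> (n' k = prd (n k) \<and> n' (k + 1) > int r))"

definition cond_qb :: "nat \<Rightarrow> (nat \<Rightarrow> int) \<Rightarrow> nat \<Rightarrow> nat \<Rightarrow> (nat \<Rightarrow> int) \<Rightarrow> bool" where
  "cond_qb k n r l n' \<longleftrightarrow>
     (if k > l then \<forall>i\<in>{1..l}. n i = n' i
      else (\<forall>i\<in>{1..<k}. n i = n' i) \<and>
       (if l = k then n' k \<in> {prd (n k), n k}
        else if l = k + 1 then
          (n' (k + 1) \<ge> int r \<and> n' k = prd (n k)) \<or> (n' (k + 1) \<le> - int r \<and> n' k = n k)
        else
          (n' (k + 1) > int r \<and> n' k = prd (n k)) \<or> (n' (k + 1) < - int r \<and> n' k = n k)))"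

text \<open>
  The symmetric relation on \<open>B0 \<union> B1\<close>. It is stated on elements through their codes; distinct
  tuples (and distinct \<open>r\<close>) give distinct elements of the sum.
\<close>

inductive sigma_base :: "'a gorder \<Rightarrow> (nat \<Rightarrow> int set \<Rightarrow> 'a) \<Rightarrow> 'a \<Rightarrow> 'a \<Rightarrow> bool"
  for L \<phi> where
  bb: "\<lbrakk>is_tuple k n; is_tuple l n'; k \<le> l; cond_bb k n l n'\<rbrakk>
    \<Longrightarrow> sigma_base L \<phi> (cell L \<phi> k n) (cell L \<phi> l n')"
| qq: "\<lbrakk>is_tuple k n; is_tuple l n'; r \<ge> 1; r' \<ge> 1; k \<le> l; cond_qq k n r l n'\<rbrakk>
    \<Longrightarrow> sigma_base L \<phi> (qelem L \<phi> k n r) (qelem L \<phi> l n' r')"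
| qb: "\<lbrakk>is_tuple k n; is_tuple l n'; r \<ge> 1; cond_qb k n r l n'\<rbrakk>
    \<Longrightarrow> sigma_base L \<phi> (qelem L \<phi> k n r) (cell L \<phi> l n')"
| sym: "sigma_base L \<phi> x y \<Longrightarrow> sigma_base L \<phi> y x"

text \<open>
  \<open>separated L G R c d\<close>: \<open>c\<close> and \<open>d\<close> are covered by finitely many (at least one) elements of \<open>G\<close>
  which are pairwise not related by \<open>R\<close>.
\<close>

definition separated ::
  "'a gorder \<Rightarrow> 'a set \<Rightarrow> ('a \<Rightarrow> 'a \<Rightarrow> bool) \<Rightarrow> 'a \<Rightarrow> 'a \<Rightarrow> bool" where
  "separated L G R c d \<longleftrightarrow>
     (\<exists>S T. finite S \<and> finite T \<and> S \<noteq> {} \<and> T \<noteq> {} \<and> S \<subseteq> G \<and> T \<subseteq> G \<and>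
        c \<sqsubseteq>\<^bsub>L\<^esub> \<Squnion>\<^bsub>L\<^esub> S \<and> d \<sqsubseteq>\<^bsub>L\<^esub> \<Squnion>\<^bsub>L\<^esub> T \<and> (\<forall>x\<in>S. \<forall>y\<in>T. \<not> R x y))"

text \<open>
  The relation is extended from \<open>B0 \<union> B1\<close> to the ideal \<^const>\<open>BB\<close> by \<^const>\<open>separated\<close> and from there to
  all of \<open>L\<close>; on \<open>B0 \<union> B1\<close> it agrees with \<^const>\<open>sigma_base\<close>.
\<close>

definition sigma_tilde :: "'a gorder \<Rightarrow> (nat \<Rightarrow> int set \<Rightarrow> 'a) \<Rightarrow> 'a \<Rightarrow> 'a \<Rightarrow> bool" where
  "sigma_tilde L \<phi> a b \<longleftrightarrow>
     (\<exists>c\<in>BB L \<phi>. \<exists>d\<in>BB L \<phi>. c \<sqsubseteq>\<^bsub>L\<^esub> a \<and> d \<sqsubseteq>\<^bsub>L\<^esub> b \<and>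
        \<not> separated L (B0 L \<phi> \<union> B1 L \<phi>) (sigma_base L \<phi>) c d)"

definition sigma_tilde' :: "'a gorder \<Rightarrow> (nat \<Rightarrow> int set \<Rightarrow> 'a) \<Rightarrow> 'a \<Rightarrow> 'a \<Rightarrow> bool" where
  "sigma_tilde' L \<phi> c d \<longleftrightarrow>
     \<not> (c = \<bottom>\<^bsub>L\<^esub> \<or> d = \<bottom>\<^bsub>L\<^esub> \<or>
        separated L (B0 L \<phi> \<union> B1 L \<phi> \<union> B2 \<phi>) (sigma_tilde L \<phi>) c d)"

definition tilde_alg :: "'a gorder \<Rightarrow> (nat \<Rightarrow> int set \<Rightarrow> 'a) \<Rightarrow> 'a contact_alg" where
  "tilde_alg L \<phi> = \<lparr>carrier = carrier L, eq = eq L, le = le L, contact = sigma_tilde' L \<phi>\<rparr>"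

end

theory Submission
  imports Defs
begin

text \<open>
  By de Vries duality the functions \<open>\<phi>\<close> between complete normal contact algebras satisfying the
  DHC axioms are exactly the maps \<open>F \<mapsto> cl (g\<inverse> (int F))\<close> induced by the continuous maps \<open>g\<close> between
  the corresponding compact Hausdorff spaces, so that sums in DHC correspond to topological products.
  A complete normal contact algebra is recovered as the algebra of regular closed sets of its space of
  ends (maximal round filters). It remains to identify the algebra \<open>(L, \<sigma>')\<close> with \<open>RC [0, 1]\<close>: the
  cells \<open>\<phi>\<^sub>1 {n\<^sub>1} \<and> \<dots> \<and> \<phi>\<^sub>k {n\<^sub>k}\<close> form a dense tree in \<open>L\<close>, and so do, in \<open>RC [0, 1]\<close>, the intervals obtained by
  repeatedly cutting each open interval into a sequence of intervals of order type \<open>Z\<^sub>0\<close> that accumulates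
  only at its two end points. Under this identification the elements of \<open>B\<^sub>1\<close> are small closed
  neighbourhoods of the cut points, those of \<open>B\<^sub>2\<close> are neighbourhoods of \<open>0\<close> and \<open>1\<close>, and the combinatorial contact
  conditions say precisely that two such intervals meet; compactness then turns separation by finite covers into disjointness.
\<close>

section \<open>Ultrafilters\<close>

text \<open>Two obstacles shape the proof. The first is typing: the sum \<open>A\<close> is known
  only through a universal property for algebras on the type \<open>'a\<close>, so facts about it
  are extracted from test algebras on subsets of \<open>A\<close> itself; and a DHC test object
  lives on an arbitrary type, so its dual space is built from sets of its own elements. Duality is
  therefore stated for an algebra together with some space that represents it, whatever the type of
  the points. The second is that the first stage of the contact relation cannot see the points
  \<open>0\<close> and \<open>1\<close>: every generator from \<open>B0\<close> and
  \<open>B1\<close> is realised by a closed interval inside the open unit interval. So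
  \<open>sigma_tilde\<close> turns out to be contact at interior points only, and the rays in
  \<open>B2\<close> let the finite covers reach the end points. The order isomorphism is never
  computed by hand on arbitrary elements: it rests on the density of both trees and on the fact that
  two cells are incompatible in \<open>L\<close> exactly when their open intervals are
  disjoint.\<close>

definition ultra :: "('a, 'm) gorder_scheme \<Rightarrow> 'a set \<Rightarrow> bool" where
  "ultra L u \<longleftrightarrow> u \<subseteq> carrier L \<and> \<top>\<^bsub>L\<^esub> \<in> u \<and> \<bottom>\<^bsub>L\<^esub> \<notin> u \<and>
     (\<forall>x\<in>u. \<forall>y\<in>u. x \<sqinter>\<^bsub>L\<^esub> y \<in> u) \<and> (\<forall>x\<in>u. \<forall>y\<in>carrier L. x \<sqsubseteq>\<^bsub>L\<^esub> y \<longrightarrow> y \<in> u) \<and>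
     (\<forall>x\<in>carrier L. x \<in> u \<or> cmpl L x \<in> u)"

context boolean_alg
begin

lemma bot_join: "x \<in> carrier L \<Longrightarrow> \<bottom> \<squnion> x = x"
  using le_iff_meet[of \<bottom> x] bottom_lower by simp

lemma meet_top: "x \<in> carrier L \<Longrightarrow> x \<sqinter> \<top> = x"
  using le_iff_join[of x \<top>] top_higher by simp

lemma cmpl_unique:
  assumes c: "x \<in> carrier L" "y \<in> carrier L" "z \<in> carrier L"
    and e: "x \<sqinter> y = \<bottom>" "x \<squnion> y = \<top>" "x \<sqinter> z = \<bottom>" "x \<squnion> z = \<top>"
  shows "y = z"
proof -
  have "y = y \<sqinter> z"
    using distrib[OF c(2,1,3)] e(1,4) c bot_join meet_top by (simp add: meet_comm)
  also have "\<dots> = z"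
    using distrib[OF c(3,1,2)] e(2,3) c bot_join meet_top by (simp add: meet_comm)
  finally show ?thesis .
qed

lemma cmpl_props:
  assumes "x \<in> carrier L"
  shows "cmpl L x \<in> carrier L" "x \<sqinter> cmpl L x = \<bottom>" "x \<squnion> cmpl L x = \<top>"
proof -
  have "\<exists>!y. y \<in> carrier L \<and> x \<sqinter> y = \<bottom> \<and> x \<squnion> y = \<top>"
    using compl_exists[OF assms] cmpl_unique[OF assms] by blast
  from theI'[OF this] show "cmpl L x \<in> carrier L" "x \<sqinter> cmpl L x = \<bottom>" "x \<squnion> cmpl L x = \<top>"
    unfolding cmpl_def by blast+
qed

lemma le_cmpl_if_disjoint:
  assumes "x \<in> carrier L" "y \<in> carrier L" "x \<sqinter> y = \<bottom>"
  shows "x \<sqsubseteq> cmpl L y"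
proof -
  have "x = x \<sqinter> cmpl L y"
    using distrib[of x y "cmpl L y"] assms cmpl_props[of y] bot_join meet_top by simp
  then show ?thesis
    using le_iff_join[of x "cmpl L y"] assms cmpl_props by blast
qed

text \<open>Zorn's lemma enlarges the filter generated by \<open>R\<close> to a maximal one, and a
  maximal filter decides every element. Directedness is assumed instead of closure under meets
  because the families used later consist of complements of elements with a join-stable
  property.\<close>

lemma ultrafilter_extension:
  assumes R: "R \<subseteq> carrier L" "R \<noteq> {}" "\<bottom> \<notin> R"
    and dir: "\<And>x y. x \<in> R \<Longrightarrow> y \<in> R \<Longrightarrow> \<exists>z\<in>R. z \<sqsubseteq> x \<and> z \<sqsubseteq> y"
  shows "\<exists>u. ultra L u \<and> R \<subseteq> u"
proof -
  define filt where "filt F \<longleftrightarrow> F \<subseteq> carrier L \<and> F \<noteq> {} \<and> \<bottom> \<notin> F \<and>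
     (\<forall>x\<in>F. \<forall>y\<in>F. x \<sqinter> y \<in> F) \<and> (\<forall>x\<in>F. \<forall>y\<in>carrier L. x \<sqsubseteq> y \<longrightarrow> y \<in> F)" for F
  define F0 where "F0 = {z \<in> carrier L. \<exists>x\<in>R. x \<sqsubseteq> z}"
  have "filt F0"
    unfolding filt_def
  proof (intro conjI ballI impI)
    show "F0 \<subseteq> carrier L" by (auto simp: F0_def)
    show "F0 \<noteq> {}" using R by (auto simp: F0_def)
    show "\<bottom> \<notin> F0" using R bottom_lower le_antisym by (auto simp: F0_def subset_iff)
    fix x y assume "x \<in> F0" "y \<in> F0"
    then obtain a b where ab: "a \<in> R" "b \<in> R" "a \<sqsubseteq> x" "b \<sqsubseteq> y" "x \<in> carrier L" "y \<in> carrier L"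
      by (auto simp: F0_def)
    then obtain z where "z \<in> R" "z \<sqsubseteq> a" "z \<sqsubseteq> b" using dir by blast
    then have "z \<sqsubseteq> x \<sqinter> y" using ab R by (meson le_trans meet_le subsetD)
    then show "x \<sqinter> y \<in> F0" using \<open>z \<in> R\<close> ab by (auto simp: F0_def)
  next
    fix x y assume "x \<in> F0" "y \<in> carrier L" "x \<sqsubseteq> y"
    then show "y \<in> F0" using R by (auto simp: F0_def) (meson le_trans subsetD)
  qed
  have RF0: "R \<subseteq> F0" using R unfolding F0_def by blast
  let ?S = "{F. filt F \<and> F0 \<subseteq> F}"
  have "\<exists>M\<in>?S. \<forall>X\<in>?S. M \<subseteq> X \<longrightarrow> X = M"
  proof (rule subset_Zorn_nonempty)
    show "?S \<noteq> {}" using \<open>filt F0\<close> by auto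
    fix C assume C: "C \<noteq> {}" "subset.chain ?S C"
    then have CS: "\<And>F. F \<in> C \<Longrightarrow> filt F \<and> F0 \<subseteq> F" and
      ch: "\<And>F G. F \<in> C \<Longrightarrow> G \<in> C \<Longrightarrow> F \<subseteq> G \<or> G \<subseteq> F"
      by (auto simp: subset_chain_def)
    have "filt (\<Union>C)"
      unfolding filt_def
    proof (intro conjI ballI impI)
      show "\<Union>C \<subseteq> carrier L" using CS by (meson Sup_least filt_def)
      show "\<bottom> \<notin> \<Union>C" using CS by (auto simp: filt_def)
      show "\<Union>C \<noteq> {}" using CS C(1) by (fastforce simp: filt_def)
      fix x y assume "x \<in> \<Union>C" "y \<in> \<Union>C"
      then obtain F where "F \<in> C" "x \<in> F" "y \<in> F" using ch by blast
      then show "x \<sqinter> y \<in> \<Union>C" using CS unfolding filt_def by blast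
    next
      fix x y assume "x \<in> \<Union>C" "y \<in> carrier L" "x \<sqsubseteq> y"
      then show "y \<in> \<Union>C" using CS unfolding filt_def by blast
    qed
    then show "\<Union>C \<in> ?S" using CS C(1) by blast
  qed
  then obtain M where M: "filt M" "F0 \<subseteq> M" and max: "\<And>X. filt X \<Longrightarrow> M \<subseteq> X \<Longrightarrow> X = M"
    by (auto; meson subset_trans)
  have Mc: "M \<subseteq> carrier L" and Mne: "M \<noteq> {}" and Mb: "\<bottom> \<notin> M"
    and Mm: "\<And>x y. x \<in> M \<Longrightarrow> y \<in> M \<Longrightarrow> x \<sqinter> y \<in> M"
    and Mu: "\<And>x y. x \<in> M \<Longrightarrow> y \<in> carrier L \<Longrightarrow> x \<sqsubseteq> y \<Longrightarrow> y \<in> M"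
    using M(1) by (auto simp: filt_def)
  have "x \<in> M \<or> cmpl L x \<in> M" if x: "x \<in> carrier L" for x
  proof (rule ccontr)
    assume n: "\<not> (x \<in> M \<or> cmpl L x \<in> M)"
    \<comment> \<open>The filter generated by \<open>M\<close> and \<open>x\<close>. It is proper,
      because \<open>f \<sqinter> x = \<bottom>\<close> would put \<open>cmpl L x\<close> into
      \<open>M\<close>; maximality of \<open>M\<close> then forces \<open>x\<close> into
      \<open>M\<close>.\<close>
    define G where "G = {z \<in> carrier L. \<exists>f\<in>M. f \<sqinter> x \<sqsubseteq> z}"
    have "filt G"
      unfolding filt_def
    proof (intro conjI ballI impI)
      show "G \<subseteq> carrier L" by (auto simp: G_def)
      show "G \<noteq> {}" using Mne Mc x unfolding G_def by (blast intro: le_refl meet_closed)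
      show "\<bottom> \<notin> G"
      proof
        assume "\<bottom> \<in> G"
        then obtain f where f: "f \<in> M" "f \<sqinter> x \<sqsubseteq> \<bottom>" by (auto simp: G_def)
        have fc: "f \<in> carrier L" using f Mc by auto
        have "f \<sqinter> x = \<bottom>"
          using le_antisym[OF f(2) bottom_lower] fc x by simp
        then have "f \<sqsubseteq> cmpl L x" by (rule le_cmpl_if_disjoint[OF fc x])
        then show False using Mu[OF f(1) cmpl_props(1)[OF x]] n by simp
      qed
      fix a b assume "a \<in> G" "b \<in> G"
      then obtain f g where fg: "f \<in> M" "g \<in> M" "f \<sqinter> x \<sqsubseteq> a" "g \<sqinter> x \<sqsubseteq> b" "a \<in> carrier L" "b \<in> carrier L"
        by (auto simp: G_def)
      have fc: "f \<in> carrier L" "g \<in> carrier L" using fg Mc by auto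
      have h: "(f \<sqinter> g) \<sqinter> x \<sqsubseteq> f \<sqinter> g" "f \<sqinter> g \<sqsubseteq> f" "f \<sqinter> g \<sqsubseteq> g"
        using fc x by (simp_all add: meet_left meet_right)
      have "(f \<sqinter> g) \<sqinter> x \<sqsubseteq> f" "(f \<sqinter> g) \<sqinter> x \<sqsubseteq> g" "(f \<sqinter> g) \<sqinter> x \<sqsubseteq> x"
        using fc x le_trans[OF h(1,2)] le_trans[OF h(1,3)] by (simp_all add: meet_right)
      then have "(f \<sqinter> g) \<sqinter> x \<sqsubseteq> f \<sqinter> x" "(f \<sqinter> g) \<sqinter> x \<sqsubseteq> g \<sqinter> x"
        using fc x by (simp_all add: meet_le)
      then have "(f \<sqinter> g) \<sqinter> x \<sqsubseteq> a" "(f \<sqinter> g) \<sqinter> x \<sqsubseteq> b"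
        using fg fc x le_trans[of "(f \<sqinter> g) \<sqinter> x"] by (meson meet_closed)+
      then have "(f \<sqinter> g) \<sqinter> x \<sqsubseteq> a \<sqinter> b"
        using fg fc x by (simp add: meet_le)
      then show "a \<sqinter> b \<in> G" using fg Mm by (auto simp: G_def)
    next
      fix a b assume "a \<in> G" "b \<in> carrier L" "a \<sqsubseteq> b"
      then show "b \<in> G" using Mc x by (auto simp: G_def) (meson le_trans meet_closed subsetD)
    qed
    moreover have "M \<subseteq> G" using Mc x unfolding G_def by (blast intro: meet_left)
    ultimately have "G = M" by (rule max)
    moreover have "x \<in> G" using Mne Mc x unfolding G_def by (blast intro: meet_right)
    ultimately show False using n by blast
  qed
  have "ultra L M"
  proof -
    obtain m where "m \<in> M" using Mne by blast
    then have "\<top> \<in> M" using Mu[OF _ top_closed top_higher] Mc by blast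
    then show ?thesis
      using \<open>\<And>x. x \<in> carrier L \<Longrightarrow> x \<in> M \<or> cmpl L x \<in> M\<close> Mc Mb Mm Mu by (auto simp: ultra_def)
  qed
  then show ?thesis using RF0 M(2) by blast
qed

lemma ultraD:
  assumes "ultra L u"
  shows "\<top> \<in> u" "\<bottom> \<notin> u" "u \<subseteq> carrier L"
    "x \<in> carrier L \<Longrightarrow> y \<in> carrier L \<Longrightarrow> x \<sqinter> y \<in> u \<longleftrightarrow> x \<in> u \<and> y \<in> u"
    "x \<in> carrier L \<Longrightarrow> y \<in> carrier L \<Longrightarrow> x \<squnion> y \<in> u \<longleftrightarrow> x \<in> u \<or> y \<in> u"
    "x \<in> carrier L \<Longrightarrow> cmpl L x \<in> u \<longleftrightarrow> x \<notin> u"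
proof -
  note u = assms[unfolded ultra_def]
  show "\<top> \<in> u" "\<bottom> \<notin> u" "u \<subseteq> carrier L" using u by auto
  show m: "x \<sqinter> y \<in> u \<longleftrightarrow> x \<in> u \<and> y \<in> u" if "x \<in> carrier L" "y \<in> carrier L" for x y
    using u that by (meson meet_closed meet_left meet_right)
  show c: "cmpl L x \<in> u \<longleftrightarrow> x \<notin> u" if "x \<in> carrier L" for x
    using u that m[of x "cmpl L x"] cmpl_props[of x] by auto
  show "x \<squnion> y \<in> u \<longleftrightarrow> x \<in> u \<or> y \<in> u" if xy: "x \<in> carrier L" "y \<in> carrier L" for x y
  proof
    assume j: "x \<squnion> y \<in> u"
    show "x \<in> u \<or> y \<in> u"
    proof (rule ccontr)
      assume "\<not> (x \<in> u \<or> y \<in> u)"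
      then have "cmpl L x \<in> u" using c xy by blast
      then have "cmpl L x \<sqinter> (x \<squnion> y) \<in> u" using j u by blast
      moreover have "cmpl L x \<sqinter> (x \<squnion> y) = cmpl L x \<sqinter> y"
        using xy cmpl_props[of x] distrib[of "cmpl L x" x y]
        by (metis bottom_lower le_iff_meet meet_closed meet_comm)
      ultimately have "y \<in> u" using m xy cmpl_props by metis
      then show False using \<open>\<not> (x \<in> u \<or> y \<in> u)\<close> by blast
    qed
  next
    assume "x \<in> u \<or> y \<in> u"
    then show "x \<squnion> y \<in> u" using u xy by (meson join_closed join_left join_right)
  qed
qed

text \<open>Together with \<open>ultraD\<close> this turns Boolean identities and inequalities into propositional ones.\<close>

lemma le_iff_stone:
  assumes "x \<in> carrier L" "y \<in> carrier L"
  shows "x \<sqsubseteq> y \<longleftrightarrow> (\<forall>u. ultra L u \<longrightarrow> x \<in> u \<longrightarrow> y \<in> u)"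
proof
  assume "x \<sqsubseteq> y" then show "\<forall>u. ultra L u \<longrightarrow> x \<in> u \<longrightarrow> y \<in> u"
    using assms by (auto simp: ultra_def)
next
  assume r: "\<forall>u. ultra L u \<longrightarrow> x \<in> u \<longrightarrow> y \<in> u"
  have "x \<sqinter> cmpl L y = \<bottom>"
  proof (rule ccontr)
    assume "x \<sqinter> cmpl L y \<noteq> \<bottom>"
    then obtain u where u: "ultra L u" "x \<sqinter> cmpl L y \<in> u"
      using ultrafilter_extension[of "{x \<sqinter> cmpl L y}"] assms cmpl_props by auto
    then have "x \<in> u" "y \<notin> u"
      using assms ultraD(4)[OF u(1), of x "cmpl L y"] ultraD(6)[OF u(1), of y] cmpl_props(1) by auto
    then show False using r u(1) by blast
  qed
  then have "x = x \<sqinter> y \<squnion> \<bottom>"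
    using assms cmpl_props[of y] distrib[of x y "cmpl L y"] le_iff_join[of x \<top>] top_higher by auto
  also have "\<dots> = x \<sqinter> y"
    using assms by (metis bottom_lower bottom_closed join_comm le_iff_meet meet_closed)
  finally show "x \<sqsubseteq> y" using le_iff_join[OF assms] by simp
qed

lemma eq_iff_stone:
  assumes "x \<in> carrier L" "y \<in> carrier L"
  shows "x = y \<longleftrightarrow> (\<forall>u. ultra L u \<longrightarrow> x \<in> u \<longleftrightarrow> y \<in> u)"
  using le_iff_stone[OF assms] le_iff_stone[OF assms(2,1)] le_antisym[OF _ _ assms] le_refl[OF assms(1)]
  by auto

end

section \<open>Regular closed algebras\<close>

text \<open>A neighbourhood of a point on the right meets \<open>U\<close>, and the resulting open
  set still lies in the closure of \<open>V\<close>, so it meets \<open>V\<close> as well. This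
  identity lets finite intersections of open sets stand for meets of regular closed sets.\<close>

lemma interior_closure_Int:
  assumes "openin X U" "openin X V"
  shows "X interior_of (X closure_of (U \<inter> V)) = X interior_of (X closure_of U) \<inter> X interior_of (X closure_of V)"
proof (rule subset_antisym)
  show "X interior_of (X closure_of (U \<inter> V)) \<subseteq> X interior_of (X closure_of U) \<inter> X interior_of (X closure_of V)"
    by (simp add: closure_of_mono interior_of_mono)
  let ?W = "X interior_of (X closure_of U) \<inter> X interior_of (X closure_of V)"
  have W: "openin X ?W" by (intro openin_Int openin_interior_of)
  have "?W \<subseteq> X closure_of (U \<inter> V)"
  proof
    fix p assume p: "p \<in> ?W"
    have "T \<inter> (U \<inter> V) \<noteq> {}" if T: "p \<in> T" "openin X T" for T
    proof -
      have o: "openin X (?W \<inter> T)" using W T(2) by (rule openin_Int)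
      have "(?W \<inter> T) \<inter> X closure_of U \<noteq> {}"
        using p T(1) interior_of_subset[of X "X closure_of U"] by blast
      then have "((?W \<inter> T) \<inter> U) \<inter> X closure_of V \<noteq> {}"
        using openin_Int_closure_of_eq_empty[OF o, of U] interior_of_subset[of X "X closure_of V"] by blast
      then show ?thesis
        using openin_Int_closure_of_eq_empty[OF openin_Int[OF o assms(1)], of V] by blast
    qed
    moreover have "p \<in> topspace X"
      using p interior_of_subset_topspace[of X "X closure_of U"] by blast
    ultimately show "p \<in> X closure_of (U \<inter> V)"
      by (simp add: in_closure_of) blast
  qed
  then show "?W \<subseteq> X interior_of (X closure_of (U \<inter> V))"
    by (rule interior_of_maximal[OF _ W])
qed

lemma RC_closure_interior: "F \<in> carrier (RC X) \<Longrightarrow> X closure_of (X interior_of F) = F"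
  by simp

lemma RC_subset_topspace: "F \<in> carrier (RC X) \<Longrightarrow> F \<subseteq> topspace X"
  by simp

lemma RC_cl_int: "X closure_of (X interior_of S) \<in> carrier (RC X)"
  by (rule RC_closure_of_open) simp

lemma RC_sup_least:
  assumes "S \<subseteq> carrier (RC X)"
  shows "least (RC X) (X closure_of (\<Union>F\<in>S. X interior_of F)) (Upper (RC X) S)"
proof -
  let ?U = "\<Union>F\<in>S. X interior_of F"
  have "X closure_of ?U \<in> carrier (RC X)" by (rule RC_closure_of_open) (auto intro: openin_Union)
  moreover have "F \<subseteq> X closure_of ?U" if "F \<in> S" for F
    using closure_of_mono[of "X interior_of F" ?U X] RC_closure_interior[of F X] that assms by blast
  moreover have "X closure_of ?U \<subseteq> G" if "G \<in> carrier (RC X)" "\<And>F. F \<in> S \<Longrightarrow> F \<subseteq> G" for G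
    using that RC_closed interior_of_subset by (intro closure_of_minimal) fast+
  ultimately show ?thesis
    using assms unfolding least_def Upper_def by (simp del: RC_simps(1)) blast
qed

lemma RC_inf_greatest:
  assumes "S \<subseteq> carrier (RC X)"
  shows "greatest (RC X) (X closure_of (X interior_of (topspace X \<inter> \<Inter>S))) (Lower (RC X) S)"
proof -
  let ?V = "X interior_of (topspace X \<inter> \<Inter>S)"
  have "X closure_of ?V \<subseteq> F" if "F \<in> S" for F
    using that assms RC_closed interior_of_subset[of X "topspace X \<inter> \<Inter>S"]
    by (intro closure_of_minimal) fast+
  moreover have "G \<subseteq> X closure_of ?V" if G: "G \<in> carrier (RC X)" "\<And>F. F \<in> S \<Longrightarrow> G \<subseteq> F" for G
  proof -
    have "X interior_of G \<subseteq> ?V"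
      by (rule interior_of_mono) (use G RC_subset_topspace in blast)
    then show ?thesis
      using closure_of_mono RC_closure_interior[OF G(1)] by blast
  qed
  ultimately show ?thesis
    using assms RC_cl_int[of X] unfolding greatest_def Lower_def by (simp del: RC_simps(1)) blast
qed

lemma RC_complete_lattice: "complete_lattice (RC X)"
  using partial_order.complete_latticeI[OF RC_partial_order] RC_sup_least RC_inf_greatest by blast

text \<open>Distributivity is inherited from the lattice of open sets: each regular closed set is
  replaced by its interior, and \<open>interior_closure_Int\<close> carries the intersection through
  the closure.\<close>

lemma RC_boolean_alg: "boolean_alg (RC X)"
proof -
  interpret complete_lattice "RC X" by (rule RC_complete_lattice)
  show ?thesis
  proof (unfold_locales)
    fix F G H assume FGH: "F \<in> carrier (RC X)" "G \<in> carrier (RC X)" "H \<in> carrier (RC X)"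
    let ?i = "\<lambda>F. X interior_of F"
    have c: "X closure_of (?i (A \<inter> B)) = X closure_of (?i A \<inter> ?i B)" for A B
      by (simp add: interior_of_Int)
    have i: "?i A = ?i (X closure_of (?i A))" if "A \<in> carrier (RC X)" for A
      using RC_closure_interior that by metis
    have "F \<sqinter>\<^bsub>RC X\<^esub> (G \<squnion>\<^bsub>RC X\<^esub> H) = X closure_of (?i F \<inter> ?i (X closure_of (?i G \<union> ?i H)))"
      using FGH by (simp only: RC_meet join_closed c) (simp only: RC_join closure_of_Un RC_closure_interior)
    also have "\<dots> = X closure_of (?i (X closure_of (?i F)) \<inter> ?i (X closure_of (?i G \<union> ?i H)))"
      using i[OF FGH(1)] by metis
    also have "\<dots> = X closure_of (?i (X closure_of (?i F \<inter> (?i G \<union> ?i H))))"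
      by (subst interior_closure_Int) auto
    also have "\<dots> = X closure_of (?i F \<inter> (?i G \<union> ?i H))"
      by (rule RC_closure_interior[OF RC_closure_of_open]) (intro openin_Int openin_Un openin_interior_of)
    also have "\<dots> = X closure_of (?i F \<inter> ?i G) \<union> X closure_of (?i F \<inter> ?i H)"
      by (simp add: Int_Un_distrib closure_of_Un)
    also have "\<dots> = (F \<sqinter>\<^bsub>RC X\<^esub> G) \<squnion>\<^bsub>RC X\<^esub> (F \<sqinter>\<^bsub>RC X\<^esub> H)"
      using FGH by (simp only: RC_join meet_closed) (simp only: RC_meet c)
    finally show "F \<sqinter>\<^bsub>RC X\<^esub> (G \<squnion>\<^bsub>RC X\<^esub> H) = (F \<sqinter>\<^bsub>RC X\<^esub> G) \<squnion>\<^bsub>RC X\<^esub> (F \<sqinter>\<^bsub>RC X\<^esub> H)" .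
  next
    fix F assume F: "F \<in> carrier (RC X)"
    let ?G = "X closure_of (topspace X - F)"
    have G: "?G \<in> carrier (RC X)" using RC_closed[OF F] by (intro RC_closure_of_open) blast
    have "F \<union> ?G = topspace X"
      using RC_subset_topspace[OF F] closure_of_subset[of "topspace X - F" X] closure_of_subset_topspace[of X] by blast
    moreover have "X interior_of (F \<inter> ?G) = {}"
      using interior_of_subset[of X ?G]
      by (auto simp: interior_of_Int closure_of_complement)
    ultimately show "\<exists>G\<in>carrier (RC X). F \<sqinter>\<^bsub>RC X\<^esub> G = \<bottom>\<^bsub>RC X\<^esub> \<and> F \<squnion>\<^bsub>RC X\<^esub> G = \<top>\<^bsub>RC X\<^esub>"
      using G F by (intro bexI[OF _ G]) (simp only: RC_meet RC_join RC_bottom_top closure_of_empty)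
  qed
qed

section \<open>Contact algebras represented by compact Hausdorff spaces\<close>

lemma (in partial_order) sup_eqI:
  assumes "S \<subseteq> carrier L" "z \<in> carrier L" "\<And>x. x \<in> S \<Longrightarrow> x \<sqsubseteq> z"
    and "\<And>y. y \<in> carrier L \<Longrightarrow> (\<And>x. x \<in> S \<Longrightarrow> x \<sqsubseteq> y) \<Longrightarrow> z \<sqsubseteq> y"
  shows "\<Squnion>S = z"
proof -
  have "least L z (Upper L S)"
    using assms by (intro least_UpperI) (simp_all add: Upper_def subset_iff)
  then show ?thesis unfolding sup_def by (metis least_unique someI)
qed

lemma (in partial_order) inf_eqI:
  assumes "S \<subseteq> carrier L" "z \<in> carrier L" "\<And>x. x \<in> S \<Longrightarrow> z \<sqsubseteq> x"
    and "\<And>y. y \<in> carrier L \<Longrightarrow> (\<And>x. x \<in> S \<Longrightarrow> y \<sqsubseteq> x) \<Longrightarrow> y \<sqsubseteq> z"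
  shows "\<Sqinter>S = z"
proof -
  have "greatest L z (Lower L S)"
    using assms by (intro greatest_LowerI) (simp_all add: Lower_def subset_iff)
  then show ?thesis unfolding inf_def by (metis greatest_unique someI)
qed

text \<open>A faithful picture of \<open>A\<close> as the algebra of all regular closed sets of
  \<open>X\<close>. Only order and contact are prescribed, since the order determines all Boolean
  operations. The interval, its powers and spaces of ends all become instances.\<close>

locale represented = boolean_alg A for A :: "'a contact_alg" (structure) +
  fixes X :: "'x topology" and e :: "'a \<Rightarrow> 'x set"
  assumes complete: "complete_lattice A"
    and compact: "compact_space X" and Hausdorff: "Hausdorff_space X"
    and bij: "bij_betw e (carrier A) (carrier (RC X))"
    and le_iff: "\<lbrakk>a \<in> carrier A; b \<in> carrier A\<rbrakk> \<Longrightarrow> a \<sqsubseteq> b \<longleftrightarrow> e a \<subseteq> e b"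
    and contact_iff: "\<lbrakk>a \<in> carrier A; b \<in> carrier A\<rbrakk> \<Longrightarrow> contact A a b \<longleftrightarrow> e a \<inter> e b \<noteq> {}"
begin

text \<open>The regular open partner of \<open>e a\<close>. Meets become plain intersections of such
  sets, and well-insideness becomes the inclusion \<open>e a \<subseteq> op b\<close>.\<close>

definition op :: "'a \<Rightarrow> 'x set" where
  "op a = X interior_of (e a)"

lemma e_RC: "a \<in> carrier A \<Longrightarrow> e a \<in> carrier (RC X)"
  using bij by (meson bij_betwE)

lemma e_surj: "F \<in> carrier (RC X) \<Longrightarrow> \<exists>a\<in>carrier A. e a = F"
  using bij unfolding bij_betw_def by (metis imageE)

lemma e_eq_iff: "\<lbrakk>a \<in> carrier A; b \<in> carrier A\<rbrakk> \<Longrightarrow> e a = e b \<longleftrightarrow> a = b"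
  using bij by (meson bij_betw_imp_inj_on inj_on_eq_iff)

lemma e_closed: "a \<in> carrier A \<Longrightarrow> closedin X (e a)"
  using e_RC RC_closed by blast

lemma e_subset: "a \<in> carrier A \<Longrightarrow> e a \<subseteq> topspace X"
  using e_RC RC_subset_topspace by blast

lemma op_open [simp]: "openin X (op a)"
  by (simp add: op_def)

lemma op_subset: "op a \<subseteq> e a"
  by (simp add: op_def interior_of_subset)

lemma closure_op: "a \<in> carrier A \<Longrightarrow> X closure_of (op a) = e a"
  unfolding op_def by (rule RC_closure_interior[OF e_RC])

lemma ex_closure:
  assumes "openin X U"
  shows "\<exists>a\<in>carrier A. e a = X closure_of U"
  using e_surj RC_closure_of_open[OF assms] by blast

lemma op_mono: "\<lbrakk>a \<in> carrier A; b \<in> carrier A\<rbrakk> \<Longrightarrow> a \<sqsubseteq> b \<Longrightarrow> op a \<subseteq> op b"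
  by (simp add: le_iff op_def interior_of_mono)

lemma e_sup:
  assumes S: "S \<subseteq> carrier A"
  shows "\<Squnion>S \<in> carrier A" "e (\<Squnion>S) = X closure_of (\<Union>a\<in>S. op a)"
proof -
  obtain z where z: "z \<in> carrier A" "e z = X closure_of (\<Union>a\<in>S. op a)"
    using ex_closure[OF openin_Union[of "op ` S"]] op_open by blast
  have "\<Squnion>S = z"
  proof (rule sup_eqI[OF S z(1)])
    fix x assume x: "x \<in> S"
    then have "X closure_of (op x) \<subseteq> e z"
      unfolding z(2) by (intro closure_of_mono) blast
    then show "x \<sqsubseteq> z" using x S z(1) by (simp add: subset_iff le_iff closure_op)
  next
    fix y assume y: "y \<in> carrier A" "\<And>x. x \<in> S \<Longrightarrow> x \<sqsubseteq> y"
    then have "op x \<subseteq> e y" if "x \<in> S" for x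
      using that S le_iff[of x y] op_subset[of x] by blast
    then have "e z \<subseteq> e y"
      unfolding z(2) by (intro closure_of_minimal e_closed y) blast
    then show "z \<sqsubseteq> y" using le_iff z y by blast
  qed
  then show "\<Squnion>S \<in> carrier A" "e (\<Squnion>S) = X closure_of (\<Union>a\<in>S. op a)"
    using z by auto
qed

lemma e_join: "\<lbrakk>a \<in> carrier A; b \<in> carrier A\<rbrakk> \<Longrightarrow> e (a \<squnion> b) = e a \<union> e b"
  using e_sup(2)[of "{a, b}"] closure_op by (simp add: join_def closure_of_Un)

lemma e_bot: "e \<bottom> = {}"
proof -
  have "{} \<in> carrier (RC X)" by simp
  then obtain z where "z \<in> carrier A" "e z = {}" using e_surj by blast
  then show ?thesis using bottom_lower[of z] le_iff[of \<bottom> z] by auto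
qed

lemma e_top: "e \<top> = topspace X"
proof -
  have "topspace X \<in> carrier (RC X)" by simp
  then obtain z where "z \<in> carrier A" "e z = topspace X" using e_surj by blast
  then show ?thesis using top_higher[of z] le_iff[of z \<top>] e_subset[of \<top>] by auto
qed

lemma e_meet:
  assumes "a \<in> carrier A" "b \<in> carrier A"
  shows "e (a \<sqinter> b) = X closure_of (op a \<inter> op b)"
proof -
  obtain z where z: "z \<in> carrier A" "e z = X closure_of (op a \<inter> op b)"
    using ex_closure[OF openin_Int[OF op_open op_open]] by blast
  have "a \<sqinter> b = z"
    unfolding meet_def
  proof (rule inf_eqI[OF _ z(1)])
    fix x assume x: "x \<in> {a, b}"
    then have "e z \<subseteq> X closure_of (op x)"
      unfolding z(2) by (intro closure_of_mono) blast
    then show "z \<sqsubseteq> x" using x assms z(1) by (auto simp: le_iff closure_op)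
  next
    fix y assume y: "y \<in> carrier A" "\<And>x. x \<in> {a, b} \<Longrightarrow> y \<sqsubseteq> x"
    then have "op y \<subseteq> op a \<inter> op b" using assms op_mono[of y] by simp
    then have "X closure_of (op y) \<subseteq> e z" unfolding z(2) by (rule closure_of_mono)
    then show "y \<sqsubseteq> z" using le_iff z y closure_op by simp
  qed (use assms in auto)
  then show ?thesis using z by simp
qed

lemma op_meet:
  assumes "a \<in> carrier A" "b \<in> carrier A"
  shows "op (a \<sqinter> b) = op a \<inter> op b"
proof -
  have "op (a \<sqinter> b) = X interior_of (X closure_of (op a)) \<inter> X interior_of (X closure_of (op b))"
    unfolding op_def[of "a \<sqinter> b"] e_meet[OF assms] by (rule interior_closure_Int) auto
  then show ?thesis using assms by (simp add: closure_op) (simp add: op_def)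
qed

lemma e_cmpl:
  assumes a: "a \<in> carrier A"
  shows "e (cmpl A a) = topspace X - op a"
proof -
  have "openin X (topspace X - e a)" using e_closed[OF a] by blast
  then obtain z where z: "z \<in> carrier A" "e z = X closure_of (topspace X - e a)"
    using ex_closure by blast
  have ez: "e z = topspace X - op a" by (simp add: z closure_of_complement op_def)
  have oz: "op z \<inter> op a = {}" using op_subset[of z] ez by blast
  have "e (a \<sqinter> z) = {}" using e_meet[OF a z(1)] oz by (simp add: Int_commute)
  then have "a \<sqinter> z = \<bottom>" using e_eq_iff[of "a \<sqinter> z" \<bottom>] a z e_bot by simp
  moreover have "e (a \<squnion> z) = topspace X" using a z(1) ez op_subset[of a] e_subset[of a] by (auto simp: e_join)
  then have "a \<squnion> z = \<top>" using e_eq_iff[of "a \<squnion> z" \<top>] a z e_top by simp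
  ultimately have "cmpl A a = z"
    using cmpl_unique[OF a _ z(1)] cmpl_props[OF a] by blast
  then show ?thesis using ez by simp
qed

lemma op_cmpl:
  assumes a: "a \<in> carrier A"
  shows "op (cmpl A a) = topspace X - e a"
  using closure_op[OF a] by (simp add: op_def[of "cmpl A a"] e_cmpl a interior_of_complement)

lemma well_inside_iff:
  assumes "a \<in> carrier A" "b \<in> carrier A"
  shows "well_inside A a b \<longleftrightarrow> e a \<subseteq> op b"
  using assms e_subset[of a] contact_iff[of a "cmpl A b"] cmpl_props[of b]
  by (auto simp: well_inside_def e_cmpl)

text \<open>Compact Hausdorff spaces are regular, so a closed neighbourhood fits into
  \<open>U\<close>, and the closure of its open part is regular closed. Through this lemma
  neighbourhoods are traded for elements of the algebra.\<close>

lemma regular: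
  assumes "openin X U" "p \<in> U"
  shows "\<exists>a\<in>carrier A. p \<in> op a \<and> e a \<subseteq> U"
proof -
  have "neighbourhood_base_of (closedin X) X"
    using compact Hausdorff compact_Hausdorff_imp_regular_space neighbourhood_base_of_closedin by blast
  then obtain V C where VC: "openin X V" "closedin X C" "p \<in> V" "V \<subseteq> C" "C \<subseteq> U"
    using assms unfolding neighbourhood_base_of by meson
  obtain a where a: "a \<in> carrier A" "e a = X closure_of V" using ex_closure VC by blast
  have "V \<subseteq> op a" using VC a by (simp add: op_def interior_of_maximal closure_of_subset openin_subset)
  moreover have "e a \<subseteq> U" using a VC closure_of_minimal by blast
  ultimately show ?thesis using a VC by blast
qed

lemma op_regular:
  assumes "p \<in> op b"
  shows "\<exists>a\<in>carrier A. p \<in> op a \<and> e a \<subseteq> op b"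
  using regular[OF _ assms] by simp

text \<open>The two deep axioms are separation properties of the space: \<open>C5\<close> is
  normality, with \<open>c\<close> the closure of an open set around \<open>e b\<close>, and
  \<open>C6\<close> is regularity at a point outside \<open>e a\<close>.\<close>

lemma cnca: "cnca A"
proof -
  interpret complete_lattice A by (rule complete)
  have cc: "cmpl A a \<in> carrier A" if "a \<in> carrier A" for a using cmpl_props that by blast
  show ?thesis
  proof (unfold_locales, goal_cases)
    case (1 a)
    then have "e a \<noteq> {}" using e_eq_iff[of a \<bottom>] e_bot by simp
    then show ?case using 1 contact_iff by simp
  next
    case (2 a b)
    then show ?case using contact_iff e_bot by auto
  next
    case (3 a b)
    then show ?case using contact_iff by (simp add: Int_commute)
  next
    case (4 a b c)
    then show ?case using contact_iff e_join by auto
  next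
    case (5 a b)
    then have "disjnt (e a) (e b)" using contact_iff by (simp add: disjnt_def)
    moreover have "normal_space X"
      using compact Hausdorff compact_Hausdorff_or_regular_imp_normal_space by blast
    ultimately obtain U V where UV: "openin X U" "openin X V" "e a \<subseteq> U" "e b \<subseteq> V" "disjnt U V"
      using 5 e_closed unfolding normal_space_def by meson
    obtain c where c: "c \<in> carrier A" "e c = X closure_of V" using ex_closure UV by blast
    have "U \<inter> e c = {}" using UV openin_Int_closure_of_eq_empty[OF UV(1)] c by (simp add: disjnt_def)
    moreover have "V \<subseteq> op c"
      using UV c by (simp add: op_def interior_of_maximal closure_of_subset openin_subset)
    ultimately have "\<not> contact A a c" "\<not> contact A b (cmpl A c)"
      using 5 c UV contact_iff cc by (auto simp: e_cmpl)
    then show ?case using c by blast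
  next
    case (6 a)
    then have "e a \<noteq> topspace X" using e_eq_iff[of a \<top>] e_top by simp
    then obtain p where p: "p \<in> topspace X - e a" using e_subset 6 by blast
    moreover have "openin X (topspace X - e a)" using e_closed 6 by blast
    ultimately obtain b where b: "b \<in> carrier A" "p \<in> op b" "e b \<subseteq> topspace X - e a"
      using regular by blast
    have "b \<noteq> \<bottom>" using b op_subset e_bot by blast
    moreover have "\<not> contact A b a" using b 6 contact_iff by auto
    ultimately show ?case using b by blast
  qed
qed

lemma CA_isomorphic_RC: "CA_isomorphic (RC X) A"
proof -
  define f where "f = (\<lambda>F\<in>carrier (RC X). inv_into (carrier A) e F)"
  have fe: "f (e a) = a" if "a \<in> carrier A" for a
    using that e_RC[OF that] bij unfolding f_def by (simp add: bij_betw_inv_into_left del: RC_simps(1))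
  have ex: "\<exists>a\<in>carrier A. F = e a" if "F \<in> carrier (RC X)" for F using e_surj that by blast
  have cc: "cmpl A a \<in> carrier A" if "a \<in> carrier A" for a using cmpl_props that by blast
  have "bij_betw f (carrier (RC X)) (carrier A)"
    using bij_betw_inv_into[OF bij] by (rule bij_betw_cong[THEN iffD1, rotated]) (simp add: f_def del: RC_simps(1))
  moreover have "f \<in> bool_hom (RC X) A"
    unfolding bool_hom_def
  proof (intro CollectI conjI ballI)
    show "f \<in> carrier (RC X) \<rightarrow>\<^sub>E carrier A"
    proof (rule PiE_I)
      show "f F \<in> carrier A" if "F \<in> carrier (RC X)" for F using ex[OF that] fe by auto
    qed (simp add: f_def del: RC_simps(1))
    show "f \<bottom>\<^bsub>RC X\<^esub> = \<bottom>" "f \<top>\<^bsub>RC X\<^esub> = \<top>"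
      using fe[of \<bottom>] fe[of \<top>] by (simp_all add: RC_bottom_top e_bot e_top)
    fix F assume F: "F \<in> carrier (RC X)"
    then obtain a where a: "a \<in> carrier A" "F = e a" using ex by blast
    have "cmpl (RC X) F = e (cmpl A a)"
      using F a by (simp only: RC_cmpl e_cmpl closure_of_complement op_def)
    then show "f (cmpl (RC X) F) = cmpl A (f F)" using fe a cc by simp
    fix G assume G: "G \<in> carrier (RC X)"
    then obtain b where b: "b \<in> carrier A" "G = e b" using ex by blast
    have "F \<sqinter>\<^bsub>RC X\<^esub> G = e (a \<sqinter> b)"
      using F G a b by (simp only: RC_meet e_meet op_def interior_of_Int)
    then show "f (F \<sqinter>\<^bsub>RC X\<^esub> G) = f F \<sqinter> f G" using fe a b by simp
    have "F \<squnion>\<^bsub>RC X\<^esub> G = e (a \<squnion> b)"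
      using F G a b by (simp only: RC_join e_join)
    then show "f (F \<squnion>\<^bsub>RC X\<^esub> G) = f F \<squnion> f G" using fe a b by simp
  qed
  moreover have "contact (RC X) F G \<longleftrightarrow> contact A (f F) (f G)"
    if "F \<in> carrier (RC X)" "G \<in> carrier (RC X)" for F G
    using ex[OF that(1)] ex[OF that(2)] fe contact_iff by auto
  ultimately show ?thesis unfolding CA_isomorphic_def by blast
qed

end

lemma represented_RC:
  assumes "compact_space X" "Hausdorff_space X"
  shows "represented (RC X) X (\<lambda>F. F)"
  by (intro represented.intro represented_axioms.intro assms RC_boolean_alg RC_complete_lattice)
    (simp_all add: bij_betw_def del: RC_simps(1))

lemma represented_homeomorphic:
  assumes r: "represented A X e" and h: "homeomorphic_map X Y h"
  shows "represented A Y (\<lambda>a. h ` e a)"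
proof -
  interpret represented A X e by (rule r)
  have inj: "inj_on h (topspace X)" using h homeomorphic_imp_injective_map by blast
  have surj: "h ` topspace X = topspace Y" using h homeomorphic_imp_surjective_map by blast
  have hom: "X homeomorphic_space Y" using h homeomorphic_map_imp_homeomorphic_space by blast
  have RCh: "h ` F \<in> carrier (RC Y)" if "F \<in> carrier (RC X)" for F
  proof -
    have F: "F \<subseteq> topspace X" "F = X closure_of (X interior_of F)" using that by auto
    then have "Y closure_of (Y interior_of (h ` F)) = h ` F"
      using homeomorphic_map_interior_of[OF h F(1)]
        homeomorphic_map_closure_of[OF h interior_of_subset_topspace] by metis
    moreover have "h ` F \<subseteq> topspace Y" using F surj by blast
    ultimately show ?thesis by simp
  qed
  have RCs: "G \<in> (`) h ` carrier (RC X)" if "G \<in> carrier (RC Y)" for G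
  proof -
    have G: "G \<subseteq> topspace Y" "G = Y closure_of (Y interior_of G)" using that by auto
    let ?F = "{x \<in> topspace X. h x \<in> G}"
    have F: "?F \<subseteq> topspace X" and hF: "h ` ?F = G" using G surj by auto
    have "h ` (X closure_of (X interior_of ?F)) = h ` ?F"
      using homeomorphic_map_interior_of[OF h F]
        homeomorphic_map_closure_of[OF h interior_of_subset_topspace] hF G(2) by metis
    then have "X closure_of (X interior_of ?F) = ?F"
      using inj_on_image_eq_iff[OF inj closure_of_subset_topspace F] by blast
    then show ?thesis using hF by (intro image_eqI[of _ _ ?F]) auto
  qed
  show ?thesis
  proof (intro represented.intro represented_axioms.intro, goal_cases)
    case 1 show ?case by (rule boolean_alg_axioms)
  next
    case 2 show ?case by (rule complete)
  next
    case 3 show ?case using compact hom homeomorphic_compact_space by blast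
  next
    case 4 show ?case using Hausdorff hom homeomorphic_Hausdorff_space by blast
  next
    case 5
    have "bij_betw ((`) h) (carrier (RC X)) (carrier (RC Y))"
      unfolding bij_betw_def
    proof
      show "inj_on ((`) h) (carrier (RC X))"
        using inj_on_image_eq_iff[OF inj] RC_subset_topspace by (meson inj_onI)
      show "(`) h ` carrier (RC X) = carrier (RC Y)" using RCh RCs by blast
    qed
    from bij_betw_trans[OF bij this] show ?case by (simp add: comp_def)
  next
    case (6 a b)
    then show ?case using le_iff inj_on_image_subset_iff[OF inj] e_subset by simp
  next
    case (7 a b)
    then show ?case using contact_iff inj_on_image_Int[OF inj, of "e a" "e b"] e_subset by auto
  qed
qed

section \<open>De Vries duality\<close>

locale represented_pair = A: represented A X e + B: represented B Y e'
  for A :: "'a contact_alg" and X :: "'x topology" and e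
    and B :: "'b contact_alg" and Y :: "'y topology" and e'
begin

definition preim :: "('y \<Rightarrow> 'x) \<Rightarrow> 'a \<Rightarrow> 'y set" where
  "preim g a = {y \<in> topspace Y. g y \<in> A.op a}"

definition dual :: "('y \<Rightarrow> 'x) \<Rightarrow> 'a \<Rightarrow> 'b" where
  "dual g = (\<lambda>a\<in>carrier A. inv_into (carrier B) e' (Y closure_of preim g a))"

lemma dual_cong:
  assumes "\<And>y. y \<in> topspace Y \<Longrightarrow> g y = g' y"
  shows "dual g = dual g'"
proof -
  have "preim g = preim g'" using assms by (intro ext) (auto simp: preim_def)
  then show ?thesis by (simp add: dual_def)
qed

lemma dual_ext: "a \<notin> carrier A \<Longrightarrow> dual g a = undefined"
  by (simp add: dual_def)

context
  fixes g assumes g: "continuous_map Y X g"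
begin

lemma preim_open: "openin Y (preim g a)"
  unfolding preim_def by (rule openin_continuous_map_preimage[OF g A.op_open])

lemma dual_closed: "a \<in> carrier A \<Longrightarrow> dual g a \<in> carrier B"
  and e_dual: "a \<in> carrier A \<Longrightarrow> e' (dual g a) = Y closure_of preim g a"
proof -
  assume a: "a \<in> carrier A"
  obtain b where b: "b \<in> carrier B" "e' b = Y closure_of preim g a"
    using B.ex_closure[OF preim_open] by blast
  have "dual g a = b"
    using a bij_betw_inv_into_left[OF B.bij b(1)] by (simp add: dual_def b(2))
  then show "dual g a \<in> carrier B" "e' (dual g a) = Y closure_of preim g a" using b by auto
qed

lemma preim_subset_op: "a \<in> carrier A \<Longrightarrow> preim g a \<subseteq> B.op (dual g a)"
  unfolding B.op_def
  by (intro interior_of_maximal preim_open) (simp add: e_dual closure_of_subset preim_def)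

lemma e_dual_subset: "a \<in> carrier A \<Longrightarrow> e' (dual g a) \<subseteq> {y \<in> topspace Y. g y \<in> e a}"
proof -
  assume a: "a \<in> carrier A"
  have "closedin Y {y \<in> topspace Y. g y \<in> e a}"
    by (rule closedin_continuous_map_preimage[OF g A.e_closed[OF a]])
  then show ?thesis
    unfolding e_dual[OF a] using A.op_subset[of a] by (intro closure_of_minimal) (auto simp: preim_def)
qed

text \<open>By regularity the sets \<open>op b\<close> with \<open>b\<close> well inside
  \<open>a\<close> cover \<open>op a\<close>, and preimages preserve unions. This is the pointwise
  source of the fourth DHC axiom and of the composition law.\<close>

lemma preim_well_inside:
  "a \<in> carrier A \<Longrightarrow> preim g a = (\<Union>b\<in>{b \<in> carrier A. well_inside A b a}. preim g b)"
  (is "_ \<Longrightarrow> _ = ?R")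
proof
  assume a: "a \<in> carrier A"
  show "?R \<subseteq> preim g a"
  proof
    fix y assume "y \<in> ?R"
    then obtain b where b: "b \<in> carrier A" "well_inside A b a" "y \<in> preim g b" by blast
    then have "e b \<subseteq> A.op a" using A.well_inside_iff a by blast
    then show "y \<in> preim g a" using b A.op_subset[of b] by (auto simp: preim_def)
  qed
  show "preim g a \<subseteq> ?R"
  proof
    fix y assume y: "y \<in> preim g a"
    then have "g y \<in> A.op a" by (simp add: preim_def)
    then obtain b where "b \<in> carrier A" "g y \<in> A.op b" "e b \<subseteq> A.op a"
      using A.op_regular by blast
    then show "y \<in> ?R" using y a A.well_inside_iff by (auto simp: preim_def)
  qed
qed

lemma dual_in_dhc_hom: "dual g \<in> dhc_hom A B"
  unfolding dhc_hom_def
proof (intro CollectI conjI ballI impI)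
  show "dual g \<in> carrier A \<rightarrow>\<^sub>E carrier B"
    by (intro PiE_I dual_closed dual_ext)
  have "e' (dual g \<bottom>\<^bsub>A\<^esub>) = {}"
    using A.op_subset[of "\<bottom>\<^bsub>A\<^esub>"] by (simp add: e_dual preim_def A.e_bot)
  then show "dual g \<bottom>\<^bsub>A\<^esub> = \<bottom>\<^bsub>B\<^esub>"
    using B.e_eq_iff[of "dual g \<bottom>\<^bsub>A\<^esub>" "\<bottom>\<^bsub>B\<^esub>"] dual_closed[of "\<bottom>\<^bsub>A\<^esub>"] by (simp add: B.e_bot)
next
  fix a b assume a: "a \<in> carrier A" and b: "b \<in> carrier A"
  have m: "a \<sqinter>\<^bsub>A\<^esub> b \<in> carrier A" using a b by simp
  have "preim g (a \<sqinter>\<^bsub>A\<^esub> b) = preim g a \<inter> preim g b"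
    using a b by (auto simp: preim_def A.op_meet)
  then have "B.op (dual g (a \<sqinter>\<^bsub>A\<^esub> b)) = B.op (dual g a) \<inter> B.op (dual g b)"
    using interior_closure_Int[OF preim_open preim_open] a b m by (simp add: B.op_def e_dual)
  then have "B.op (dual g (a \<sqinter>\<^bsub>A\<^esub> b)) = B.op (dual g a \<sqinter>\<^bsub>B\<^esub> dual g b)"
    using a b by (simp add: B.op_meet dual_closed)
  then have "e' (dual g (a \<sqinter>\<^bsub>A\<^esub> b)) = e' (dual g a \<sqinter>\<^bsub>B\<^esub> dual g b)"
    using B.closure_op[OF dual_closed[OF m]] B.closure_op[of "dual g a \<sqinter>\<^bsub>B\<^esub> dual g b"] a b
    by (simp add: dual_closed)
  then show "dual g (a \<sqinter>\<^bsub>A\<^esub> b) = dual g a \<sqinter>\<^bsub>B\<^esub> dual g b"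
    using B.e_eq_iff[OF dual_closed[OF m]] a b by (simp add: dual_closed)
next
  fix a b assume a: "a \<in> carrier A" and b: "b \<in> carrier A" and w: "well_inside A a b"
  have ca: "cmpl A a \<in> carrier A" using A.cmpl_props a by blast
  have "e a \<subseteq> A.op b" using w A.well_inside_iff a b by blast
  \<comment> \<open>A point outside \<open>B.op (dual g (cmpl A a))\<close> is in particular outside
    the preimage of \<open>A.op (cmpl A a)\<close>, which is the complement of
    \<open>e a\<close>.\<close>
  moreover have "topspace Y - B.op (dual g (cmpl A a)) \<subseteq> {y \<in> topspace Y. g y \<in> e a}"
    using preim_subset_op[OF ca] continuous_map_image_subset_topspace[OF g]
    by (auto simp: preim_def A.op_cmpl a)
  ultimately have "topspace Y - B.op (dual g (cmpl A a)) \<subseteq> B.op (dual g b)"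
    using preim_subset_op[OF b] by (auto simp: preim_def)
  then show "well_inside B (cmpl B (dual g (cmpl A a))) (dual g b)"
    using B.well_inside_iff[of "cmpl B (dual g (cmpl A a))" "dual g b"] B.cmpl_props(1) b ca
    by (simp add: B.e_cmpl dual_closed)
next
  fix a assume a: "a \<in> carrier A"
  let ?S = "{b \<in> carrier A. well_inside A b a}"
  have S: "{dual g b |b. b \<in> carrier A \<and> well_inside A b a} = dual g ` ?S" by blast
  have c: "dual g ` ?S \<subseteq> carrier B" using dual_closed by blast
  have "preim g a \<subseteq> (\<Union>b\<in>?S. B.op (dual g b))"
    using preim_well_inside[OF a] preim_subset_op by blast
  then have "e' (dual g a) \<subseteq> e' (\<Squnion>\<^bsub>B\<^esub> (dual g ` ?S))"
    using B.e_sup[OF c] e_dual[OF a] by (simp add: closure_of_mono)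
  moreover have "B.op (dual g b) \<subseteq> e' (dual g a)" if "b \<in> ?S" for b
  proof -
    have "preim g b \<subseteq> preim g a" using preim_well_inside[OF a] that by blast
    then have "e' (dual g b) \<subseteq> e' (dual g a)" using that a by (simp add: e_dual closure_of_mono)
    then show ?thesis using B.op_subset[of "dual g b"] by blast
  qed
  then have "e' (\<Squnion>\<^bsub>B\<^esub> (dual g ` ?S)) \<subseteq> e' (dual g a)"
    unfolding B.e_sup(2)[OF c] by (intro closure_of_minimal B.e_closed dual_closed a) blast
  ultimately show "dual g a = \<Squnion>\<^bsub>B\<^esub> {dual g b |b. b \<in> carrier A \<and> well_inside A b a}"
    unfolding S using B.e_eq_iff[OF dual_closed[OF a] B.e_sup(1)[OF c]] by blast
qed

end

text \<open>If the two values at \<open>y\<close> differed, some \<open>e a\<close> would be a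
  neighbourhood of the one and miss the other, while \<open>y\<close> belongs to the common image of
  \<open>a\<close>.\<close>

lemma dual_inj:
  assumes g: "continuous_map Y X g" and g': "continuous_map Y X g'" and eq: "dual g = dual g'"
    and y: "y \<in> topspace Y"
  shows "g y = g' y"
proof (rule ccontr)
  assume ne: "g y \<noteq> g' y"
  have "g y \<in> topspace X" "g' y \<in> topspace X"
    using y g g' by (auto simp: continuous_map_def)
  then obtain U V where UV: "openin X U" "openin X V" "g y \<in> U" "g' y \<in> V" "disjnt U V"
    using A.Hausdorff ne unfolding Hausdorff_space_def by meson
  obtain a where a: "a \<in> carrier A" "g y \<in> A.op a" "e a \<subseteq> U" using A.regular UV by blast
  have "y \<in> preim g a" using a y by (simp add: preim_def)
  then have "y \<in> e' (dual g a)" using preim_subset_op[OF g a(1)] B.op_subset by blast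
  then have "g' y \<in> e a" using e_dual_subset[OF g' a(1)] eq by auto
  then show False using a UV by (auto simp: disjnt_def)
qed

text \<open>The value \<open>g y\<close> has to lie in every \<open>e a\<close> with
  \<open>y\<close> in \<open>B.op (h a)\<close>. These closed sets have the finite intersection
  property because \<open>h\<close> preserves meets, so compactness provides a point; any choice
  works. The third axiom gives the converse implication \<open>near'\<close>, which yields
  continuity, and the fourth one identifies \<open>h\<close> with the dual of
  \<open>g\<close>.\<close>

lemma dhc_hom_is_dual:
  assumes h: "h \<in> dhc_hom A B"
  shows "\<exists>g. continuous_map Y X g \<and> h = dual g"
proof -
  have hc: "\<And>a. a \<in> carrier A \<Longrightarrow> h a \<in> carrier B"
    and hext: "\<And>a. a \<notin> carrier A \<Longrightarrow> h a = undefined"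
    using h by (auto simp: dhc_hom_def PiE_iff extensional_def)
  have h0: "h \<bottom>\<^bsub>A\<^esub> = \<bottom>\<^bsub>B\<^esub>"
    and hm: "\<And>a b. a \<in> carrier A \<Longrightarrow> b \<in> carrier A \<Longrightarrow> h (a \<sqinter>\<^bsub>A\<^esub> b) = h a \<sqinter>\<^bsub>B\<^esub> h b"
    and hw: "\<And>a b. a \<in> carrier A \<Longrightarrow> b \<in> carrier A \<Longrightarrow> well_inside A a b \<Longrightarrow>
        well_inside B (cmpl B (h (cmpl A a))) (h b)"
    and hs: "\<And>a. a \<in> carrier A \<Longrightarrow> h a = \<Squnion>\<^bsub>B\<^esub> {h b |b. b \<in> carrier A \<and> well_inside A b a}"
    using h unfolding dhc_hom_def by blast+
  \<comment> \<open>The third DHC axiom, read at a single point.\<close>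
  have key: "y \<in> B.op (h b)"
    if "a \<in> carrier A" "b \<in> carrier A" "e a \<subseteq> A.op b" "y \<in> topspace Y" "y \<notin> B.op (h (cmpl A a))" for a b y
  proof -
    have ca: "cmpl A a \<in> carrier A" using A.cmpl_props that by blast
    have "well_inside B (cmpl B (h (cmpl A a))) (h b)"
      using hw[OF that(1,2)] A.well_inside_iff[OF that(1,2)] that(3) by blast
    then have "e' (cmpl B (h (cmpl A a))) \<subseteq> B.op (h b)"
      using B.well_inside_iff[OF B.cmpl_props(1)[OF hc[OF ca]] hc[OF that(2)]] by blast
    then show ?thesis using that(4,5) B.e_cmpl[OF hc[OF ca]] by auto
  qed
  have ex: "\<exists>x. x \<in> topspace X \<and> (\<forall>a\<in>carrier A. y \<in> B.op (h a) \<longrightarrow> x \<in> e a)" if y: "y \<in> topspace Y" for y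
  proof -
    \<comment> \<open>Including \<open>topspace X\<close> makes sure that a common point of the
      family is a point of the space; the alternative \<open>a = \<top>\<close> in
      \<open>fin\<close> accounts for this extra member.\<close>
    define \<F> where "\<F> = insert (topspace X) (e ` {a \<in> carrier A. y \<in> B.op (h a)})"
    have fin: "\<exists>a\<in>carrier A. (y \<in> B.op (h a) \<or> a = \<top>\<^bsub>A\<^esub>) \<and> e a \<subseteq> topspace X \<inter> \<Inter>\<G>" if "finite \<G>" "\<G> \<subseteq> \<F>" for \<G>
      using that
    proof (induction \<G>)
      case empty show ?case using A.e_top by (intro bexI[of _ "\<top>\<^bsub>A\<^esub>"]) auto
    next
      case (insert F \<G>)
      then obtain a where a: "a \<in> carrier A" "y \<in> B.op (h a) \<or> a = \<top>\<^bsub>A\<^esub>" "e a \<subseteq> topspace X \<inter> \<Inter>\<G>" by blast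
      show ?case
      proof (cases "F = topspace X")
        case True then show ?thesis using a by blast
      next
        case False
        then obtain b where b: "b \<in> carrier A" "y \<in> B.op (h b)" "F = e b"
          using insert.prems by (auto simp: \<F>_def)
        show ?thesis
        proof (cases "y \<in> B.op (h a)")
          case True
          have "y \<in> B.op (h (a \<sqinter>\<^bsub>A\<^esub> b))" using True a b by (simp add: hm B.op_meet hc)
          moreover have "e (a \<sqinter>\<^bsub>A\<^esub> b) \<subseteq> e a" "e (a \<sqinter>\<^bsub>A\<^esub> b) \<subseteq> e b"
            using A.le_iff a b A.meet_left A.meet_right by (meson A.meet_closed)+
          ultimately show ?thesis using a b by (intro bexI[of _ "a \<sqinter>\<^bsub>A\<^esub> b"]) auto
        next
          case False
          then have "e a = topspace X" using a A.e_top by blast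
          then show ?thesis using a b A.e_subset by (intro bexI[of _ b]) auto
        qed
      qed
    qed
    have ne: "\<Inter>\<G> \<noteq> {}" if G: "finite \<G>" "\<G> \<subseteq> \<F>" for \<G>
    proof -
      obtain a where a: "a \<in> carrier A" "y \<in> B.op (h a) \<or> a = \<top>\<^bsub>A\<^esub>" "e a \<subseteq> topspace X \<inter> \<Inter>\<G>"
        using fin[OF G] by blast
      have "e a \<noteq> {}"
      proof
        assume "e a = {}"
        then have "a = \<bottom>\<^bsub>A\<^esub>" using A.e_eq_iff[of a "\<bottom>\<^bsub>A\<^esub>"] a A.e_bot by simp
        then have "h a = \<bottom>\<^bsub>B\<^esub>" using h0 by simp
        then have "y \<notin> B.op (h a)" using B.op_subset[of "h a"] B.e_bot by auto
        \<comment> \<open>Only the one-element algebra is left. There \<bottom> is its own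
          complement and well inside itself, so the third axiom would place \<open>y\<close> in the
          empty image of \<bottom>.\<close>
        then have X: "topspace X = {}" using a \<open>e a = {}\<close> A.e_top by simp
        have cb: "cmpl A \<bottom>\<^bsub>A\<^esub> = \<bottom>\<^bsub>A\<^esub>"
          using A.e_eq_iff[of "cmpl A \<bottom>\<^bsub>A\<^esub>" "\<bottom>\<^bsub>A\<^esub>"] A.cmpl_props(1)[of "\<bottom>\<^bsub>A\<^esub>"]
            A.e_cmpl[of "\<bottom>\<^bsub>A\<^esub>"] X A.e_bot by simp
        have "y \<in> B.op (h \<bottom>\<^bsub>A\<^esub>)"
          using key[of "\<bottom>\<^bsub>A\<^esub>" "\<bottom>\<^bsub>A\<^esub>" y] y cb A.e_bot \<open>a = \<bottom>\<^bsub>A\<^esub>\<close> \<open>y \<notin> B.op (h a)\<close> by auto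
        then show False using \<open>a = \<bottom>\<^bsub>A\<^esub>\<close> \<open>y \<notin> B.op (h a)\<close> by simp
      qed
      then show ?thesis using a by blast
    qed
    have "\<forall>C\<in>\<F>. closedin X C" using A.e_closed by (auto simp: \<F>_def)
    then have "\<Inter>\<F> \<noteq> {}"
      using A.compact ne unfolding compact_space_fip by blast
    then show ?thesis by (auto simp: \<F>_def)
  qed
  define g where "g y = (SOME x. x \<in> topspace X \<and> (\<forall>a\<in>carrier A. y \<in> B.op (h a) \<longrightarrow> x \<in> e a))" for y
  have gX: "g y \<in> topspace X" and ge: "\<And>a. a \<in> carrier A \<Longrightarrow> y \<in> B.op (h a) \<Longrightarrow> g y \<in> e a"
    if "y \<in> topspace Y" for y
    using someI_ex[OF ex[OF that]] unfolding g_def by auto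
  have near: "y \<in> B.op (h b)"
    if "y \<in> topspace Y" "a \<in> carrier A" "b \<in> carrier A" "e a \<subseteq> A.op b" "g y \<in> A.op a" for y a b
  proof -
    have ca: "cmpl A a \<in> carrier A" using A.cmpl_props that by blast
    have "y \<notin> B.op (h (cmpl A a))"
      using ge[OF that(1) ca] that by (auto simp: A.e_cmpl)
    then show ?thesis using key that by blast
  qed
  have near': "y \<in> B.op (h b)" if "y \<in> topspace Y" "b \<in> carrier A" "g y \<in> A.op b" for y b
    using A.op_regular[OF that(3)] near[OF that(1) _ that(2)] by blast
  have cont: "continuous_map Y X g"
    unfolding continuous_map
  proof (intro conjI allI impI)
    show "g ` topspace Y \<subseteq> topspace X" using gX by blast
    fix U assume U: "openin X U"
    show "openin Y {y \<in> topspace Y. g y \<in> U}"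
    proof (subst openin_subopen, intro ballI)
      fix y assume y: "y \<in> {y \<in> topspace Y. g y \<in> U}"
      then obtain b where b: "b \<in> carrier A" "g y \<in> A.op b" "e b \<subseteq> U" using A.regular[OF U] by blast
      have "B.op (h b) \<subseteq> topspace Y" by (rule openin_subset[OF B.op_open])
      then have "B.op (h b) \<subseteq> {y \<in> topspace Y. g y \<in> U}" using ge b by blast
      then show "\<exists>T. openin Y T \<and> y \<in> T \<and> T \<subseteq> {y \<in> topspace Y. g y \<in> U}"
        using near'[of y b] b y B.op_open by blast
    qed
  qed
  have "h a = dual g a" if a: "a \<in> carrier A" for a
  proof -
    let ?S = "{h b |b. b \<in> carrier A \<and> well_inside A b a}"
    have S: "?S \<subseteq> carrier B" using hc by blast
    have "preim g a \<subseteq> B.op (h a)" using near' a by (auto simp: preim_def)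
    then have "e' (dual g a) \<subseteq> e' (h a)"
      using closure_of_mono[of "preim g a" "B.op (h a)" Y] by (simp add: e_dual cont a B.closure_op hc)
    moreover have "B.op x \<subseteq> preim g a" if x: "x \<in> ?S" for x
    proof
      fix y assume y: "y \<in> B.op x"
      obtain b where b: "x = h b" "b \<in> carrier A" "well_inside A b a"
        using x by blast
      have yY: "y \<in> topspace Y" using y openin_subset[OF B.op_open[of x]] by (rule rev_subsetD)
      have "e b \<subseteq> A.op a" using b(3) A.well_inside_iff[OF b(2) a] by blast
      then show "y \<in> preim g a" using ge[OF yY] y b yY by (auto simp: preim_def)
    qed
    then have "(\<Union>x\<in>?S. B.op x) \<subseteq> preim g a" by blast
    then have "e' (h a) \<subseteq> e' (dual g a)"
      using closure_of_mono[of "\<Union>x\<in>?S. B.op x" "preim g a" Y] B.e_sup(2)[OF S] hs[OF a] by (simp add: e_dual cont a)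
    ultimately show ?thesis using B.e_eq_iff[OF hc[OF a] dual_closed[OF cont a]] by blast
  qed
  then have "h = dual g" using hext dual_ext by (intro ext) metis
  then show ?thesis using cont by blast
qed

end

locale represented_triple = AB: represented_pair A X e B Y e' + BC: represented_pair B Y e' C Z e''
  for A :: "'a contact_alg" and X :: "'x topology" and e
    and B :: "'b contact_alg" and Y :: "'y topology" and e'
    and C :: "'c contact_alg" and Z :: "'z topology" and e''
begin

sublocale AC: represented_pair A X e C Z e''
  by unfold_locales

text \<open>Applying two duals in succession takes closures twice, so the plain composite may exceed
  the dual of \<open>f \<circ> g\<close>. For \<open>b\<close> well inside \<open>a\<close>, the gap
  between \<open>e b\<close> and \<open>op a\<close> absorbs both closures; this is why the join in
  \<open>check\<close> gives the correct value.\<close>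

lemma dhc_comp_dual:
  assumes f: "continuous_map Y X f" and g: "continuous_map Z Y g"
  shows "dhc_comp A C (BC.dual g) (AB.dual f) = AC.dual (f \<circ> g)"
proof
  fix a
  have fg: "continuous_map Z X (f \<circ> g)" using f g by (rule continuous_map_compose[rotated])
  show "dhc_comp A C (BC.dual g) (AB.dual f) a = AC.dual (f \<circ> g) a"
  proof (cases "a \<in> carrier A")
    case a: True
    let ?S = "{b \<in> carrier A. well_inside A b a}"
    let ?h = "\<lambda>b. BC.dual g (AB.dual f b)"
    have S: "{(BC.dual g \<circ> AB.dual f) b |b. b \<in> carrier A \<and> well_inside A b a} = ?h ` ?S" by auto
    have c: "?h ` ?S \<subseteq> carrier C" using AB.dual_closed[OF f] BC.dual_closed[OF g] by blast
    have up: "BC.B.op (?h b) \<subseteq> AC.preim (f \<circ> g) a" if b: "b \<in> ?S" for b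
    proof -
      have "BC.B.op (?h b) \<subseteq> e'' (?h b)" by (rule BC.B.op_subset)
      also have "\<dots> \<subseteq> {z \<in> topspace Z. g z \<in> e' (AB.dual f b)}"
        using BC.e_dual_subset[OF g] AB.dual_closed[OF f] b by blast
      also have "\<dots> \<subseteq> {z \<in> topspace Z. f (g z) \<in> e b}"
        using AB.e_dual_subset[OF f, of b] b by blast
      also have "\<dots> \<subseteq> AC.preim (f \<circ> g) a"
        using AB.A.well_inside_iff[of b a] b a by (auto simp: AC.preim_def)
      finally show ?thesis .
    qed
    have low: "AC.preim (f \<circ> g) b \<subseteq> BC.B.op (?h b)" if b: "b \<in> carrier A" for b
    proof -
      have "AC.preim (f \<circ> g) b \<subseteq> BC.preim g (AB.dual f b)"
        using AB.preim_subset_op[OF f b] continuous_map_image_subset_topspace[OF g]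
        by (auto simp: AC.preim_def BC.preim_def AB.preim_def)
      then show ?thesis using BC.preim_subset_op[OF g AB.dual_closed[OF f b]] by blast
    qed
    have "(\<Union>x\<in>?h ` ?S. BC.B.op x) = AC.preim (f \<circ> g) a"
    proof
      show "(\<Union>x\<in>?h ` ?S. BC.B.op x) \<subseteq> AC.preim (f \<circ> g) a" using up by blast
      have "(\<Union>b\<in>?S. AC.preim (f \<circ> g) b) \<subseteq> (\<Union>x\<in>?h ` ?S. BC.B.op x)" using low by blast
      then show "AC.preim (f \<circ> g) a \<subseteq> (\<Union>x\<in>?h ` ?S. BC.B.op x)"
        unfolding AC.preim_well_inside[OF fg a] .
    qed
    then have "e'' (\<Squnion>\<^bsub>C\<^esub> (?h ` ?S)) = e'' (AC.dual (f \<circ> g) a)"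
      using BC.B.e_sup(2)[OF c] AC.e_dual[OF fg a] by simp
    then have "\<Squnion>\<^bsub>C\<^esub> (?h ` ?S) = AC.dual (f \<circ> g) a"
      using BC.B.e_eq_iff[OF BC.B.e_sup(1)[OF c] AC.dual_closed[OF fg a]] by blast
    then show ?thesis using a S by (simp add: dhc_comp_def check_def)
  next
    case False
    then show ?thesis using AC.dual_ext by (simp add: dhc_comp_def check_def)
  qed
qed

end

section \<open>The space of ends of a normal contact algebra\<close>

context cnca
begin

abbreviation ll (infix \<open>\<lless>\<close> 50) where "a \<lless> b \<equiv> well_inside B a b"

lemma cmpl_in [simp]: "a \<in> carrier B \<Longrightarrow> cmpl B a \<in> carrier B"
  by (rule cmpl_props)

lemma cmpl_cmpl: "a \<in> carrier B \<Longrightarrow> cmpl B (cmpl B a) = a"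
  by (simp add: eq_iff_stone ultraD)

lemma cmpl_bot_top: "cmpl B \<bottom> = \<top>" "cmpl B \<top> = \<bottom>"
  by (simp_all add: eq_iff_stone ultraD)

lemma contact_mono:
  assumes "contact B a b" "a \<sqsubseteq> a'" "b \<sqsubseteq> b'"
    and "a \<in> carrier B" "b \<in> carrier B" "a' \<in> carrier B" "b' \<in> carrier B"
  shows "contact B a' b'"
proof -
  have "a \<squnion> a' = a'" "b \<squnion> b' = b'" using assms le_iff_meet by blast+
  then have "contact B a b'" using C4[of a b b'] assms by simp
  then have "contact B b' a'" using C4[of b' a a'] C3[of a b'] assms \<open>a \<squnion> a' = a'\<close> by simp
  then show ?thesis using C3 assms by blast
qed

lemma ll_mono:
  assumes "a \<lless> b" "a' \<sqsubseteq> a" "b \<sqsubseteq> b'"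
    and c: "a \<in> carrier B" "b \<in> carrier B" "a' \<in> carrier B" "b' \<in> carrier B"
  shows "a' \<lless> b'"
proof -
  have "cmpl B b' \<sqsubseteq> cmpl B b" using assms(3) c by (auto simp: le_iff_stone ultraD)
  then show ?thesis using contact_mono[of a' "cmpl B b'" a "cmpl B b"] assms by (auto simp: well_inside_def)
qed

lemma ll_imp_le:
  assumes "a \<lless> b" and c: "a \<in> carrier B" "b \<in> carrier B"
  shows "a \<sqsubseteq> b"
proof -
  let ?x = "a \<sqinter> cmpl B b"
  have "\<not> contact B ?x ?x"
    using contact_mono[of ?x ?x a "cmpl B b"] assms meet_left[of a "cmpl B b"] meet_right[of a "cmpl B b"]
    by (auto simp: well_inside_def)
  then have "?x = \<bottom>" using C1[of ?x] c by auto
  then show ?thesis using c by (auto simp: le_iff_stone eq_iff_stone ultraD)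
qed

lemma ll_cmpl:
  assumes "a \<lless> b" and c: "a \<in> carrier B" "b \<in> carrier B"
  shows "cmpl B b \<lless> cmpl B a"
  using assms C3[of "cmpl B b" a] by (auto simp: well_inside_def cmpl_cmpl)

lemma ll_meet_right:
  assumes "a \<lless> b" "a \<lless> b'" and c: "a \<in> carrier B" "b \<in> carrier B" "b' \<in> carrier B"
  shows "a \<lless> b \<sqinter> b'"
proof -
  have "cmpl B (b \<sqinter> b') = cmpl B b \<squnion> cmpl B b'"
    using c by (auto simp: eq_iff_stone ultraD)
  then show ?thesis using assms C4[of a "cmpl B b" "cmpl B b'"] by (simp add: well_inside_def)
qed

lemma ll_meet:
  assumes "a \<lless> b" "a' \<lless> b'"
    and c: "a \<in> carrier B" "b \<in> carrier B" "a' \<in> carrier B" "b' \<in> carrier B"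
  shows "a \<sqinter> a' \<lless> b \<sqinter> b'"
  using assms by (intro ll_meet_right ll_mono[OF assms(1)] ll_mono[OF assms(2)])
    (simp_all add: meet_left meet_right)

lemma ll_join:
  assumes "a \<lless> b" "a' \<lless> b'"
    and c: "a \<in> carrier B" "b \<in> carrier B" "a' \<in> carrier B" "b' \<in> carrier B"
  shows "a \<squnion> a' \<lless> b \<squnion> b'"
proof -
  have "cmpl B b \<sqinter> cmpl B b' \<lless> cmpl B a \<sqinter> cmpl B a'"
    using assms by (intro ll_meet ll_cmpl) simp_all
  then have "cmpl B (cmpl B a \<sqinter> cmpl B a') \<lless> cmpl B (cmpl B b \<sqinter> cmpl B b')"
    using c by (intro ll_cmpl) simp_all
  moreover have "cmpl B (cmpl B a \<sqinter> cmpl B a') = a \<squnion> a'" "cmpl B (cmpl B b \<sqinter> cmpl B b') = b \<squnion> b'"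
    using c by (auto simp: eq_iff_stone ultraD)
  ultimately show ?thesis by simp
qed

lemma ll_interpolate:
  assumes "a \<lless> b" and c: "a \<in> carrier B" "b \<in> carrier B"
  shows "\<exists>c\<in>carrier B. a \<lless> c \<and> c \<lless> b"
proof -
  obtain d where d: "d \<in> carrier B" "\<not> contact B a d" "\<not> contact B (cmpl B b) (cmpl B d)"
    using C5[of a "cmpl B b"] assms by (auto simp: well_inside_def)
  then show ?thesis
    using c C3[of "cmpl B d" "cmpl B b"]
    by (intro bexI[of _ "cmpl B d"]) (auto simp: well_inside_def cmpl_cmpl)
qed

lemma ll_bot: "a \<in> carrier B \<Longrightarrow> \<bottom> \<lless> a"
  using C2[of \<bottom> "cmpl B a"] by (auto simp: well_inside_def)

lemma ll_top: "\<top> \<lless> \<top>"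
  using C2[of \<top> \<bottom>] by (auto simp: well_inside_def cmpl_bot_top)

lemma ex_ll:
  assumes "a \<in> carrier B" "a \<noteq> \<bottom>"
  shows "\<exists>b\<in>carrier B. b \<noteq> \<bottom> \<and> b \<lless> a"
proof -
  have "cmpl B a \<noteq> \<top>" using assms cmpl_cmpl cmpl_bot_top by metis
  then show ?thesis using C6[of "cmpl B a"] assms by (auto simp: well_inside_def)
qed

text \<open>The round part of an ultrafilter. With ends obtained in this way, the dichotomy that
  replaces primality is inherited from the ultrafilter, without a separate maximality
  argument.\<close>

definition the_end :: "'a set \<Rightarrow> 'a set" where
  "the_end u = {a \<in> carrier B. \<exists>b\<in>u. b \<lless> a}"

definition ends :: "'a set set" where
  "ends = the_end ` {u. ultra B u}"

lemma the_end_subset: "ultra B u \<Longrightarrow> the_end u \<subseteq> u"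
  using ll_imp_le unfolding the_end_def ultra_def by blast

lemma end_top: "p \<in> ends \<Longrightarrow> \<top> \<in> p"
  using ll_top by (auto simp: ends_def the_end_def ultra_def)

lemma end_carrier: "p \<in> ends \<Longrightarrow> a \<in> p \<Longrightarrow> a \<in> carrier B"
  by (auto simp: ends_def the_end_def)

lemma end_bot: "p \<in> ends \<Longrightarrow> \<bottom> \<notin> p"
  using the_end_subset by (auto simp: ends_def ultra_def)

lemma end_disjoint:
  assumes "p \<in> ends" "a \<in> p" "cmpl B a \<in> p"
  shows False
proof -
  obtain u where u: "ultra B u" "p = the_end u" using assms by (auto simp: ends_def)
  then have "a \<in> u" "cmpl B a \<in> u" using the_end_subset assms by auto
  then show False using ultraD(6)[OF u(1), of a] end_carrier assms by blast
qed

lemma end_meet: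
  assumes p: "p \<in> ends" and c: "a \<in> carrier B" "b \<in> carrier B"
  shows "a \<sqinter> b \<in> p \<longleftrightarrow> a \<in> p \<and> b \<in> p"
proof -
  obtain u where u: "ultra B u" "p = the_end u" using p by (auto simp: ends_def)
  have uc: "x \<in> carrier B" if "x \<in> u" for x using u that by (auto simp: ultra_def)
  show ?thesis
  proof
    assume "a \<sqinter> b \<in> p"
    then obtain x where x: "x \<in> u" "x \<lless> a \<sqinter> b" using u by (auto simp: the_end_def)
    then have "x \<lless> a" "x \<lless> b"
      using c uc[OF x(1)] ll_mono[OF x(2)] by (simp_all add: meet_left meet_right)
    then show "a \<in> p \<and> b \<in> p" using c x u by (auto simp: the_end_def)
  next
    assume "a \<in> p \<and> b \<in> p"
    then obtain x y where xy: "x \<in> u" "y \<in> u" "x \<lless> a" "y \<lless> b" using u by (auto simp: the_end_def)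
    then have "x \<sqinter> y \<lless> a \<sqinter> b" using c uc by (intro ll_meet) auto
    moreover have "x \<sqinter> y \<in> u" using u xy by (auto simp: ultra_def)
    ultimately show "a \<sqinter> b \<in> p" using c u by (auto simp: the_end_def)
  qed
qed

lemma end_up: "p \<in> ends \<Longrightarrow> a \<in> p \<Longrightarrow> b \<in> carrier B \<Longrightarrow> a \<sqsubseteq> b \<Longrightarrow> b \<in> p"
  using end_meet[of p a b] end_carrier[of p a] le_iff_join[of a b] by auto

lemma end_round:
  assumes "p \<in> ends" "a \<in> p"
  shows "\<exists>b\<in>p. b \<lless> a"
proof -
  obtain u where u: "ultra B u" "p = the_end u" using assms by (auto simp: ends_def)
  then obtain x where x: "x \<in> u" "x \<lless> a" "a \<in> carrier B" using assms by (auto simp: the_end_def)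
  then have "x \<in> carrier B" using u by (auto simp: ultra_def)
  then obtain b where "b \<in> carrier B" "x \<lless> b" "b \<lless> a" using ll_interpolate x by blast
  then show ?thesis using x u by (auto simp: the_end_def)
qed

text \<open>Interpolating \<open>x\<close> between \<open>a\<close> and \<open>b\<close> and asking
  whether the ultrafilter contains \<open>x\<close> or its complement decides the alternative. It is
  the main tool for separating ends.\<close>

lemma end_dichotomy:
  assumes p: "p \<in> ends" and ab: "a \<lless> b" and c: "a \<in> carrier B" "b \<in> carrier B"
  shows "cmpl B a \<in> p \<or> b \<in> p"
proof -
  obtain u where u: "ultra B u" "p = the_end u" using p by (auto simp: ends_def)
  obtain x where x: "x \<in> carrier B" "a \<lless> x" "x \<lless> b" using ll_interpolate[OF ab c] by blast
  have "cmpl B x \<lless> cmpl B a" using ll_cmpl x c by blast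
  moreover have "x \<in> u \<or> cmpl B x \<in> u" using u x by (auto simp: ultra_def)
  ultimately show ?thesis using u c x by (auto simp: the_end_def)
qed

definition basic :: "'a \<Rightarrow> 'a set set" where
  "basic a = {p \<in> ends. a \<in> p}"

lemma basic_meet: "a \<in> carrier B \<Longrightarrow> b \<in> carrier B \<Longrightarrow> basic (a \<sqinter> b) = basic a \<inter> basic b"
  using end_meet by (auto simp: basic_def)

lemma basic_top: "basic \<top> = ends" and basic_bot: "basic \<bottom> = {}"
  using end_top end_bot by (auto simp: basic_def)

lemma basic_mono: "a \<in> carrier B \<Longrightarrow> b \<in> carrier B \<Longrightarrow> a \<sqsubseteq> b \<Longrightarrow> basic a \<subseteq> basic b"
  using end_up by (auto simp: basic_def)

text \<open>Here \<open>C6\<close> enters, through \<open>ex_ll\<close>: an ultrafilter through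
  \<open>a\<close> may have an end that omits \<open>a\<close>, whereas one through some nonzero
  \<open>b\<close> well inside \<open>a\<close> has an end containing \<open>a\<close>.\<close>

lemma basic_nonempty:
  assumes "a \<in> carrier B" "a \<noteq> \<bottom>"
  shows "basic a \<noteq> {}"
proof -
  obtain b where b: "b \<in> carrier B" "b \<noteq> \<bottom>" "b \<lless> a" using ex_ll assms by blast
  then obtain u where "ultra B u" "b \<in> u" using ultrafilter_extension[of "{b}"] by auto
  then have "the_end u \<in> basic a" using b assms by (auto simp: basic_def ends_def the_end_def)
  then show ?thesis by blast
qed

lemma basic_disjoint:
  assumes "a \<in> carrier B" "b \<in> carrier B" "basic a \<inter> basic b = {}"
  shows "a \<sqsubseteq> cmpl B b"
proof -
  have "a \<sqinter> b = \<bottom>" using basic_nonempty[of "a \<sqinter> b"] assms basic_meet by auto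
  then show ?thesis using le_cmpl_if_disjoint assms by blast
qed

section \<open>The compact Hausdorff topology on the ends\<close>

definition end_space :: "'a set topology" where
  "end_space = topology (\<lambda>U. U \<subseteq> ends \<and> (\<forall>p\<in>U. \<exists>a\<in>carrier B. p \<in> basic a \<and> basic a \<subseteq> U))"

lemma openin_end_space:
  "openin end_space U \<longleftrightarrow> U \<subseteq> ends \<and> (\<forall>p\<in>U. \<exists>a\<in>carrier B. p \<in> basic a \<and> basic a \<subseteq> U)"
proof -
  let ?P = "\<lambda>U. U \<subseteq> ends \<and> (\<forall>p\<in>U. \<exists>a\<in>carrier B. p \<in> basic a \<and> basic a \<subseteq> U)"
  have "istopology ?P"
    unfolding istopology_def
  proof (intro conjI allI impI)
    fix S T assume S: "?P S" and T: "?P T"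
    show "S \<inter> T \<subseteq> ends" using S by blast
    show "\<forall>p\<in>S \<inter> T. \<exists>a\<in>carrier B. p \<in> basic a \<and> basic a \<subseteq> S \<inter> T"
    proof
      fix p assume "p \<in> S \<inter> T"
      then obtain a b where "a \<in> carrier B" "b \<in> carrier B" "p \<in> basic a" "basic a \<subseteq> S" "p \<in> basic b" "basic b \<subseteq> T"
        using S T by blast
      then show "\<exists>a\<in>carrier B. p \<in> basic a \<and> basic a \<subseteq> S \<inter> T"
        by (intro bexI[of _ "a \<sqinter> b"]) (auto simp: basic_meet)
    qed
  next
    fix K assume K: "\<forall>S\<in>K. ?P S"
    show "\<Union>K \<subseteq> ends" using K by blast
    show "\<forall>p\<in>\<Union>K. \<exists>a\<in>carrier B. p \<in> basic a \<and> basic a \<subseteq> \<Union>K"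
      using K by (meson UnionE Union_upper subset_trans)
  qed
  then show ?thesis by (simp add: end_space_def topology_inverse')
qed

lemma openin_basic: "a \<in> carrier B \<Longrightarrow> openin end_space (basic a)"
  by (auto simp: openin_end_space basic_def)

lemma topspace_end_space [simp]: "topspace end_space = ends"
proof
  show "topspace end_space \<subseteq> ends" using openin_end_space openin_topspace by blast
  show "ends \<subseteq> topspace end_space" using openin_basic[of \<top>] basic_top openin_subset by fastforce
qed

text \<open>If \<open>a\<close> lies in \<open>p\<close> but not in \<open>q\<close>, roundness
  gives \<open>b\<close> in \<open>p\<close> well inside \<open>a\<close>, and the dichotomy forces
  \<open>cmpl B b\<close> into \<open>q\<close>.\<close>

lemma Hausdorff_end_space: "Hausdorff_space end_space"
proof -
  have sep: "\<exists>U V. openin end_space U \<and> openin end_space V \<and> p \<in> U \<and> q \<in> V \<and> disjnt U V"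
    if p: "p \<in> ends" and q: "q \<in> ends" and a: "a \<in> p" "a \<notin> q" for p q a
  proof -
    obtain b where b: "b \<in> p" "b \<lless> a" using end_round p a by blast
    have c: "a \<in> carrier B" "b \<in> carrier B" using end_carrier p a b by auto
    then have "cmpl B b \<in> q" using end_dichotomy[OF q b(2)] a by blast
    then show ?thesis
      using b p q c openin_basic[of b] openin_basic[of "cmpl B b"] end_disjoint
      by (intro exI[of _ "basic b"] exI[of _ "basic (cmpl B b)"]) (auto simp: basic_def disjnt_def)
  qed
  show ?thesis
    unfolding Hausdorff_space_def topspace_end_space
  proof (intro allI impI)
    fix p q assume pq: "p \<in> ends \<and> q \<in> ends \<and> p \<noteq> q"
    then consider a where "a \<in> p" "a \<notin> q" | a where "a \<in> q" "a \<notin> p" by blast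
    then show "\<exists>U V. openin end_space U \<and> openin end_space V \<and> p \<in> U \<and> q \<in> V \<and> disjnt U V"
    proof cases
      case 1 then show ?thesis using sep[of p q] pq by blast
    next
      case 2 then show ?thesis using sep[of q p] pq disjnt_sym by metis
    qed
  qed
qed

text \<open>Without a finite subcover the complements of small elements are directed and avoid
  \<bottom>. An ultrafilter containing them has an end that no member of the cover can contain,
  since such a member would make an element of the ultrafilter small.\<close>

lemma compact_end_space: "compact_space end_space"
  unfolding compact_space_def compactin_def topspace_end_space
proof (intro conjI allI impI)
  fix \<U> assume \<U>: "Ball \<U> (openin end_space) \<and> ends \<subseteq> \<Union>\<U>"
  show "\<exists>\<F>. finite \<F> \<and> \<F> \<subseteq> \<U> \<and> ends \<subseteq> \<Union>\<F>"
  proof (rule ccontr)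
    assume no: "\<nexists>\<F>. finite \<F> \<and> \<F> \<subseteq> \<U> \<and> ends \<subseteq> \<Union>\<F>"
    \<comment> \<open>The buffer \<open>d\<close> makes smallness stable under joins:
      \<open>basic (d \<squnion> d')\<close> may exceed the union of \<open>basic d\<close> and
      \<open>basic d'\<close>, but for interpolated elements \<open>x\<close> and \<open>x'\<close>
      the dichotomy keeps \<open>basic (x \<squnion> x')\<close> inside that union.\<close>
    define small where "small c \<longleftrightarrow> c \<in> carrier B \<and>
      (\<exists>\<F> d. finite \<F> \<and> \<F> \<subseteq> \<U> \<and> d \<in> carrier B \<and> c \<lless> d \<and> basic d \<subseteq> \<Union>\<F>)" for c
    have small_join: "small (c \<squnion> c')" if sm: "small c" "small c'" for c c'
    proof -
      obtain \<F> d \<F>' d' where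
        1: "c \<in> carrier B" "finite \<F>" "\<F> \<subseteq> \<U>" "d \<in> carrier B" "c \<lless> d" "basic d \<subseteq> \<Union>\<F>" and
        2: "c' \<in> carrier B" "finite \<F>'" "\<F>' \<subseteq> \<U>" "d' \<in> carrier B" "c' \<lless> d'" "basic d' \<subseteq> \<Union>\<F>'"
        using sm[unfolded small_def] by blast
      obtain x where x: "x \<in> carrier B" "c \<lless> x" "x \<lless> d" using ll_interpolate 1 by blast
      obtain x' where x': "x' \<in> carrier B" "c' \<lless> x'" "x' \<lless> d'" using ll_interpolate 2 by blast
      have "basic (x \<squnion> x') \<subseteq> basic d \<union> basic d'"
      proof
        fix p assume p: "p \<in> basic (x \<squnion> x')"
        then have pe: "p \<in> ends" and xp: "x \<squnion> x' \<in> p" by (auto simp: basic_def)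
        show "p \<in> basic d \<union> basic d'"
        proof (rule ccontr)
          assume "p \<notin> basic d \<union> basic d'"
          then have "cmpl B x \<in> p" "cmpl B x' \<in> p"
            using end_dichotomy[OF pe x(3)] end_dichotomy[OF pe x'(3)] x x' 1 2 pe by (auto simp: basic_def)
          then have "cmpl B x \<sqinter> cmpl B x' \<in> p" using end_meet[OF pe] x x' by simp
          moreover have "cmpl B x \<sqinter> cmpl B x' = cmpl B (x \<squnion> x')"
            using x x' by (auto simp: eq_iff_stone ultraD)
          ultimately show False using end_disjoint[OF pe xp] by simp
        qed
      qed
      moreover have "c \<squnion> c' \<lless> x \<squnion> x'" using ll_join 1 2 x x' by simp
      ultimately show ?thesis
        unfolding small_def using 1 2 x x'
        by (intro conjI exI[of _ "\<F> \<union> \<F>'"] exI[of _ "x \<squnion> x'"]) auto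
    qed
    have "\<not> small \<top>"
    proof
      assume "small \<top>"
      then obtain \<F> d where d: "finite \<F>" "\<F> \<subseteq> \<U>" "d \<in> carrier B" "\<top> \<lless> d" "basic d \<subseteq> \<Union>\<F>"
        unfolding small_def by blast
      have "\<top> \<sqsubseteq> d" using ll_imp_le[OF d(4)] d(3) by simp
      then have "ends \<subseteq> basic d" using basic_mono[of \<top> d] d(3) by (simp add: basic_top)
      then show False using no d by blast
    qed
    define R where "R = cmpl B ` {x. small x}"
    have sc: "x \<in> carrier B" if "small x" for x using that by (simp add: small_def)
    have "\<exists>u. ultra B u \<and> R \<subseteq> u"
    proof (rule ultrafilter_extension)
      show "R \<subseteq> carrier B" using sc by (auto simp: R_def)
      have "small \<bottom>"
        unfolding small_def using ll_bot by (intro conjI exI[of _ "{}"] exI[of _ \<bottom>]) (auto simp: basic_bot)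
      then show "R \<noteq> {}" by (auto simp: R_def)
      show "\<bottom> \<notin> R"
      proof
        assume "\<bottom> \<in> R"
        then obtain x where x: "small x" "cmpl B x = \<bottom>" by (auto simp: R_def)
        then have "x = \<top>" using cmpl_cmpl[OF sc[OF x(1)]] cmpl_bot_top by simp
        then show False using \<open>\<not> small \<top>\<close> x by simp
      qed
      fix x y assume "x \<in> R" "y \<in> R"
      then obtain c d where cd: "small c" "small d" "x = cmpl B c" "y = cmpl B d" by (auto simp: R_def)
      have "cmpl B (c \<squnion> d) \<sqsubseteq> x" "cmpl B (c \<squnion> d) \<sqsubseteq> y"
        using sc cd by (simp_all add: le_iff_stone ultraD)
      then show "\<exists>z\<in>R. z \<sqsubseteq> x \<and> z \<sqsubseteq> y" using small_join[OF cd(1,2)] by (auto simp: R_def)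
    qed
    then obtain u where u: "ultra B u" "R \<subseteq> u" by blast
    then have p: "the_end u \<in> ends" by (auto simp: ends_def)
    then obtain U where U: "U \<in> \<U>" "the_end u \<in> U" using \<U> by blast
    then have "openin end_space U" using \<U> by blast
    then obtain a where a: "a \<in> carrier B" "the_end u \<in> basic a" "basic a \<subseteq> U"
      using U unfolding openin_end_space by blast
    then obtain b where b: "b \<in> u" "b \<lless> a" by (auto simp: basic_def the_end_def)
    have bc: "b \<in> carrier B" using b u by (auto simp: ultra_def)
    then have "small b" unfolding small_def using a b U by (intro conjI exI[of _ "{U}"] exI[of _ a]) auto
    then have "cmpl B b \<in> u" using u by (auto simp: R_def)
    then show False using ultraD(6)[OF u(1) bc] b by blast
  qed
qed simp

section \<open>The algebra as the regular closed sets of its space of ends\<close>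

definition end_rep :: "'a \<Rightarrow> 'a set set" where
  "end_rep a = ends - basic (cmpl B a)"

lemma end_rep_closure:
  assumes a: "a \<in> carrier B"
  shows "end_rep a = end_space closure_of (basic a)"
proof
  show "end_space closure_of (basic a) \<subseteq> end_rep a"
  proof (rule closure_of_minimal)
    show "basic a \<subseteq> end_rep a" using end_disjoint by (auto simp: basic_def end_rep_def)
    show "closedin end_space (end_rep a)"
      using openin_basic[of "cmpl B a"] a by (metis cmpl_in end_rep_def openin_closedin_eq topspace_end_space
          closedin_diff closedin_topspace)
  qed
  show "end_rep a \<subseteq> end_space closure_of (basic a)"
  proof
    fix p assume p: "p \<in> end_rep a"
    have "\<exists>q. q \<in> basic a \<and> q \<in> T" if T: "p \<in> T" "openin end_space T" for T
    proof (rule ccontr)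
      assume n: "\<nexists>q. q \<in> basic a \<and> q \<in> T"
      obtain b where b: "b \<in> carrier B" "p \<in> basic b" "basic b \<subseteq> T"
        using T unfolding openin_end_space by blast
      then have "b \<sqsubseteq> cmpl B a" using basic_disjoint[OF b(1) a] n by blast
      then show False using basic_mono[of b "cmpl B a"] a b p by (auto simp: end_rep_def)
    qed
    then show "p \<in> end_space closure_of (basic a)" using p by (auto simp: in_closure_of end_rep_def)
  qed
qed

lemma end_rep_le_iff:
  assumes a: "a \<in> carrier B" and b: "b \<in> carrier B"
  shows "a \<sqsubseteq> b \<longleftrightarrow> end_rep a \<subseteq> end_rep b"
proof
  assume "a \<sqsubseteq> b"
  then show "end_rep a \<subseteq> end_rep b"
    using basic_mono[OF a b] by (simp add: end_rep_closure a b closure_of_mono)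
next
  assume s: "end_rep a \<subseteq> end_rep b"
  have "basic a \<inter> basic (cmpl B b) = {}"
    using s end_disjoint by (auto simp: end_rep_def basic_def)
  then have "a \<sqsubseteq> cmpl B (cmpl B b)" using basic_disjoint a b by simp
  then show "a \<sqsubseteq> b" using cmpl_cmpl b by simp
qed

text \<open>The witness is the join of all elements whose basic set lies in \<open>F\<close>. A
  basic set inside \<open>basic s\<close> but outside \<open>F\<close> would be disjoint from every
  member of the family, hence its element would be disjoint from the join, which is absurd.\<close>

lemma end_rep_surj:
  assumes F: "F \<in> carrier (RC end_space)"
  shows "\<exists>s\<in>carrier B. end_rep s = F"
proof -
  let ?S = "{a \<in> carrier B. basic a \<subseteq> F}"
  define s where "s = \<Squnion>?S"
  have s: "s \<in> carrier B" by (simp add: s_def)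
  have up: "a \<sqsubseteq> s" if "a \<in> ?S" for a unfolding s_def using that by (intro sup_upper) auto
  have Fe: "F \<subseteq> ends" using RC_subset_topspace[OF F] by simp
  have "basic s \<subseteq> F"
  proof (rule ccontr)
    assume n: "\<not> basic s \<subseteq> F"
    have "openin end_space (basic s - F)" using openin_basic[OF s] RC_closed[OF F] by (rule openin_diff)
    then obtain d q where d: "d \<in> carrier B" "q \<in> basic d" "basic d \<subseteq> basic s - F"
      using n unfolding openin_end_space by blast
    have "s \<sqsubseteq> cmpl B d"
      unfolding s_def
    proof (rule sup_least)
      fix a assume "a \<in> ?S"
      then show "a \<sqsubseteq> cmpl B d" using d by (intro basic_disjoint) auto
    qed (use d in auto)
    then have "q \<in> basic (cmpl B d)" using basic_mono[OF s, of "cmpl B d"] d by auto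
    then show False using d(2) end_disjoint by (auto simp: basic_def)
  qed
  then have "end_rep s \<subseteq> F" using RC_closed[OF F] by (simp add: end_rep_closure s closure_of_minimal)
  moreover have "end_space interior_of F \<subseteq> basic s"
  proof
    fix p assume p: "p \<in> end_space interior_of F"
    have "openin end_space (end_space interior_of F)" by simp
    then obtain a where a: "a \<in> carrier B" "p \<in> basic a" "basic a \<subseteq> end_space interior_of F"
      using p unfolding openin_end_space by blast
    then have "a \<sqsubseteq> s" using up[of a] interior_of_subset[of end_space F] by blast
    then show "p \<in> basic s" using basic_mono[OF a(1) s] a(2) by blast
  qed
  then have "F \<subseteq> end_rep s"
    using closure_of_mono[of "end_space interior_of F" "basic s" end_space] RC_closure_interior[OF F]
    by (simp add: end_rep_closure s)
  ultimately show ?thesis using s by blast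
qed

text \<open>Elements in contact need an end that omits both complements, so an ultrafilter is sought
  that contains the complement of everything well inside \<open>cmpl B a\<close> or
  \<open>cmpl B b\<close>. If these complements met in \<bottom>, say for \<open>c\<close> and
  \<open>d\<close>, then \<open>a\<close> would be well inside \<open>cmpl B c\<close>, which is
  below \<open>d\<close>, which is well inside \<open>cmpl B b\<close>, against the contact of
  \<open>a\<close> and \<open>b\<close>.\<close>

lemma end_rep_contact:
  assumes a: "a \<in> carrier B" and b: "b \<in> carrier B"
  shows "contact B a b \<longleftrightarrow> end_rep a \<inter> end_rep b \<noteq> {}"
proof
  assume ab: "contact B a b"
  let ?R = "{cmpl B c \<sqinter> cmpl B d |c d. c \<in> carrier B \<and> d \<in> carrier B \<and> c \<lless> cmpl B a \<and> d \<lless> cmpl B b}"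
  have "\<exists>u. ultra B u \<and> ?R \<subseteq> u"
  proof (rule ultrafilter_extension)
    show "?R \<subseteq> carrier B" by auto
    show "?R \<noteq> {}" using ll_bot a b bottom_closed cmpl_in by blast
    show "\<bottom> \<notin> ?R"
    proof
      assume "\<bottom> \<in> ?R"
      then obtain c d where cd: "c \<in> carrier B" "d \<in> carrier B" "c \<lless> cmpl B a" "d \<lless> cmpl B b"
        "cmpl B c \<sqinter> cmpl B d = \<bottom>" by auto
      have "cmpl B c \<sqsubseteq> d" using cd by (auto simp: le_iff_stone eq_iff_stone ultraD)
      moreover have "a \<lless> cmpl B c" using ll_cmpl[OF cd(3)] cd a by (simp add: cmpl_cmpl)
      ultimately have "a \<lless> d" using ll_mono[of a "cmpl B c" a d] cd a by simp
      then have "a \<lless> cmpl B b"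
        using ll_mono[OF cd(4), of a "cmpl B b"] ll_imp_le[of a d] cd a b by simp
      then show False using ab b by (simp add: well_inside_def cmpl_cmpl)
    qed
    fix x y assume "x \<in> ?R" "y \<in> ?R"
    then obtain c d c' d' where
      1: "c \<in> carrier B" "d \<in> carrier B" "c \<lless> cmpl B a" "d \<lless> cmpl B b" "x = cmpl B c \<sqinter> cmpl B d" and
      2: "c' \<in> carrier B" "d' \<in> carrier B" "c' \<lless> cmpl B a" "d' \<lless> cmpl B b" "y = cmpl B c' \<sqinter> cmpl B d'"
      by blast
    have j: "x \<squnion> x = x" if "x \<in> carrier B" for x using le_iff_meet[of x x] that by simp
    have "c \<squnion> c' \<lless> cmpl B a" "d \<squnion> d' \<lless> cmpl B b"
      using ll_join[OF 1(3) 2(3)] ll_join[OF 1(4) 2(4)] 1 2 a b j by auto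
    then have "cmpl B (c \<squnion> c') \<sqinter> cmpl B (d \<squnion> d') \<in> ?R"
      using 1(1,2) 2(1,2) by (intro CollectI exI[of _ "c \<squnion> c'"] exI[of _ "d \<squnion> d'"]) simp
    moreover have "cmpl B (c \<squnion> c') \<sqinter> cmpl B (d \<squnion> d') \<sqsubseteq> x" "cmpl B (c \<squnion> c') \<sqinter> cmpl B (d \<squnion> d') \<sqsubseteq> y"
      using 1 2 by (auto simp: le_iff_stone ultraD)
    ultimately show "\<exists>z\<in>?R. z \<sqsubseteq> x \<and> z \<sqsubseteq> y" by blast
  qed
  then obtain u where u: "ultra B u" "?R \<subseteq> u" by blast
  have "cmpl B c \<sqinter> cmpl B \<bottom> \<in> u" if "c \<in> carrier B" "c \<lless> cmpl B a" for c
    using that b ll_bot[of "cmpl B b"]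
    by (intro subsetD[OF u(2)] CollectI exI[of _ c] exI[of _ \<bottom>]) simp
  then have ua: "c \<notin> u" if "c \<in> carrier B" "c \<lless> cmpl B a" for c
    using that ultraD(4,6)[OF u(1)] by auto
  have "cmpl B \<bottom> \<sqinter> cmpl B c \<in> u" if "c \<in> carrier B" "c \<lless> cmpl B b" for c
    using that a ll_bot[of "cmpl B a"]
    by (intro subsetD[OF u(2)] CollectI exI[of _ \<bottom>] exI[of _ c]) simp
  then have ub: "c \<notin> u" if "c \<in> carrier B" "c \<lless> cmpl B b" for c
    using that ultraD(4,6)[OF u(1)] by auto
  have uc: "u \<subseteq> carrier B" using u(1) by (simp add: ultra_def)
  have "the_end u \<in> end_rep a \<inter> end_rep b"
    using u(1) ua ub uc by (auto simp: end_rep_def ends_def basic_def) (auto simp: the_end_def)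
  then show "end_rep a \<inter> end_rep b \<noteq> {}" by blast
next
  assume ne: "end_rep a \<inter> end_rep b \<noteq> {}"
  show "contact B a b"
  proof (rule ccontr)
    assume "\<not> contact B a b"
    then have "a \<lless> cmpl B b" using b by (simp add: well_inside_def cmpl_cmpl)
    then have "cmpl B a \<in> p \<or> cmpl B b \<in> p" if "p \<in> ends" for p
      using end_dichotomy[OF that] a b by simp
    then show False using ne by (auto simp: end_rep_def basic_def)
  qed
qed

lemma end_rep_bij: "bij_betw end_rep (carrier B) (carrier (RC end_space))"
  unfolding bij_betw_def
proof
  show "inj_on end_rep (carrier B)"
    using end_rep_le_iff le_antisym by (intro inj_onI) auto
  show "end_rep ` carrier B = carrier (RC end_space)"
  proof
    show "end_rep ` carrier B \<subseteq> carrier (RC end_space)"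
    proof
      fix F assume "F \<in> end_rep ` carrier B"
      then obtain a where a: "a \<in> carrier B" "F = end_rep a" by blast
      then show "F \<in> carrier (RC end_space)"
        unfolding a(2) end_rep_closure[OF a(1)] by (intro RC_closure_of_open openin_basic)
    qed
    show "carrier (RC end_space) \<subseteq> end_rep ` carrier B"
      using end_rep_surj by (intro subsetI) (metis imageI)
  qed
qed

end

lemma represented_ends:
  assumes "cnca T"
  shows "represented T (cnca.end_space T) (cnca.end_rep T)"
proof -
  interpret cnca T by (rule assms)
  show ?thesis
    by (intro represented.intro represented_axioms.intro boolean_alg_axioms complete_lattice_axioms
        compact_end_space Hausdorff_end_space end_rep_bij end_rep_le_iff end_rep_contact)
qed

section \<open>The tree of intervals\<close>

text \<open>A strictly increasing two-sided sequence with limits \<open>0\<close> and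
  \<open>1\<close>. The value \<open>1/2\<close> at index \<open>0\<close> bounds every gap by
  \<open>1/2\<close>, so that widths at least halve from one depth to the next.\<close>

definition tick :: "int \<Rightarrow> real" where
  "tick m = (if 0 \<le> m then 1 - 1 / (2 * (1 + of_int m)) else 1 / (2 * (1 - of_int m)))"

text \<open>
  Since \<open>Z\<^sub>0\<close> omits \<open>0\<close>, the child \<open>p\<close> of a cell is placed between the cut points \<open>idx p\<close> and
  \<open>idx p + 1\<close>; the \<open>m\<close>-th cut point sits at the fraction \<open>tick m\<close> of the cell.
\<close>

definition idx :: "int \<Rightarrow> int" where
  "idx p = (if p > 0 then p - 1 else p)"

primrec wid :: "nat \<Rightarrow> (nat \<Rightarrow> int) \<Rightarrow> real" where
  "wid 0 n = 1"
| "wid (Suc k) n = wid k n * (tick (idx (n (Suc k)) + 1) - tick (idx (n (Suc k))))"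

primrec lo :: "nat \<Rightarrow> (nat \<Rightarrow> int) \<Rightarrow> real" where
  "lo 0 n = 0"
| "lo (Suc k) n = lo k n + wid k n * tick (idx (n (Suc k)))"

definition hi :: "nat \<Rightarrow> (nat \<Rightarrow> int) \<Rightarrow> real" where
  "hi k n = lo k n + wid k n"

definition pt :: "nat \<Rightarrow> (nat \<Rightarrow> int) \<Rightarrow> int \<Rightarrow> real" where
  "pt k n m = lo k n + wid k n * tick m"

lemma tick_bounds: "0 < tick m" "tick m < 1"
  by (auto simp: tick_def field_simps)

lemma tick_half: "0 \<le> m \<Longrightarrow> 1/2 \<le> tick m" "m \<le> 0 \<Longrightarrow> tick m \<le> 1/2"
  by (auto simp: tick_def field_simps)

lemma tick_less: "m < m' \<Longrightarrow> tick m < tick m'"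
proof -
  assume m: "m < m'"
  consider "0 \<le> m" | "m < 0" "0 \<le> m'" | "m' < 0" using m by linarith
  then show ?thesis
  proof cases
    case 2
    have "tick m < 1/2" using 2 by (auto simp: tick_def field_simps)
    then show ?thesis using tick_half(1)[OF 2(2)] by linarith
  qed (use m in \<open>auto simp: tick_def field_simps\<close>)
qed

lemma tick_less_iff: "tick m < tick m' \<longleftrightarrow> m < m'"
  using tick_less[of m m'] tick_less[of m' m] by (cases m m' rule: linorder_cases) auto

lemma tick_gap: "tick (m + 1) - tick m \<le> 1/2"
proof (cases "0 \<le> m")
  case True then show ?thesis using tick_half(1)[of m] tick_bounds(2)[of "m + 1"] by linarith
next
  case False then show ?thesis using tick_half(2)[of "m + 1"] tick_bounds(1)[of m] by linarith
qed

lemma tick_half_strict: "r \<ge> 1 \<Longrightarrow> 1/2 < tick r" "r \<ge> 1 \<Longrightarrow> tick (- r) < 1/2"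
  using tick_less[of 0 r] tick_less[of "- r" 0] by (auto simp: tick_def)

lemma tick_limits:
  assumes "\<epsilon> > 0"
  shows "\<exists>r\<ge>1. 1 - tick (int r) < \<epsilon> \<and> tick (- int r) < \<epsilon>"
proof -
  obtain r :: nat where r: "1 / \<epsilon> < real r" using reals_Archimedean2 by blast
  have "r \<ge> 1" using r assms by (metis One_nat_def Suc_leI divide_pos_pos gr_zeroI not_less_iff_gr_or_eq of_nat_0 zero_less_one)
  have "1 / (2 * (1 + real r)) < \<epsilon>"
  proof -
    have "1 < \<epsilon> * real r" using r assms by (simp add: field_simps)
    also have "\<dots> \<le> \<epsilon> * (2 * (1 + real r))" using assms by simp
    finally show ?thesis by (simp add: field_simps)
  qed
  then show ?thesis using \<open>r \<ge> 1\<close> by (intro exI[of _ r]) (auto simp: tick_def)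
qed

lemma tick_locate:
  assumes "0 < s" "s < 1"
  shows "\<exists>m. tick m \<le> s \<and> s < tick (m + 1)"
proof -
  obtain r where r: "r \<ge> 1" "1 - tick (int r) < 1 - s" using tick_limits[of "1 - s"] assms by auto
  obtain r' where r': "r' \<ge> 1" "tick (- int r') < s" using tick_limits[of s] assms by auto
  \<comment> \<open>A climb by unit steps from \<open>- int r'\<close>, where \<open>tick\<close> is
    below \<open>s\<close>: if no step crossed \<open>s\<close>, the value at \<open>int r\<close>
    would still be at most \<open>s\<close>.\<close>
  have "\<exists>k. tick (- int r' + int k) \<le> s \<and> s < tick (- int r' + int k + 1)"
  proof (rule ccontr)
    assume n: "\<not> ?thesis"
    have "tick (- int r' + int k) \<le> s" for k
    proof (induction k)
      case 0 then show ?case using r' by simp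
    next
      case (Suc k)
      have "\<not> s < tick (- int r' + int k + 1)" using n Suc.IH by blast
      moreover have "- int r' + int (Suc k) = - int r' + int k + 1" by simp
      ultimately show ?case by (metis not_less)
    qed
    from this[of "r' + r"] show False using r by simp
  qed
  then show ?thesis by blast
qed

lemma idx_prd: "p \<noteq> 0 \<Longrightarrow> idx (prd p) = idx p - 1" and idx_scc: "p \<noteq> 0 \<Longrightarrow> idx (scc p) = idx p + 1"
  by (auto simp: idx_def prd_def scc_def)

lemma prd_nonzero: "p \<noteq> 0 \<Longrightarrow> prd p \<noteq> 0" and scc_nonzero: "p \<noteq> 0 \<Longrightarrow> scc p \<noteq> 0"
  by (auto simp: prd_def scc_def)

lemma idx_eq_iff: "p \<noteq> 0 \<Longrightarrow> q \<noteq> 0 \<Longrightarrow> idx p = idx q \<longleftrightarrow> p = q"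
  by (auto simp: idx_def)

lemma idx_surj: "\<exists>p. p \<noteq> 0 \<and> idx p = m"
  by (rule exI[of _ "if m \<ge> 0 then m + 1 else m"]) (simp add: idx_def)

lemma wid_pos: "0 < wid k n"
  by (induction k) (auto simp: tick_less)

lemma wid_le: "wid k n \<le> (1/2) ^ k"
proof (induction k)
  case (Suc k)
  have "wid k n * (tick (idx (n (Suc k)) + 1) - tick (idx (n (Suc k)))) \<le> (1/2)^k * (1/2)"
    using Suc tick_gap wid_pos[of k n] tick_less[of "idx (n (Suc k))" "idx (n (Suc k)) + 1"]
    by (intro mult_mono) auto
  then show ?case by simp
qed simp

lemma lo_Suc: "lo (Suc k) n = pt k n (idx (n (Suc k)))"
  by (simp add: pt_def)

lemma hi_Suc: "hi (Suc k) n = pt k n (idx (n (Suc k)) + 1)"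
  by (simp add: pt_def hi_def algebra_simps)

lemma lo_less_hi: "lo k n < hi k n"
  using wid_pos by (simp add: hi_def)

lemma pt_less_iff: "pt k n m < pt k n m' \<longleftrightarrow> m < m'"
  using wid_pos[of k n] by (simp add: pt_def tick_less_iff)

lemma pt_le_iff: "pt k n m \<le> pt k n m' \<longleftrightarrow> m \<le> m'"
  using pt_less_iff[of k n m' m] by linarith

lemma pt_bounds: "lo k n < pt k n m" "pt k n m < hi k n"
  using wid_pos[of k n] tick_bounds[of m] by (auto simp: pt_def hi_def)

definition agree :: "nat \<Rightarrow> (nat \<Rightarrow> int) \<Rightarrow> (nat \<Rightarrow> int) \<Rightarrow> bool" where
  "agree k n n' \<longleftrightarrow> (\<forall>i\<in>{1..k}. n i = n' i)"

lemma agree_Suc: "agree (Suc k) n n' \<longleftrightarrow> agree k n n' \<and> n (Suc k) = n' (Suc k)"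
  by (auto simp: agree_def atLeastAtMostSuc_conv)

lemma agree_upd: "agree k (n(Suc k := p)) n"
  by (simp add: agree_def)

lemma wid_cong: "agree k n n' \<Longrightarrow> wid k n = wid k n'"
  by (induction k) (auto simp: agree_Suc)

lemma lo_cong: "agree k n n' \<Longrightarrow> lo k n = lo k n'"
  by (induction k) (auto simp: agree_Suc wid_cong)

lemma hi_cong: "agree k n n' \<Longrightarrow> hi k n = hi k n'"
  by (simp add: hi_def lo_cong wid_cong)

lemma pt_cong: "agree k n n' \<Longrightarrow> pt k n m = pt k n' m"
  by (simp add: pt_def lo_cong wid_cong)

lemma nested_aux: "lo k n \<le> lo (k + d) n \<and> hi (k + d) n \<le> hi k n"
proof (induction d)
  case (Suc d)
  then show ?case
    using pt_bounds(1)[of "k + d" n "idx (n (Suc (k + d)))"] pt_bounds(2)[of "k + d" n "idx (n (Suc (k + d))) + 1"]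
      lo_Suc[of "k + d" n] hi_Suc[of "k + d" n] by (simp del: lo.simps)
qed simp

lemma nested: "k \<le> l \<Longrightarrow> lo k n \<le> lo l n" "k \<le> l \<Longrightarrow> hi l n \<le> hi k n"
  using nested_aux[of k n "l - k"] by auto

lemma nested_Suc: "lo k n < lo (Suc k) n" "hi (Suc k) n < hi k n"
  unfolding lo_Suc hi_Suc by (rule pt_bounds)+

definition cell_cl :: "nat \<Rightarrow> (nat \<Rightarrow> int) \<Rightarrow> real set" where
  "cell_cl k n = {lo k n..hi k n}"

definition cell_op :: "nat \<Rightarrow> (nat \<Rightarrow> int) \<Rightarrow> real set" where
  "cell_op k n = {lo k n<..<hi k n}"

lemma cell_op_cl: "cell_op k n \<subseteq> cell_cl k n"
  by (auto simp: cell_op_def cell_cl_def)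

lemma cell_op_nonempty: "cell_op k n \<noteq> {}"
  using lo_less_hi[of k n] by (auto simp: cell_op_def)

lemma cell_op_mono: "k \<le> l \<Longrightarrow> cell_op l n \<subseteq> cell_op k n"
  using nested[of k l n] by (auto simp: cell_op_def)

lemma cell_cl_mono: "k \<le> l \<Longrightarrow> cell_cl l n \<subseteq> cell_cl k n"
  using nested[of k l n] by (auto simp: cell_cl_def)

lemma cell_cl_subset_op: "k < l \<Longrightarrow> cell_cl l n \<subseteq> cell_op k n"
  using nested[of "Suc k" l n] nested_Suc[of k n] by (auto simp: cell_op_def cell_cl_def)

lemma cell_cong: "agree k n n' \<Longrightarrow> cell_cl k n = cell_cl k n'" "agree k n n' \<Longrightarrow> cell_op k n = cell_op k n'"
  by (simp_all add: cell_cl_def cell_op_def lo_cong hi_cong)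

lemma cell_unit: "cell_cl k n \<subseteq> {0..1}" "cell_op k n \<subseteq> {0<..<1}"
  using cell_cl_mono[of 0 k n] cell_op_mono[of 0 k n] by (auto simp: cell_cl_def cell_op_def hi_def)

text \<open>Unlike \<^const>\<open>is_tuple\<close>, this admits \<open>k = 0\<close>, the code of the whole interval and of \<open>\<top>\<close>.\<close>

definition nz :: "nat \<Rightarrow> (nat \<Rightarrow> int) \<Rightarrow> bool" where
  "nz k n \<longleftrightarrow> (\<forall>i\<in>{1..k}. n i \<noteq> 0)"

lemma nz_mono: "nz k n \<Longrightarrow> j \<le> k \<Longrightarrow> nz j n"
  by (auto simp: nz_def)

lemma nz_Suc: "nz (Suc k) n \<longleftrightarrow> nz k n \<and> n (Suc k) \<noteq> 0"
  by (auto simp: nz_def atLeastAtMostSuc_conv)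

lemma is_tuple_iff: "is_tuple k n \<longleftrightarrow> k \<ge> 1 \<and> nz k n"
  by (auto simp: is_tuple_def nz_def Z0_def)

text \<open>Where the codes first differ, the cells become different children of one cell, separated
  by a cut point, and deeper cells stay inside. One side is closed so that the lemma also applies to
  neighbours with a common end point.\<close>

lemma cells_disjoint:
  assumes "nz m n" "nz m n'" "\<not> agree m n n'"
  shows "cell_op m n \<inter> cell_cl m n' = {}"
  using assms
proof (induction m)
  case 0 then show ?case by (simp add: agree_def)
next
  case (Suc m)
  show ?case
  proof (cases "agree m n n'")
    case False
    then have "cell_op m n \<inter> cell_cl m n' = {}" using Suc by (simp add: nz_Suc)
    then show ?thesis using cell_op_mono[of m "Suc m" n] cell_cl_mono[of m "Suc m" n'] by auto
  next
    case True
    then have "n (Suc m) \<noteq> n' (Suc m)" using Suc.prems by (simp add: agree_Suc)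
    then have "idx (n (Suc m)) \<noteq> idx (n' (Suc m))" using Suc.prems by (simp add: nz_Suc idx_eq_iff)
    then have "idx (n (Suc m)) + 1 \<le> idx (n' (Suc m)) \<or> idx (n' (Suc m)) + 1 \<le> idx (n (Suc m))" by linarith
    then have "hi (Suc m) n \<le> lo (Suc m) n' \<or> hi (Suc m) n' \<le> lo (Suc m) n"
      unfolding lo_Suc hi_Suc pt_cong[OF True] by (simp add: pt_le_iff)
    then show ?thesis by (auto simp: cell_op_def cell_cl_def)
  qed
qed

section \<open>Intervals around the cut points\<close>

definition qlo :: "nat \<Rightarrow> (nat \<Rightarrow> int) \<Rightarrow> nat \<Rightarrow> real" where
  "qlo k n r = pt k (n(k := prd (n k))) (int r)"

definition qhi :: "nat \<Rightarrow> (nat \<Rightarrow> int) \<Rightarrow> nat \<Rightarrow> real" where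
  "qhi k n r = pt k n (- int r)"

text \<open>A neighbourhood of the left end of the cell \<open>n\<close>, reaching into its left
  neighbour. In the numbering by \<open>idx\<close> the first child in \<open>succs (int r)\<close>
  starts at cut point \<open>r\<close>, and the last child in \<open>preds (- int r)\<close> ends at
  cut point \<open>- r\<close>; hence the two bounds.\<close>

definition qset :: "nat \<Rightarrow> (nat \<Rightarrow> int) \<Rightarrow> nat \<Rightarrow> real set" where
  "qset k n r = {qlo k n r..qhi k n r}"

lemma hi_prd: "n (Suc j) \<noteq> 0 \<Longrightarrow> hi (Suc j) (n(Suc j := prd (n (Suc j)))) = lo (Suc j) n"
  unfolding lo_Suc hi_Suc using pt_cong[OF agree_upd[of j n]] by (simp add: idx_prd)

lemma lo_prd: "n (Suc j) \<noteq> 0 \<Longrightarrow> lo (Suc j) (n(Suc j := prd (n (Suc j)))) = pt j n (idx (n (Suc j)) - 1)"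
  unfolding lo_Suc using pt_cong[OF agree_upd[of j n]] by (simp add: idx_prd)

text \<open>For \<open>r \<ge> 1\<close> the fraction \<open>tick r\<close> is beyond
  \<open>1/2\<close> and \<open>tick (- r)\<close> short of it. Staying within the nearer halves
  keeps the intervals around different cut points of one cell apart, as the case
  \<open>l = k\<close> of \<open>cond_qq\<close> requires.\<close>

lemma q_bounds:
  assumes "n (Suc j) \<noteq> 0" "r \<ge> 1"
  defines "a \<equiv> idx (n (Suc j))"
  shows "(pt j n (a - 1) + pt j n a) / 2 < qlo (Suc j) n r" "qlo (Suc j) n r < pt j n a"
    "pt j n a < qhi (Suc j) n r" "qhi (Suc j) n r < (pt j n a + pt j n (a + 1)) / 2"
proof -
  let ?m = "n(Suc j := prd (n (Suc j)))"
  have h: "hi (Suc j) ?m = pt j n a" using hi_prd[of n j] assms lo_Suc[of j n] by simp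
  have l: "lo (Suc j) ?m = pt j n (a - 1)" using lo_prd[of n j] assms by simp
  show "qlo (Suc j) n r < pt j n a" unfolding qlo_def h[symmetric] by (rule pt_bounds)
  show "pt j n a < qhi (Suc j) n r"
    unfolding qhi_def a_def lo_Suc[symmetric] by (rule pt_bounds)
  have w: "wid (Suc j) ?m = pt j n a - pt j n (a - 1)" using h l by (simp add: hi_def del: lo.simps wid.simps)
  have "wid (Suc j) ?m * (1/2) < wid (Suc j) ?m * tick (int r)"
    using tick_half_strict(1)[of "int r"] wid_pos[of "Suc j" ?m] assms(2) by (intro mult_strict_left_mono) auto
  then show "(pt j n (a - 1) + pt j n a) / 2 < qlo (Suc j) n r"
    unfolding qlo_def pt_def[of "Suc j"] l w by (simp add: field_simps)
  have h': "hi (Suc j) n = pt j n (a + 1)" and l': "lo (Suc j) n = pt j n a"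
    by (simp_all only: hi_Suc lo_Suc a_def)
  have w': "wid (Suc j) n = pt j n (a + 1) - pt j n a" using h' l' by (simp add: hi_def del: lo.simps wid.simps)
  have "wid (Suc j) n * tick (- int r) < wid (Suc j) n * (1/2)"
    using tick_half_strict(2)[of "int r"] wid_pos[of "Suc j" n] assms(2) by (intro mult_strict_left_mono) auto
  then show "qhi (Suc j) n r < (pt j n a + pt j n (a + 1)) / 2"
    unfolding qhi_def pt_def[of "Suc j"] l' w' by (simp add: field_simps)
qed

lemma q_nonempty: "n (Suc j) \<noteq> 0 \<Longrightarrow> r \<ge> 1 \<Longrightarrow> qlo (Suc j) n r < qhi (Suc j) n r"
  using q_bounds[of n j r] by linarith

lemma qset_subset: "n (Suc j) \<noteq> 0 \<Longrightarrow> r \<ge> 1 \<Longrightarrow> qset (Suc j) n r \<subseteq> cell_op j n"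
  using q_bounds[of n j r] pt_bounds[of j n "idx (n (Suc j)) - 1"] pt_bounds[of j n "idx (n (Suc j))"]
    pt_bounds[of j n "idx (n (Suc j)) + 1"] by (auto simp: qset_def cell_op_def)

section \<open>Meeting of intervals expressed by the contact conditions on codes\<close>

lemma agree_iff: "(\<forall>i\<in>{1..<Suc j}. n i = n' i) \<longleftrightarrow> agree j n n'"
  by (simp add: agree_def atLeastLessThanSuc_atLeastAtMost)

lemma interval_meets: "(a::real) \<le> b \<Longrightarrow> c \<le> d \<Longrightarrow> {a..b} \<inter> {c..d} \<noteq> {} \<longleftrightarrow> a \<le> d \<and> c \<le> b"
  by (auto simp: max_def min_def)

lemma cell_cl_nonempty: "cell_cl k n \<noteq> {}"
  using lo_less_hi[of k n] by (simp add: cell_cl_def)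

lemma cells_disjoint':
  assumes "nz m n" "nz m n'" "\<not> agree m n n'" "S \<subseteq> cell_op m n" "S' \<subseteq> cell_cl m n'"
  shows "S \<inter> S' = {}"
  using cells_disjoint[OF assms(1-3)] assms(4,5) by blast

text \<open>At equal depth, closed siblings meet when their indices differ by at most one. A deeper
  closed cell lies in an open cell of depth \<open>k\<close>, because cut points accumulate only at
  the ends of a cell and never reach them; so it meets only its own ancestor.\<close>

lemma meets_cell_cell:
  assumes t: "is_tuple k n" "is_tuple l n'" and kl: "k \<le> l"
  shows "cell_cl k n \<inter> cell_cl l n' \<noteq> {} \<longleftrightarrow> cond_bb k n l n'"
proof -
  obtain j where k: "k = Suc j" using t by (cases k) (auto simp: is_tuple_iff)
  have z: "nz k n" "nz l n'" using t by (auto simp: is_tuple_iff)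
  have z': "nz k n'" "nz j n" "nz j n'" "n k \<noteq> 0" "n' k \<noteq> 0"
    using z nz_mono[of l n' k] kl nz_mono[of k n j] nz_mono[of l n' j] k by (auto simp: nz_Suc)
  show ?thesis
  proof (cases "agree j n n'")
    case False
    have "cell_cl k n \<inter> cell_cl l n' = {}"
      using k kl by (intro cells_disjoint'[OF z'(2,3) False] cell_cl_subset_op cell_cl_mono) auto
    moreover have "\<not> cond_bb k n l n'" using False unfolding cond_bb_def k agree_iff by simp
    ultimately show ?thesis by blast
  next
    case True
    show ?thesis
    proof (cases "k = l")
      case l: True
      have "cell_cl k n \<inter> cell_cl l n' \<noteq> {} \<longleftrightarrow> idx (n k) \<le> idx (n' k) + 1 \<and> idx (n' k) \<le> idx (n k) + 1"
        unfolding cell_cl_def l[symmetric]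
        by (subst interval_meets) (simp_all only: lo_less_hi less_imp_le k lo_Suc hi_Suc pt_cong[OF True] pt_le_iff)
      also have "\<dots> \<longleftrightarrow> idx (n' k) = idx (prd (n k)) \<or> idx (n' k) = idx (n k) \<or> idx (n' k) = idx (scc (n k))"
        using z' by (auto simp: idx_prd idx_scc)
      also have "\<dots> \<longleftrightarrow> n' k \<in> {prd (n k), n k, scc (n k)}"
        using z' prd_nonzero[of "n k"] scc_nonzero[of "n k"] by (simp add: idx_eq_iff)
      finally show ?thesis using True l unfolding cond_bb_def k agree_iff by simp
    next
      case l: False
      then have lt: "k < l" using kl by simp
      have "cell_cl k n \<inter> cell_cl l n' \<noteq> {} \<longleftrightarrow> n' k = n k"
      proof (cases "n' k = n k")
        case eq: True
        then have "agree k n n'" using True by (simp add: k agree_Suc)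
        then have "cell_cl l n' \<subseteq> cell_cl k n" using cell_cl_mono[OF kl] cell_cong by metis
        then show ?thesis using eq cell_cl_nonempty[of l n'] by blast
      next
        case ne: False
        then have "\<not> agree k n' n" by (simp add: k agree_Suc)
        then have "cell_cl l n' \<inter> cell_cl k n = {}"
          using cells_disjoint'[of k n' n "cell_cl l n'" "cell_cl k n"] cell_cl_subset_op[OF lt] z' z by blast
        then show ?thesis using ne by blast
      qed
      then show ?thesis using True l unfolding cond_bb_def k agree_iff by simp
    qed
  qed
qed

text \<open>From within one open cell of the same depth the interval around a cut point looks like a
  ray: initial in the cell to the right of the cut point, final in the one to the left, empty
  elsewhere. The deeper contact conditions thereby reduce to a comparison with a single cut
  point.\<close>

lemma qset_in_cell:
  assumes z: "nz (Suc j) n" "nz (Suc j) n'" and ag: "agree j n n'" and r: "r \<ge> 1"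
    and S: "S \<subseteq> cell_op (Suc j) n'"
  shows "n' (Suc j) = n (Suc j) \<Longrightarrow> qset (Suc j) n r \<inter> S = S \<inter> {..pt (Suc j) n' (- int r)}"
    and "n' (Suc j) = prd (n (Suc j)) \<Longrightarrow> qset (Suc j) n r \<inter> S = S \<inter> {pt (Suc j) n' (int r)..}"
    and "n' (Suc j) \<noteq> n (Suc j) \<Longrightarrow> n' (Suc j) \<noteq> prd (n (Suc j)) \<Longrightarrow> qset (Suc j) n r \<inter> S = {}"
proof -
  let ?m = "n(Suc j := prd (n (Suc j)))"
  have n0: "n (Suc j) \<noteq> 0" using z by (simp add: nz_Suc)
  note qb = q_bounds[where n=n and j=j and r=r, OF n0 r]
  have a: "pt j n (idx (n (Suc j))) = lo (Suc j) n" "pt j n (idx (n (Suc j))) = hi (Suc j) ?m"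
    using hi_prd[of n j] n0 by (simp_all only: lo_Suc simp_thms)
  show "qset (Suc j) n r \<inter> S = S \<inter> {..pt (Suc j) n' (- int r)}" if eq: "n' (Suc j) = n (Suc j)"
  proof -
    have ag': "agree (Suc j) n n'" using ag eq by (simp add: agree_Suc)
    have "qlo (Suc j) n r < lo (Suc j) n'" using qb(2) a(1) lo_cong[OF ag'] by simp
    moreover have "qhi (Suc j) n r = pt (Suc j) n' (- int r)" unfolding qhi_def by (rule pt_cong[OF ag'])
    ultimately show ?thesis using S by (auto simp: qset_def cell_op_def)
  qed
  show "qset (Suc j) n r \<inter> S = S \<inter> {pt (Suc j) n' (int r)..}" if eq: "n' (Suc j) = prd (n (Suc j))"
  proof -
    have ag': "agree (Suc j) ?m n'" using ag eq by (auto simp: agree_def le_Suc_eq)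
    have "hi (Suc j) n' < qhi (Suc j) n r" using qb(3) a(2) hi_cong[OF ag'] by simp
    moreover have "qlo (Suc j) n r = pt (Suc j) n' (int r)" unfolding qlo_def by (rule pt_cong[OF ag'])
    ultimately show ?thesis using S by (auto simp: qset_def cell_op_def)
  qed
  show "qset (Suc j) n r \<inter> S = {}" if ne: "n' (Suc j) \<noteq> n (Suc j)" "n' (Suc j) \<noteq> prd (n (Suc j))"
  proof -
    have zm: "nz (Suc j) ?m" using z n0 prd_nonzero by (auto simp: nz_def)
    have "\<not> agree (Suc j) n' n" "\<not> agree (Suc j) n' ?m" using ne by (auto simp: agree_Suc)
    then have "cell_op (Suc j) n' \<inter> cell_cl (Suc j) n = {}" "cell_op (Suc j) n' \<inter> cell_cl (Suc j) ?m = {}"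
      using cells_disjoint[of "Suc j" n' n] cells_disjoint[of "Suc j" n' ?m] z zm by blast+
    moreover have "qset (Suc j) n r \<subseteq> cell_cl (Suc j) n \<union> cell_cl (Suc j) ?m"
      using pt_bounds[of "Suc j" ?m "int r"] pt_bounds[of "Suc j" n "- int r"] a
      by (auto simp: qset_def cell_cl_def qlo_def qhi_def simp del: lo.simps)
    ultimately show ?thesis using S by blast
  qed
qed

text \<open>A set inside an open child cannot merely touch the bounding cut point, which gives the
  strict conditions. The index shift for positive codes turns \<open>r \<le> idx p\<close> into
  \<open>p > r\<close>, while \<open>idx p + 1 \<le> - r\<close> becomes
  \<open>p < - r\<close>.\<close>

lemma qset_meets_deep:
  assumes z: "nz (Suc j) n" "nz (Suc (Suc j)) n'" and ag: "agree j n n'" and r: "r \<ge> 1"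
    and S: "S \<subseteq> cell_op (Suc (Suc j)) n'" "S \<noteq> {}"
  defines "p \<equiv> n' (Suc (Suc j))"
  shows "qset (Suc j) n r \<inter> S \<noteq> {} \<longleftrightarrow>
    n' (Suc j) = n (Suc j) \<and> p < - int r \<or> n' (Suc j) = prd (n (Suc j)) \<and> p > int r"
proof -
  have z': "nz (Suc j) n'" "n (Suc j) \<noteq> 0" using z by (simp_all add: nz_Suc)
  have S': "S \<subseteq> cell_op (Suc j) n'" using S cell_op_mono[of "Suc j" "Suc (Suc j)" n'] by auto
  note Q = qset_in_cell[OF z(1) z'(1) ag r S']
  have b: "pt (Suc j) n' (idx p) < s" "s < pt (Suc j) n' (idx p + 1)" if "s \<in> S" for s
    using S that by (auto simp: cell_op_def lo_Suc hi_Suc p_def simp del: lo.simps)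
  have p0: "p \<noteq> 0" using z by (simp add: nz_Suc p_def)
  have ne: "prd (n (Suc j)) \<noteq> n (Suc j)" by (simp add: prd_def)
  obtain s where s: "s \<in> S" using S by blast
  consider "n' (Suc j) = n (Suc j)" | "n' (Suc j) = prd (n (Suc j))"
    | "n' (Suc j) \<noteq> n (Suc j)" "n' (Suc j) \<noteq> prd (n (Suc j))" by blast
  then show ?thesis
  proof cases
    case 1
    have "S \<inter> {..pt (Suc j) n' (- int r)} \<noteq> {} \<longleftrightarrow> idx p + 1 \<le> - int r"
    proof (cases "idx p + 1 \<le> - int r")
      case True
      then have "pt (Suc j) n' (idx p + 1) \<le> pt (Suc j) n' (- int r)" by (simp only: pt_le_iff)
      then have "s \<in> S \<inter> {..pt (Suc j) n' (- int r)}" using b[OF s] s by auto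
      then show ?thesis using True by blast
    next
      case False
      then have "pt (Suc j) n' (- int r) \<le> pt (Suc j) n' (idx p)" by (simp add: pt_le_iff)
      then show ?thesis using b False by force
    qed
    also have "\<dots> \<longleftrightarrow> p < - int r" using r p0 by (auto simp: idx_def)
    finally show ?thesis using Q(1)[OF 1] 1 ne by simp
  next
    case 2
    have "S \<inter> {pt (Suc j) n' (int r)..} \<noteq> {} \<longleftrightarrow> int r \<le> idx p"
    proof (cases "int r \<le> idx p")
      case True
      then have "pt (Suc j) n' (int r) \<le> pt (Suc j) n' (idx p)" by (simp only: pt_le_iff)
      then have "s \<in> S \<inter> {pt (Suc j) n' (int r)..}" using b[OF s] s by auto
      then show ?thesis using True by blast
    next
      case False
      then have "pt (Suc j) n' (idx p + 1) \<le> pt (Suc j) n' (int r)" by (simp add: pt_le_iff)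
      then show ?thesis using b False by force
    qed
    also have "\<dots> \<longleftrightarrow> p > int r" using r p0 by (auto simp: idx_def)
    finally show ?thesis using Q(2)[OF 2] 2 ne by simp
  next
    case 3 then show ?thesis using Q(3)[OF 3] by simp
  qed
qed

lemma meets_q_q:
  assumes t: "is_tuple k n" "is_tuple l n'" and r: "r \<ge> 1" "r' \<ge> 1" and kl: "k \<le> l"
  shows "qset k n r \<inter> qset l n' r' \<noteq> {} \<longleftrightarrow> cond_qq k n r l n'"
proof -
  obtain j where k: "k = Suc j" using t by (cases k) (auto simp: is_tuple_iff)
  obtain i where l: "l = Suc i" using t by (cases l) (auto simp: is_tuple_iff)
  have z: "nz (Suc j) n" "nz (Suc i) n'" using t k l by (auto simp: is_tuple_iff)
  have ji: "j \<le> i" using kl k l by simp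
  have z': "nz (Suc j) n'" "nz j n" "nz j n'" "n (Suc j) \<noteq> 0" "n' (Suc j) \<noteq> 0" "n' (Suc i) \<noteq> 0"
    using z nz_mono[of "Suc i" n' "Suc j"] ji by (auto simp: nz_Suc)
  have sub: "qset (Suc j) n r \<subseteq> cell_op j n" "qset (Suc i) n' r' \<subseteq> cell_op i n'"
    using qset_subset z' r by auto
  show ?thesis
  proof (cases "agree j n n'")
    case False
    have "qset (Suc j) n r \<inter> qset (Suc i) n' r' = {}"
      using cells_disjoint'[OF z'(2,3) False sub(1)] sub(2) cell_op_cl[of i n'] cell_cl_mono[OF ji, of n'] by blast
    moreover have "\<not> cond_qq k n r l n'" using False unfolding cond_qq_def k agree_iff by simp
    ultimately show ?thesis by (simp add: k l)
  next
    case ag: True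
    note q = q_bounds[where n=n and j=j and r=r, OF z'(4) r(1)] and q' = q_bounds[where n=n' and j=i and r=r', OF z'(6) r(2)]
    have ne: "prd (n (Suc j)) \<noteq> n (Suc j)" by (simp add: prd_def)
    have meets: "qset (Suc j) n r \<inter> qset (Suc i) n' r' \<noteq> {} \<longleftrightarrow>
        qlo (Suc j) n r \<le> qhi (Suc i) n' r' \<and> qlo (Suc i) n' r' \<le> qhi (Suc j) n r"
      unfolding qset_def using q q' by (intro interval_meets) linarith+
    consider "i = j" | "i = Suc j" | "Suc j < i" using ji by linarith
    then show ?thesis
    proof cases
      case 1
      let ?a = "idx (n (Suc j))" and ?b = "idx (n' (Suc j))" and ?P = "pt j n'"
      have qn: "(?P (?a - 1) + ?P ?a) / 2 < qlo (Suc j) n r" "qlo (Suc j) n r < ?P ?a"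
        "?P ?a < qhi (Suc j) n r" "qhi (Suc j) n r < (?P ?a + ?P (?a + 1)) / 2"
        using q by (simp_all only: pt_cong[OF ag])
      have qn': "(?P (?b - 1) + ?P ?b) / 2 < qlo (Suc j) n' r'" "qlo (Suc j) n' r' < ?P ?b"
        "?P ?b < qhi (Suc j) n' r'" "qhi (Suc j) n' r' < (?P ?b + ?P (?b + 1)) / 2"
        using q' by (simp_all only: 1)
      have "qset (Suc j) n r \<inter> qset (Suc j) n' r' \<noteq> {} \<longleftrightarrow> ?a = ?b"
      proof (cases ?a ?b rule: linorder_cases)
        case less
        then have "?P ?a \<le> ?P (?b - 1)" "?P (?a + 1) \<le> ?P ?b" by (simp_all add: pt_le_iff)
        then show ?thesis using less meets 1 qn qn' by simp
      next
        case equal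
        then show ?thesis using meets 1 qn qn' by auto
      next
        case greater
        then have "?P ?b \<le> ?P (?a - 1)" "?P (?b + 1) \<le> ?P ?a" by (simp_all add: pt_le_iff)
        then show ?thesis using greater meets 1 qn qn' by simp
      qed
      then show ?thesis using 1 z' ag unfolding k l cond_qq_def agree_iff by (auto simp: idx_eq_iff)
    next
      case 2
      \<comment> \<open>The deeper interval surrounds the cut point \<open>idx p\<close>, which is
        \<open>p\<close> for negative and \<open>p - 1\<close> for positive codes; this explains the
        asymmetry between \<open>p \<le> - int r\<close> and \<open>p > int r\<close>.\<close>
      define p where "p = n' (Suc (Suc j))"
      let ?P = "pt (Suc j) n'" and ?S = "qset (Suc i) n' r'"
      have p0: "p \<noteq> 0" using z' 2 by (simp add: p_def)
      have S: "?S \<subseteq> cell_op (Suc j) n'" using sub 2 by simp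
      note Q = qset_in_cell[OF z(1) z'(1) ag r(1) S]
      have qn': "?P (idx p - 1) < qlo (Suc i) n' r'" "qlo (Suc i) n' r' < ?P (idx p)"
        "?P (idx p) < qhi (Suc i) n' r'" "qhi (Suc i) n' r' < ?P (idx p + 1)"
        using q' 2 pt_less_iff[of "Suc j" n' "idx p - 1" "idx p"] pt_less_iff[of "Suc j" n' "idx p" "idx p + 1"]
        by (simp_all add: p_def)
      consider "n' (Suc j) = n (Suc j)" | "n' (Suc j) = prd (n (Suc j))"
        | "n' (Suc j) \<noteq> n (Suc j)" "n' (Suc j) \<noteq> prd (n (Suc j))" by blast
      then have "qset (Suc j) n r \<inter> ?S \<noteq> {} \<longleftrightarrow>
        n' (Suc j) = n (Suc j) \<and> p \<le> - int r \<or> n' (Suc j) = prd (n (Suc j)) \<and> p > int r"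
      proof cases
        case c: 1
        have "?S \<inter> {..?P (- int r)} \<noteq> {} \<longleftrightarrow> qlo (Suc i) n' r' \<le> ?P (- int r)"
          using qn' by (auto simp: qset_def)
        also have "\<dots> \<longleftrightarrow> idx p \<le> - int r"
        proof (cases "idx p \<le> - int r")
          case True
          then have "?P (idx p) \<le> ?P (- int r)" by (simp add: pt_le_iff)
          then show ?thesis using True qn' by simp
        next
          case False
          then have "?P (- int r) \<le> ?P (idx p - 1)" by (simp add: pt_le_iff)
          then show ?thesis using False qn' by simp
        qed
        also have "\<dots> \<longleftrightarrow> p \<le> - int r" using r p0 by (auto simp: idx_def)
        finally show ?thesis using Q(1)[OF c] c ne by simp
      next
        case c: 2
        have "?S \<inter> {?P (int r)..} \<noteq> {} \<longleftrightarrow> ?P (int r) \<le> qhi (Suc i) n' r'"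
          using qn' by (auto simp: qset_def)
        also have "\<dots> \<longleftrightarrow> int r \<le> idx p"
        proof (cases "int r \<le> idx p")
          case True
          then have "?P (int r) \<le> ?P (idx p)" by (simp add: pt_le_iff)
          then show ?thesis using True qn' by simp
        next
          case False
          then have "?P (idx p + 1) \<le> ?P (int r)" by (simp add: pt_le_iff)
          then show ?thesis using False qn' by simp
        qed
        also have "\<dots> \<longleftrightarrow> p > int r" using r p0 by (auto simp: idx_def)
        finally show ?thesis using Q(2)[OF c] c ne by simp
      next
        case c: 3 then show ?thesis using Q(3)[OF c] by simp
      qed
      then show ?thesis using 2 ag unfolding cond_qq_def k l agree_iff p_def by simp
    next
      case 3
      have "qset (Suc i) n' r' \<subseteq> cell_op (Suc (Suc j)) n'"
        using sub(2) cell_op_mono[of "Suc (Suc j)" i n'] 3 by auto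
      moreover have "qset (Suc i) n' r' \<noteq> {}" using q' by (simp add: qset_def)
      moreover have "nz (Suc (Suc j)) n'" using z(2) by (rule nz_mono) (use 3 in simp)
      ultimately have "qset (Suc j) n r \<inter> qset (Suc i) n' r' \<noteq> {} \<longleftrightarrow>
          n' (Suc j) = n (Suc j) \<and> n' (Suc (Suc j)) < - int r \<or>
          n' (Suc j) = prd (n (Suc j)) \<and> n' (Suc (Suc j)) > int r"
        using qset_meets_deep[OF z(1) _ ag r(1)] by blast
      then show ?thesis using 3 ag unfolding cond_qq_def k l agree_iff by simp
    qed
  qed
qed

text \<open>For \<open>l < k\<close> the interval lies in the open cell of depth
  \<open>k - 1\<close>, hence entirely inside or outside the coarser cell. In the other cases it is
  compared with the cell as a ray.\<close>

lemma meets_q_cell: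
  assumes t: "is_tuple k n" "is_tuple l n'" and r: "r \<ge> 1"
  shows "qset k n r \<inter> cell_cl l n' \<noteq> {} \<longleftrightarrow> cond_qb k n r l n'"
proof -
  obtain j where k: "k = Suc j" using t by (cases k) (auto simp: is_tuple_iff)
  obtain i where l: "l = Suc i" using t by (cases l) (auto simp: is_tuple_iff)
  have z: "nz (Suc j) n" "nz (Suc i) n'" using t k l by (auto simp: is_tuple_iff)
  have n0: "n (Suc j) \<noteq> 0" using z by (simp add: nz_Suc)
  note q = q_bounds[where n=n and j=j and r=r, OF n0 r]
  have sub: "qset (Suc j) n r \<subseteq> cell_op j n" using qset_subset n0 r by auto
  have ne: "qset (Suc j) n r \<noteq> {}" using q by (simp add: qset_def)
  show ?thesis
  proof (cases "l < k")
    case True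
    then have lj: "l \<le> j" using k by simp
    have "qset (Suc j) n r \<inter> cell_cl l n' \<noteq> {} \<longleftrightarrow> agree l n n'"
    proof (cases "agree l n n'")
      case ag: True
      have "qset (Suc j) n r \<subseteq> cell_cl l n'"
        using sub cell_op_mono[OF lj, of n] cell_op_cl[of l n] cell_cong(1)[OF ag] by blast
      then show ?thesis using ne ag by blast
    next
      case False
      have "nz l n" "nz l n'" using z nz_mono[of "Suc j" n l] lj l by auto
      then have "qset (Suc j) n r \<inter> cell_cl l n' = {}"
        using cells_disjoint'[OF _ _ False] sub cell_op_mono[OF lj, of n] by blast
      then show ?thesis using False by blast
    qed
    then show ?thesis using True by (simp add: cond_qb_def agree_def k)
  next
    case False
    then have ji: "j \<le> i" using k l by simp
    have z': "nz (Suc j) n'" "nz j n" "nz j n'" "n' (Suc j) \<noteq> 0" "n' (Suc i) \<noteq> 0"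
      using z nz_mono[of "Suc i" n' "Suc j"] ji by (auto simp: nz_Suc)
    show ?thesis
    proof (cases "agree j n n'")
      case na: False
      have "qset (Suc j) n r \<inter> cell_cl (Suc i) n' = {}"
        using ji by (intro cells_disjoint'[OF z'(2,3) na sub] cell_cl_mono) auto
      moreover have "\<not> cond_qb k n r l n'" using na False unfolding cond_qb_def k agree_iff by simp
      ultimately show ?thesis by (simp add: k l)
    next
      case ag: True
      have nep: "prd (n (Suc j)) \<noteq> n (Suc j)" by (simp add: prd_def)
      have meets: "qset (Suc j) n r \<inter> cell_cl (Suc i) n' \<noteq> {} \<longleftrightarrow>
          qlo (Suc j) n r \<le> hi (Suc i) n' \<and> lo (Suc i) n' \<le> qhi (Suc j) n r"
        unfolding qset_def cell_cl_def using q lo_less_hi[of "Suc i" n']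
        by (intro interval_meets) linarith+
      consider "i = j" | "i = Suc j" | "Suc j < i" using ji by linarith
      then show ?thesis
      proof cases
        case 1
        let ?a = "idx (n (Suc j))" and ?b = "idx (n' (Suc j))" and ?P = "pt j n'"
        have st: "?P (?a - 1) < ?P ?a" "?P ?a < ?P (?a + 1)" by (simp_all add: pt_less_iff)
        have qn: "(?P (?a - 1) + ?P ?a) / 2 < qlo (Suc j) n r" "qlo (Suc j) n r < ?P ?a"
          "?P ?a < qhi (Suc j) n r" "qhi (Suc j) n r < (?P ?a + ?P (?a + 1)) / 2"
          using q by (simp_all only: pt_cong[OF ag])
        have b: "lo (Suc j) n' = ?P ?b" "hi (Suc j) n' = ?P (?b + 1)" by (simp_all only: lo_Suc hi_Suc)
        have "qlo (Suc j) n r \<le> ?P (?b + 1) \<longleftrightarrow> ?a \<le> ?b + 1"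
        proof (cases "?a \<le> ?b + 1")
          case True
          then have "?P ?a \<le> ?P (?b + 1)" by (simp add: pt_le_iff)
          then show ?thesis using True qn by simp
        next
          case False
          then have "?P (?b + 1) \<le> ?P (?a - 1)" by (simp add: pt_le_iff)
          then show ?thesis using False qn st by simp
        qed
        moreover have "?P ?b \<le> qhi (Suc j) n r \<longleftrightarrow> ?b \<le> ?a"
        proof (cases "?b \<le> ?a")
          case True
          then have "?P ?b \<le> ?P ?a" by (simp add: pt_le_iff)
          then show ?thesis using True qn by simp
        next
          case False
          then have "?P (?a + 1) \<le> ?P ?b" by (simp add: pt_le_iff)
          then show ?thesis using False qn st by simp
        qed
        ultimately have "qset (Suc j) n r \<inter> cell_cl (Suc j) n' \<noteq> {} \<longleftrightarrow> ?b = ?a - 1 \<or> ?b = ?a"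
          using meets b by (auto simp: 1)
        also have "\<dots> \<longleftrightarrow> n' (Suc j) \<in> {prd (n (Suc j)), n (Suc j)}"
          using z'(4) n0 prd_nonzero[OF n0] by (simp add: idx_eq_iff flip: idx_prd)
        finally show ?thesis using ag 1 unfolding cond_qb_def k l agree_iff by simp
      next
        case 2
        \<comment> \<open>A closed child may also touch the bounding cut point from outside, so both
          inequalities are weak here.\<close>
        define p where "p = n' (Suc (Suc j))"
        let ?P = "pt (Suc j) n'" and ?S = "cell_cl (Suc i) n'"
        have p0: "p \<noteq> 0" using z' 2 by (simp add: p_def)
        have S: "?S \<subseteq> cell_op (Suc j) n'" using 2 by (intro cell_cl_subset_op) simp
        note Q = qset_in_cell[OF z(1) z'(1) ag r(1) S]
        have b: "?S = {?P (idx p)..?P (idx p + 1)}"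
          unfolding cell_cl_def 2 by (simp only: lo_Suc hi_Suc p_def)
        have st: "?P (idx p) \<le> ?P (idx p + 1)" by (simp add: pt_le_iff)
        consider "n' (Suc j) = n (Suc j)" | "n' (Suc j) = prd (n (Suc j))"
          | "n' (Suc j) \<noteq> n (Suc j)" "n' (Suc j) \<noteq> prd (n (Suc j))" by blast
        then have "qset (Suc j) n r \<inter> ?S \<noteq> {} \<longleftrightarrow>
          p \<ge> int r \<and> n' (Suc j) = prd (n (Suc j)) \<or> p \<le> - int r \<and> n' (Suc j) = n (Suc j)"
        proof cases
          case c: 1
          have "?S \<inter> {..?P (- int r)} \<noteq> {} \<longleftrightarrow> ?P (idx p) \<le> ?P (- int r)"
            using st by (auto simp: b)
          also have "\<dots> \<longleftrightarrow> p \<le> - int r" using r p0 by (auto simp: idx_def pt_le_iff)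
          finally show ?thesis using Q(1)[OF c] c nep by simp
        next
          case c: 2
          have "?S \<inter> {?P (int r)..} \<noteq> {} \<longleftrightarrow> ?P (int r) \<le> ?P (idx p + 1)"
            using st by (auto simp: b)
          also have "\<dots> \<longleftrightarrow> p \<ge> int r" using r p0 by (auto simp: idx_def pt_le_iff)
          finally show ?thesis using Q(2)[OF c] c nep by simp
        next
          case c: 3 then show ?thesis using Q(3)[OF c] by simp
        qed
        then show ?thesis using 2 ag unfolding cond_qb_def k l agree_iff p_def by simp
      next
        case 3
        have "cell_cl (Suc i) n' \<subseteq> cell_op (Suc (Suc j)) n'" using 3 by (intro cell_cl_subset_op) simp
        moreover have "nz (Suc (Suc j)) n'" using z(2) by (rule nz_mono) (use 3 in simp)
        ultimately have "qset (Suc j) n r \<inter> cell_cl (Suc i) n' \<noteq> {} \<longleftrightarrow>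
            n' (Suc j) = n (Suc j) \<and> n' (Suc (Suc j)) < - int r \<or>
            n' (Suc j) = prd (n (Suc j)) \<and> n' (Suc (Suc j)) > int r"
          using qset_meets_deep[OF z(1) _ ag r(1) _ cell_cl_nonempty] by blast
        then show ?thesis using 3 ag unfolding cond_qb_def k l agree_iff by auto
      qed
    qed
  qed
qed

text \<open>A point that is never an end point of a cell lies in an open cell of every depth, and
  the widths shrink geometrically. An end point is interior to no deep cell and needs an interval
  around the cut point with large \<open>r\<close>; this is the purpose of the elements of
  \<open>B1\<close>.\<close>

lemma small_neighbourhood:
  assumes x: "0 < x" "x < 1" and \<epsilon>: "\<epsilon> > 0"
  shows "(\<exists>k n. is_tuple k n \<and> x \<in> cell_op k n \<and> hi k n - lo k n < \<epsilon>) \<or>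
    (\<exists>k n r. is_tuple k n \<and> r \<ge> 1 \<and> qlo k n r < x \<and> x < qhi k n r \<and> qhi k n r - qlo k n r < \<epsilon>)"
proof (cases "\<exists>k n. is_tuple k n \<and> x = lo k n")
  case True
  then obtain k n where kn: "is_tuple k n" "x = lo k n" by blast
  then obtain j where k: "k = Suc j" by (cases k) (auto simp: is_tuple_iff)
  have n0: "n (Suc j) \<noteq> 0" using kn k by (simp add: is_tuple_iff nz_Suc)
  let ?m = "n(Suc j := prd (n (Suc j)))"
  \<comment> \<open>The total width of the two cells that meet at \<open>x\<close>: taking less than
    the fraction \<open>\<epsilon> / ?W\<close> of each leaves a total length below
    \<epsilon>.\<close>
  let ?W = "wid (Suc j) n + wid (Suc j) ?m"
  have W: "?W > 0" by (rule add_pos_pos[OF wid_pos wid_pos])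
  obtain r where r: "r \<ge> 1" "1 - tick (int r) < \<epsilon> / ?W" "tick (- int r) < \<epsilon> / ?W"
    using tick_limits[of "\<epsilon> / ?W"] W \<epsilon> by auto
  have xP: "x = pt j n (idx (n (Suc j)))" using kn k lo_Suc by simp
  have "qhi k n r = x + wid (Suc j) n * tick (- int r)" by (simp add: qhi_def pt_def kn k)
  moreover have "hi (Suc j) ?m = x" using hi_prd[of n j] n0 kn k by simp
  then have "qlo k n r = x - wid (Suc j) ?m * (1 - tick (int r))"
    unfolding qlo_def pt_def k hi_def by (simp add: algebra_simps del: wid.simps lo.simps)
  moreover have "wid (Suc j) n * tick (- int r) < wid (Suc j) n * (\<epsilon> / ?W)"
    "wid (Suc j) ?m * (1 - tick (int r)) < wid (Suc j) ?m * (\<epsilon> / ?W)"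
    using r wid_pos by (intro mult_strict_left_mono; blast)+
  moreover have "wid (Suc j) n * (\<epsilon> / ?W) + wid (Suc j) ?m * (\<epsilon> / ?W) = \<epsilon>"
  proof -
    have "wid (Suc j) n * (\<epsilon> / ?W) + wid (Suc j) ?m * (\<epsilon> / ?W) = ?W * (\<epsilon> / ?W)"
      by (simp only: distrib_right)
    also have "\<dots> = \<epsilon>" using W by (metis less_numeral_extra(3) nonzero_mult_div_cancel_left times_divide_eq_right)
    finally show ?thesis .
  qed
  ultimately have "qhi k n r - qlo k n r < \<epsilon>" by linarith
  moreover have "qlo k n r < x" "x < qhi k n r"
    using q_bounds(2,3)[where n=n and j=j and r=r, OF n0 r(1)] by (simp_all only: k xP)
  ultimately show ?thesis using kn(1) r(1) by blast
next
  case False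
  have "\<exists>n. nz k n \<and> x \<in> cell_op k n" for k
  proof (induction k)
    case 0 then show ?case using x by (auto simp: nz_def cell_op_def hi_def)
  next
    case (Suc k)
    then obtain n where n: "nz k n" "x \<in> cell_op k n" by blast
    define s where "s = (x - lo k n) / wid k n"
    have xs: "x = lo k n + wid k n * s" using wid_pos[of k n] by (simp add: s_def)
    have "0 < s" "s < 1" using n wid_pos[of k n] by (auto simp: s_def cell_op_def hi_def)
    then obtain m where m: "tick m \<le> s" "s < tick (m + 1)" using tick_locate by blast
    obtain p where p: "p \<noteq> 0" "idx p = m" using idx_surj by blast
    let ?n = "n(Suc k := p)"
    have ag: "agree k ?n n" by (rule agree_upd)
    have nz: "nz (Suc k) ?n" using n p by (auto simp: nz_def)
    have lo: "lo (Suc k) ?n = lo k n + wid k n * tick m" and hi: "hi (Suc k) ?n = lo k n + wid k n * tick (m + 1)"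
      unfolding lo_Suc hi_Suc pt_def using p by (simp_all add: lo_cong[OF ag] wid_cong[OF ag])
    have "lo (Suc k) ?n \<le> x" "x < hi (Suc k) ?n"
      unfolding lo hi using m wid_pos[of k n] by (simp_all add: xs)
    moreover have "lo (Suc k) ?n \<noteq> x" using False nz by (auto simp: is_tuple_iff simp del: lo.simps)
    ultimately show ?case using nz by (auto simp: cell_op_def simp del: lo.simps intro!: exI[of _ ?n])
  qed
  moreover obtain k where k: "(1/2::real) ^ k < \<epsilon>"
    using real_arch_pow_inv[of \<epsilon> "1/2"] \<epsilon> by auto
  ultimately obtain n where n: "nz (Suc k) n" "x \<in> cell_op (Suc k) n" by blast
  have "(1/2::real) ^ Suc k \<le> (1/2) ^ k" by simp
  then have "hi (Suc k) n - lo (Suc k) n < \<epsilon>"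
    using wid_le[of "Suc k" n] wid_pos[of "Suc k" n] k by (simp add: hi_def del: wid.simps lo.simps)
  then show ?thesis using n by (auto simp: is_tuple_iff simp del: lo.simps)
qed

text \<open>The child with code \<open>- r - 1\<close> ends exactly at cut point \<open>- r\<close>,
  the right end of the interval.\<close>

lemma cell_below_q:
  assumes "is_tuple k n" "r \<ge> 1"
  shows "is_tuple (Suc k) (n(Suc k := - int r - 1)) \<and> cell_op (Suc k) (n(Suc k := - int r - 1)) \<subseteq> {qlo k n r..qhi k n r}"
proof -
  obtain j where k: "k = Suc j" using assms by (cases k) (auto simp: is_tuple_iff)
  have n0: "n (Suc j) \<noteq> 0" using assms k by (simp add: is_tuple_iff nz_Suc)
  let ?n = "n(Suc k := - int r - 1)"
  have ag: "agree k ?n n" by (rule agree_upd)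
  have "is_tuple (Suc k) ?n" using assms by (auto simp: is_tuple_iff nz_def)
  moreover have "hi (Suc k) ?n = qhi k n r"
    unfolding hi_Suc qhi_def by (simp add: pt_cong[OF ag] idx_def)
  moreover have "qlo k n r \<le> lo (Suc k) ?n"
    using q_bounds(2)[where n=n and j=j and r=r, OF n0 assms(2)] nested_Suc(1)[of k ?n] lo_cong[OF ag] lo_Suc[of j n] k by simp
  ultimately show ?thesis by (auto simp: cell_op_def simp del: lo.simps)
qed

section \<open>The completed sum of power set algebras\<close>

text \<open>All operations are computed from the order of the structure at hand, so a subset closed
  under the ambient operations must be shown to compute the same ones. The lemma serves
  \<open>A\<close> in \<open>L\<close>, restricted carriers, and a mere change of the
  record.\<close>

lemma subalgebra:
  fixes A :: "('a, 'm) gorder_scheme" and L :: "('a, 'n) gorder_scheme"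
  assumes L: "boolean_alg L" and A: "partial_order A" and sub: "carrier A \<subseteq> carrier L"
    and le: "\<And>x y. x \<in> carrier A \<Longrightarrow> y \<in> carrier A \<Longrightarrow> x \<sqsubseteq>\<^bsub>A\<^esub> y \<longleftrightarrow> x \<sqsubseteq>\<^bsub>L\<^esub> y"
    and bt: "\<bottom>\<^bsub>L\<^esub> \<in> carrier A" "\<top>\<^bsub>L\<^esub> \<in> carrier A"
    and cm: "\<And>x. x \<in> carrier A \<Longrightarrow> cmpl L x \<in> carrier A"
    and mj: "\<And>x y. x \<in> carrier A \<Longrightarrow> y \<in> carrier A \<Longrightarrow> x \<sqinter>\<^bsub>L\<^esub> y \<in> carrier A"
      "\<And>x y. x \<in> carrier A \<Longrightarrow> y \<in> carrier A \<Longrightarrow> x \<squnion>\<^bsub>L\<^esub> y \<in> carrier A"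
  shows "boolean_alg A" "\<bottom>\<^bsub>A\<^esub> = \<bottom>\<^bsub>L\<^esub>" "\<top>\<^bsub>A\<^esub> = \<top>\<^bsub>L\<^esub>"
    "\<And>x. x \<in> carrier A \<Longrightarrow> cmpl A x = cmpl L x"
    "\<And>x y. x \<in> carrier A \<Longrightarrow> y \<in> carrier A \<Longrightarrow> x \<sqinter>\<^bsub>A\<^esub> y = x \<sqinter>\<^bsub>L\<^esub> y"
    "\<And>x y. x \<in> carrier A \<Longrightarrow> y \<in> carrier A \<Longrightarrow> x \<squnion>\<^bsub>A\<^esub> y = x \<squnion>\<^bsub>L\<^esub> y"
proof -
  interpret L: boolean_alg L by (rule L)
  interpret A: partial_order A by (rule A)
  have c: "x \<in> carrier L" if "x \<in> carrier A" for x using sub that by blast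
  have m: "greatest A (x \<sqinter>\<^bsub>L\<^esub> y) (Lower A {x, y})" if "x \<in> carrier A" "y \<in> carrier A" for x y
    using that c mj by (intro greatest_LowerI) (auto simp: le L.meet_left L.meet_right Lower_def L.meet_le)
  have j: "least A (x \<squnion>\<^bsub>L\<^esub> y) (Upper A {x, y})" if xy: "x \<in> carrier A" "y \<in> carrier A" for x y
  proof (rule least_UpperI)
    fix z assume "z \<in> {x, y}"
    then show "z \<sqsubseteq>\<^bsub>A\<^esub> x \<squnion>\<^bsub>L\<^esub> y" using xy c mj by (auto simp: le L.join_left L.join_right)
  next
    fix z assume "z \<in> Upper A {x, y}"
    then have "z \<in> carrier A" "x \<sqsubseteq>\<^bsub>L\<^esub> z" "y \<sqsubseteq>\<^bsub>L\<^esub> z" using xy le by (auto simp: Upper_def)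
    then show "x \<squnion>\<^bsub>L\<^esub> y \<sqsubseteq>\<^bsub>A\<^esub> z" using xy c mj by (simp add: le L.join_le)
  qed (use xy mj in auto)
  have lb: "least A \<bottom>\<^bsub>L\<^esub> (carrier A)" and gt: "greatest A \<top>\<^bsub>L\<^esub> (carrier A)"
    unfolding least_def greatest_def using bt le L.bottom_lower[OF c] L.top_higher[OF c] by simp_all
  show me: "\<And>x y. x \<in> carrier A \<Longrightarrow> y \<in> carrier A \<Longrightarrow> x \<sqinter>\<^bsub>A\<^esub> y = x \<sqinter>\<^bsub>L\<^esub> y"
    unfolding meet_def[of A] inf_def by (metis m A.greatest_unique someI)
  show je: "\<And>x y. x \<in> carrier A \<Longrightarrow> y \<in> carrier A \<Longrightarrow> x \<squnion>\<^bsub>A\<^esub> y = x \<squnion>\<^bsub>L\<^esub> y"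
    unfolding join_def[of A] sup_def by (metis j A.least_unique someI)
  show be: "\<bottom>\<^bsub>A\<^esub> = \<bottom>\<^bsub>L\<^esub>" unfolding bottom_def[of A] by (metis lb A.least_unique someI)
  show te: "\<top>\<^bsub>A\<^esub> = \<top>\<^bsub>L\<^esub>" unfolding top_def[of A] by (metis gt A.greatest_unique someI)
  show A': "boolean_alg A"
  proof (unfold_locales, goal_cases)
    case 1 then show ?case using j by blast
  next
    case 2 then show ?case using m by blast
  next
    case 3 then show ?case using lb by blast
  next
    case 4 then show ?case using gt by blast
  next
    case (5 x y z) then show ?case using L.distrib[of x y z] c mj by (simp add: me je)
  next
    case (6 x) then show ?case
      using cm[OF 6] L.cmpl_props[OF c[OF 6]] by (intro bexI[of _ "cmpl L x"]) (simp_all add: me je be te)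
  qed
  fix x assume x: "x \<in> carrier A"
  show "cmpl A x = cmpl L x"
    using boolean_alg.cmpl_unique[OF A' x _ cm[OF x]] boolean_alg.cmpl_props[OF A' x]
      L.cmpl_props[OF c[OF x]] cm[OF x] by (simp add: me je be te x)
qed

lemma restrict_carrier_partial_order:
  assumes "partial_order L" "S \<subseteq> carrier L"
  shows "partial_order (L\<lparr>carrier := S\<rparr>)"
proof -
  interpret partial_order L by (rule assms)
  show ?thesis
    by (unfold_locales; use assms(2) in \<open>simp add: eq_is_equal subset_iff\<close>) (meson le_antisym le_trans)+
qed

lemma powerset_Z0_simps [simp]:
  "carrier powerset_Z0 = Pow Z0" "eq powerset_Z0 = (=)" "le powerset_Z0 = (\<subseteq>)"
  by (simp_all add: powerset_Z0_def)

lemma powerset_Z0_partial_order: "partial_order powerset_Z0"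
  by unfold_locales auto

lemma powerset_Z0_ops:
  assumes "S \<subseteq> Z0" "T \<subseteq> Z0"
  shows "S \<sqinter>\<^bsub>powerset_Z0\<^esub> T = S \<inter> T" "S \<squnion>\<^bsub>powerset_Z0\<^esub> T = S \<union> T"
proof -
  interpret partial_order powerset_Z0 by (rule powerset_Z0_partial_order)
  show "S \<sqinter>\<^bsub>powerset_Z0\<^esub> T = S \<inter> T"
    unfolding meet_def by (rule inf_eqI) (use assms in auto)
  show "S \<squnion>\<^bsub>powerset_Z0\<^esub> T = S \<union> T"
    unfolding join_def by (rule sup_eqI) (use assms in auto)
qed

lemma powerset_Z0_bot_top: "\<bottom>\<^bsub>powerset_Z0\<^esub> = {}" "\<top>\<^bsub>powerset_Z0\<^esub> = Z0"
proof -
  interpret partial_order powerset_Z0 by (rule powerset_Z0_partial_order)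
  have "least powerset_Z0 {} (carrier powerset_Z0)" "greatest powerset_Z0 Z0 (carrier powerset_Z0)"
    by (auto simp: least_def greatest_def)
  then show "\<bottom>\<^bsub>powerset_Z0\<^esub> = {}" "\<top>\<^bsub>powerset_Z0\<^esub> = Z0"
    unfolding bottom_def top_def by (metis least_unique someI, metis greatest_unique someI)
qed

lemma powerset_Z0_cmpl:
  assumes "boolean_alg powerset_Z0" "S \<subseteq> Z0"
  shows "cmpl powerset_Z0 S = Z0 - S"
proof -
  interpret boolean_alg powerset_Z0 by (rule assms)
  note p = cmpl_props[of S]
  show ?thesis
  proof (rule cmpl_unique)
    show "S \<sqinter>\<^bsub>powerset_Z0\<^esub> (Z0 - S) = \<bottom>\<^bsub>powerset_Z0\<^esub>" "S \<squnion>\<^bsub>powerset_Z0\<^esub> (Z0 - S) = \<top>\<^bsub>powerset_Z0\<^esub>"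
      using powerset_Z0_ops[of S "Z0 - S"] assms(2) by (auto simp: powerset_Z0_bot_top)
  qed (use p assms(2) in simp_all)
qed

locale completed_sum =
  fixes L :: "'a gorder" (structure) and A :: "'a gorder" and \<phi> :: "nat \<Rightarrow> int set \<Rightarrow> 'a"
  assumes sum: "boolean_sum TYPE('a) {1..} (\<lambda>_. powerset_Z0) A \<phi>"
    and mono: "\<And>i. i \<ge> 1 \<Longrightarrow> inj_on (\<phi> i) (carrier powerset_Z0)"
    and completion: "macneille_completion A L"
begin

sublocale A: boolean_alg A using completion by (simp add: macneille_completion_def)
sublocale L: boolean_alg L using completion by (simp add: macneille_completion_def)
sublocale LC: complete_lattice L using completion by (simp add: macneille_completion_def)

lemma powerset_boolean: "boolean_alg powerset_Z0"
  using sum by (auto simp: boolean_sum_def)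

lemma A_sub: "carrier A \<subseteq> carrier L"
  and A_closed: "\<bottom> \<in> carrier A" "\<top> \<in> carrier A" "\<And>x. x \<in> carrier A \<Longrightarrow> cmpl L x \<in> carrier A"
    "\<And>x y. x \<in> carrier A \<Longrightarrow> y \<in> carrier A \<Longrightarrow> x \<sqinter> y \<in> carrier A"
    "\<And>x y. x \<in> carrier A \<Longrightarrow> y \<in> carrier A \<Longrightarrow> x \<squnion> y \<in> carrier A"
  and A_le: "\<And>x y. x \<in> carrier A \<Longrightarrow> y \<in> carrier A \<Longrightarrow> x \<sqsubseteq>\<^bsub>A\<^esub> y \<longleftrightarrow> x \<sqsubseteq> y"
  and A_dense: "\<And>x. x \<in> carrier L \<Longrightarrow> x = \<Squnion> {a \<in> carrier A. a \<sqsubseteq> x}"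
  using completion unfolding macneille_completion_def by blast+

lemmas A_ops = subalgebra(2-)[OF L.boolean_alg_axioms A.partial_order_axioms A_sub A_le A_closed]

lemma phi_hom: "i \<ge> 1 \<Longrightarrow> \<phi> i \<in> bool_hom powerset_Z0 A"
  using sum by (simp add: boolean_sum_def)

lemma phi_A: "i \<ge> 1 \<Longrightarrow> S \<subseteq> Z0 \<Longrightarrow> \<phi> i S \<in> carrier A"
  using phi_hom[of i] by (auto simp: bool_hom_def)

lemma phi_closed [simp]: "i \<ge> 1 \<Longrightarrow> S \<subseteq> Z0 \<Longrightarrow> \<phi> i S \<in> carrier L"
  using phi_A A_sub by blast

lemma phi_ops:
  assumes i: "i \<ge> 1"
  shows "\<phi> i {} = \<bottom>" "\<phi> i Z0 = \<top>"
    "S \<subseteq> Z0 \<Longrightarrow> \<phi> i (Z0 - S) = cmpl L (\<phi> i S)"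
    "S \<subseteq> Z0 \<Longrightarrow> T \<subseteq> Z0 \<Longrightarrow> \<phi> i (S \<inter> T) = \<phi> i S \<sqinter> \<phi> i T"
    "S \<subseteq> Z0 \<Longrightarrow> T \<subseteq> Z0 \<Longrightarrow> \<phi> i (S \<union> T) = \<phi> i S \<squnion> \<phi> i T"
  using phi_hom[OF i] phi_A[OF i]
  by (simp_all add: bool_hom_def powerset_Z0_bot_top A_ops flip: powerset_Z0_ops powerset_Z0_cmpl[OF powerset_boolean])

lemma bot_neq_top: "\<bottom> \<noteq> \<top>"
proof
  assume "\<bottom> = \<top>"
  then have "\<phi> 1 {} = \<phi> 1 Z0" using phi_ops(1,2)[of 1] by simp
  then have "{} = Z0" using mono[of 1] by (auto dest!: inj_onD)
  moreover have "(1::int) \<in> Z0" by (simp add: Z0_def)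
  ultimately show False by blast
qed

text \<open>The universal property can be applied only to algebras on the type \<open>'a\<close>.
  Restricting the carrier of \<open>A\<close> supplies such algebras: a generated part for
  \<open>generated\<close>, a two-element one for \<open>point_hom\<close>.\<close>

lemma restricted:
  assumes S: "S \<subseteq> carrier A"
    and bt: "\<bottom> \<in> S" "\<top> \<in> S" and cm: "\<And>x. x \<in> S \<Longrightarrow> cmpl L x \<in> S"
    and mj: "\<And>x y. x \<in> S \<Longrightarrow> y \<in> S \<Longrightarrow> x \<sqinter> y \<in> S" "\<And>x y. x \<in> S \<Longrightarrow> y \<in> S \<Longrightarrow> x \<squnion> y \<in> S"
  defines "B \<equiv> A\<lparr>carrier := S\<rparr>"
  shows "boolean_alg B" "\<bottom>\<^bsub>B\<^esub> = \<bottom>" "\<top>\<^bsub>B\<^esub> = \<top>"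
    "\<And>x. x \<in> S \<Longrightarrow> cmpl B x = cmpl L x"
    "\<And>x y. x \<in> S \<Longrightarrow> y \<in> S \<Longrightarrow> x \<sqinter>\<^bsub>B\<^esub> y = x \<sqinter> y"
    "\<And>x y. x \<in> S \<Longrightarrow> y \<in> S \<Longrightarrow> x \<squnion>\<^bsub>B\<^esub> y = x \<squnion> y"
proof -
  have SB: "carrier B = S" by (simp add: B_def)
  have po: "partial_order B"
    unfolding B_def by (rule restrict_carrier_partial_order[OF A.partial_order_axioms S])
  have sub: "carrier B \<subseteq> carrier L" using S A_sub SB by blast
  have le: "x \<sqsubseteq>\<^bsub>B\<^esub> y \<longleftrightarrow> x \<sqsubseteq> y" if "x \<in> carrier B" "y \<in> carrier B" for x y
    using A_le[of x y] that S by (auto simp: B_def)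
  note * = subalgebra[OF L.boolean_alg_axioms po sub le, unfolded SB, OF _ _ bt cm mj]
  show "boolean_alg B" "\<bottom>\<^bsub>B\<^esub> = \<bottom>" "\<top>\<^bsub>B\<^esub> = \<top>"
    "\<And>x. x \<in> S \<Longrightarrow> cmpl B x = cmpl L x"
    "\<And>x y. x \<in> S \<Longrightarrow> y \<in> S \<Longrightarrow> x \<sqinter>\<^bsub>B\<^esub> y = x \<sqinter> y"
    "\<And>x y. x \<in> S \<Longrightarrow> y \<in> S \<Longrightarrow> x \<squnion>\<^bsub>B\<^esub> y = x \<squnion> y"
    by (rule *; assumption)+
qed

text \<open>The injections factor through \<open>S\<close>, so the universal property gives a
  homomorphism from \<open>A\<close> to \<open>S\<close>. Regarded as a map into \<open>A\<close> it
  must be the identity by uniqueness, so nothing lies outside \<open>S\<close>.\<close>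

lemma generated:
  assumes S: "S \<subseteq> carrier A" and gen: "\<And>i T. i \<ge> 1 \<Longrightarrow> T \<subseteq> Z0 \<Longrightarrow> \<phi> i T \<in> S"
    and bt: "\<bottom> \<in> S" "\<top> \<in> S" and cm: "\<And>x. x \<in> S \<Longrightarrow> cmpl L x \<in> S"
    and mj: "\<And>x y. x \<in> S \<Longrightarrow> y \<in> S \<Longrightarrow> x \<sqinter> y \<in> S" "\<And>x y. x \<in> S \<Longrightarrow> y \<in> S \<Longrightarrow> x \<squnion> y \<in> S"
  shows "S = carrier A"
proof -
  let ?B = "A\<lparr>carrier := S\<rparr>"
  have c: "x \<in> carrier A" if "x \<in> S" for x using S that by blast
  note B = restricted[OF S bt cm mj]
  have hom: "\<phi> i \<in> bool_hom powerset_Z0 ?B" if i: "i \<ge> 1" for i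
    unfolding bool_hom_def
  proof (intro CollectI conjI ballI)
    show "\<phi> i \<in> carrier powerset_Z0 \<rightarrow>\<^sub>E carrier ?B"
      using phi_hom[OF i] gen[OF i] unfolding bool_hom_def PiE_iff by simp
  qed (use i gen[OF i] in \<open>simp_all add: B powerset_Z0_bot_top powerset_Z0_ops
      powerset_Z0_cmpl[OF powerset_boolean] phi_ops\<close>)
  obtain h where h: "h \<in> bool_hom A ?B" "\<forall>i\<in>{1..}. compose (carrier powerset_Z0) h (\<phi> i) = \<phi> i"
    using sum[unfolded boolean_sum_def] B(1) hom by (metis (no_types, lifting) atLeast_iff)
  have hS: "h x \<in> S" if "x \<in> carrier A" for x
    using h(1) that by (auto simp: bool_hom_def)
  have hA: "h \<in> bool_hom A A"
  proof -
    have "h \<in> carrier A \<rightarrow>\<^sub>E carrier A" using h(1) S by (auto simp: bool_hom_def PiE_iff)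
    then show ?thesis
      using h(1) hS c unfolding bool_hom_def by (simp add: B A_ops)
  qed
  have id: "(\<lambda>x\<in>carrier A. x) \<in> bool_hom A A"
    using A.cmpl_props by (auto simp: bool_hom_def)
  have "\<exists>!h. h \<in> bool_hom A A \<and> (\<forall>i\<in>{1..}. compose (carrier powerset_Z0) h (\<phi> i) = \<phi> i)"
    using sum phi_hom A.boolean_alg_axioms unfolding boolean_sum_def by (metis (no_types, lifting) atLeast_iff)
  moreover have "compose (carrier powerset_Z0) (\<lambda>x\<in>carrier A. x) (\<phi> i) = \<phi> i" if "i \<in> {1..}" for i
  proof
    fix T show "compose (carrier powerset_Z0) (\<lambda>x\<in>carrier A. x) (\<phi> i) T = \<phi> i T"
      using phi_hom[of i] phi_A[of i T] that
      by (auto simp: compose_def bool_hom_def PiE_iff extensional_def)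
  qed
  ultimately have "h = (\<lambda>x\<in>carrier A. x)" using h(2) hA id by blast
  then show ?thesis using hS S by force
qed

text \<open>On each factor take the principal ultrafilter at \<open>\<nu> i\<close>; the universal
  property glues these into a two-valued point of the sum. The truth values are \<bottom> and \<top>
  of \<open>A\<close> itself, for reasons of typing, and they differ by injectivity of
  \<open>\<phi> 1\<close>.\<close>

lemma point_hom:
  assumes \<nu>: "\<And>i. i \<ge> 1 \<Longrightarrow> \<nu> i \<in> Z0"
  shows "\<exists>h. (\<forall>x\<in>carrier A. \<forall>y\<in>carrier A. h (x \<sqinter> y) = (h x \<and> h y)) \<and> \<not> h \<bottom> \<and> h \<top> \<and>
    (\<forall>i\<ge>1. \<forall>S\<subseteq>Z0. h (\<phi> i S) \<longleftrightarrow> \<nu> i \<in> S)"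
proof -
  define two where "two = {\<bottom>, \<top>}"
  let ?B = "A\<lparr>carrier := two\<rparr>"
  have two: "\<bottom> \<in> two" "\<top> \<in> two" by (simp_all add: two_def)
  have S: "two \<subseteq> carrier A" using A_closed by (simp add: two_def)
  have cl: "cmpl L \<bottom> = \<top>" "cmpl L \<top> = \<bottom>"
    "\<bottom> \<sqinter> x = \<bottom>" "\<top> \<sqinter> x = x" "\<bottom> \<squnion> x = x" "\<top> \<squnion> x = \<top>"
    if "x \<in> carrier L" for x
    using that L.cmpl_props(1) by (auto simp: L.eq_iff_stone L.ultraD)
  have cm: "cmpl L x \<in> two" if "x \<in> two" for x
    using that cl(1,2)[of "\<bottom>"] by (auto simp: two_def)
  have mj: "x \<sqinter> y \<in> two" "x \<squnion> y \<in> two" if "x \<in> two" "y \<in> two" for x y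
    using that cl(3-)[of "\<bottom>"] cl(3-)[of "\<top>"] by (auto simp: two_def)
  note B = restricted[OF S two cm mj]
  define f where "f i = (\<lambda>S\<in>Pow Z0. if \<nu> i \<in> S then \<top> else \<bottom>)" for i
  have hom: "f i \<in> bool_hom powerset_Z0 ?B" if i: "i \<ge> 1" for i
    unfolding bool_hom_def
  proof (intro CollectI conjI ballI)
    show "f i \<in> carrier powerset_Z0 \<rightarrow>\<^sub>E carrier ?B" by (auto simp: f_def two)
  qed (use \<nu>[OF i] in \<open>auto simp: f_def two B powerset_Z0_bot_top powerset_Z0_ops
      powerset_Z0_cmpl[OF powerset_boolean] cl[of "\<bottom>"] cl[of "\<top>"]\<close>)
  obtain h where h: "h \<in> bool_hom A ?B" "\<forall>i\<in>{1..}. compose (carrier powerset_Z0) h (\<phi> i) = f i"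
    using sum[unfolded boolean_sum_def] B(1) hom by (metis (no_types, lifting) atLeast_iff)
  have h2: "h x \<in> two" if "x \<in> carrier A" for x
    using h(1) that by (auto simp: bool_hom_def)
  have hm: "h (x \<sqinter> y) = h x \<sqinter> h y" if "x \<in> carrier A" "y \<in> carrier A" for x y
    using h(1) that h2 by (simp add: bool_hom_def A_ops B)
  have h01: "h \<bottom> = \<bottom>" "h \<top> = \<top>"
    using h(1) by (simp_all add: bool_hom_def A_ops B)
  have hphi: "h (\<phi> i S) = (if \<nu> i \<in> S then \<top> else \<bottom>)" if "i \<ge> 1" "S \<subseteq> Z0" for i S
  proof -
    have "compose (carrier powerset_Z0) h (\<phi> i) S = f i S" using h(2) that by simp
    then show ?thesis using that by (simp add: compose_def f_def)
  qed
  have "(h (x \<sqinter> y) = \<top>) = (h x = \<top> \<and> h y = \<top>)"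
    if "x \<in> carrier A" "y \<in> carrier A" for x y
    using h2[OF that(1)] h2[OF that(2)] bot_neq_top
    by (auto simp: two_def hm that cl[of "\<bottom>"] cl[of "\<top>"])
  then show ?thesis
    using h01 hphi bot_neq_top by (intro exI[of _ "\<lambda>x. h x = \<top>"]) auto
qed

section \<open>Cells of the sum and their density\<close>

lemma phi_ultra:
  assumes u: "ultra L u" and i: "i \<ge> 1"
  shows "\<phi> i {} \<notin> u" "\<phi> i Z0 \<in> u"
    "S \<subseteq> Z0 \<Longrightarrow> \<phi> i (Z0 - S) \<in> u \<longleftrightarrow> \<phi> i S \<notin> u"
    "S \<subseteq> Z0 \<Longrightarrow> T \<subseteq> Z0 \<Longrightarrow> \<phi> i (S \<inter> T) \<in> u \<longleftrightarrow> \<phi> i S \<in> u \<and> \<phi> i T \<in> u"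
    "S \<subseteq> T \<Longrightarrow> T \<subseteq> Z0 \<Longrightarrow> \<phi> i S \<in> u \<Longrightarrow> \<phi> i T \<in> u"
proof -
  show 1: "\<phi> i {} \<notin> u" "\<phi> i Z0 \<in> u"
    "S \<subseteq> Z0 \<Longrightarrow> \<phi> i (Z0 - S) \<in> u \<longleftrightarrow> \<phi> i S \<notin> u" for S
    using i L.ultraD[OF u] by (simp_all add: phi_ops)
  show 2: "S \<subseteq> Z0 \<Longrightarrow> T \<subseteq> Z0 \<Longrightarrow> \<phi> i (S \<inter> T) \<in> u \<longleftrightarrow> \<phi> i S \<in> u \<and> \<phi> i T \<in> u" for S T
    using i L.ultraD[OF u] by (simp add: phi_ops)
  show "S \<subseteq> T \<Longrightarrow> T \<subseteq> Z0 \<Longrightarrow> \<phi> i S \<in> u \<Longrightarrow> \<phi> i T \<in> u"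
    using 2[of S T] by (simp add: inf_absorb1)
qed

lemma cell_0: "cell L \<phi> 0 n = \<top>"
  using LC.weak_inf_empty by (simp add: cell_def L.eq_is_equal)

lemma cell_Suc:
  assumes n: "nz (Suc k) n" and c: "cell L \<phi> k n \<in> carrier L"
  shows "cell L \<phi> (Suc k) n = \<phi> (Suc k) {n (Suc k)} \<sqinter> cell L \<phi> k n"
proof -
  have "(\<lambda>i. \<phi> i {n i}) ` {1..k} \<subseteq> carrier L" "\<phi> (Suc k) {n (Suc k)} \<in> carrier L"
    using n by (auto simp: nz_def Z0_def)
  then have "\<Sqinter> (insert (\<phi> (Suc k) {n (Suc k)}) ((\<lambda>i. \<phi> i {n i}) ` {1..k})) =
      \<phi> (Suc k) {n (Suc k)} \<sqinter> \<Sqinter> ((\<lambda>i. \<phi> i {n i}) ` {1..k})"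
    using LC.weak_inf_insert by (simp add: L.eq_is_equal)
  then show ?thesis by (simp add: cell_def atLeastAtMostSuc_conv)
qed

lemma cell_A: "nz k n \<Longrightarrow> cell L \<phi> k n \<in> carrier A"
proof (induction k)
  case 0 then show ?case using cell_0 A_closed by simp
next
  case (Suc k)
  then have "cell L \<phi> k n \<in> carrier A" by (simp add: nz_Suc)
  moreover have "\<phi> (Suc k) {n (Suc k)} \<in> carrier A" using Suc.prems by (intro phi_A) (auto simp: nz_Suc Z0_def)
  ultimately show ?case using cell_Suc[OF Suc.prems] A_sub A_closed(4) by auto
qed

lemma cell_closed [simp]: "nz k n \<Longrightarrow> cell L \<phi> k n \<in> carrier L"
  using cell_A A_sub by blast

lemma cell_ultra:
  assumes u: "ultra L u" and n: "nz k n"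
  shows "cell L \<phi> k n \<in> u \<longleftrightarrow> (\<forall>i\<in>{1..k}. \<phi> i {n i} \<in> u)"
  using n
proof (induction k)
  case 0 then show ?case using cell_0 L.ultraD(1)[OF u] by simp
next
  case (Suc k)
  have "\<phi> (Suc k) {n (Suc k)} \<in> carrier L" using Suc.prems by (intro phi_closed) (auto simp: nz_Suc Z0_def)
  then show ?case
    using Suc cell_Suc[OF Suc.prems] L.ultraD(4)[OF u] by (simp add: nz_Suc atLeastAtMostSuc_conv)
qed

lemma cell_agree: "agree k n n' \<Longrightarrow> cell L \<phi> k n = cell L \<phi> k n'"
proof -
  assume "agree k n n'"
  then have "(\<lambda>i. \<phi> i {n i}) ` {1..k} = (\<lambda>i. \<phi> i {n' i}) ` {1..k}"
    by (intro image_cong) (auto simp: agree_def)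
  then show ?thesis by (simp add: cell_def)
qed

lemma cell_mono: "nz l n \<Longrightarrow> k \<le> l \<Longrightarrow> cell L \<phi> l n \<sqsubseteq> cell L \<phi> k n"
  using nz_mono[of l n k] by (auto simp: L.le_iff_stone cell_ultra)

lemma phi_singletons:
  assumes u: "ultra L u" and i: "i \<ge> 1" and p: "p \<noteq> 0" "\<phi> i {p} \<in> u" and S: "S \<subseteq> Z0"
  shows "\<phi> i S \<in> u \<longleftrightarrow> p \<in> S"
proof (cases "p \<in> S")
  case True then show ?thesis using phi_ultra(5)[OF u i, of "{p}" S] S p by simp
next
  case False
  then have "{p} \<inter> S = {}" by blast
  then show ?thesis
    using phi_ultra(1)[OF u i] phi_ultra(4)[OF u i, of "{p}" S] S p False by (auto simp: Z0_def)
qed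

lemma cell_disjoint:
  assumes "nz m n" "nz m n'" "\<not> agree m n n'"
  shows "cell L \<phi> m n \<sqinter> cell L \<phi> m n' = \<bottom>"
proof -
  obtain i where i: "i \<in> {1..m}" "n i \<noteq> n' i" using assms by (auto simp: agree_def)
  have "\<not> (cell L \<phi> m n \<in> u \<and> cell L \<phi> m n' \<in> u)" if u: "ultra L u" for u
    using phi_singletons[OF u, of i "n i" "{n' i}"] i assms u
    by (auto simp: cell_ultra nz_def Z0_def)
  then show ?thesis
    using assms by (simp add: L.eq_iff_stone L.ultraD)
qed

text \<open>This is the independence of the factors: the two-valued point with coordinates
  \<open>n\<close> holds on the cell. Coordinates beyond \<open>k\<close> receive the arbitrary
  value \<open>1\<close>.\<close>

lemma cell_nonbot:
  assumes "nz k n"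
  shows "cell L \<phi> k n \<noteq> \<bottom>"
proof -
  let ?\<nu> = "\<lambda>i. if i \<in> {1..k} then n i else 1"
  have "?\<nu> i \<in> Z0" for i using assms by (auto simp: nz_def Z0_def)
  then obtain h where h: "\<forall>x\<in>carrier A. \<forall>y\<in>carrier A. h (x \<sqinter> y) = (h x \<and> h y)" "\<not> h \<bottom>" "h \<top>"
    "\<forall>i\<ge>1. \<forall>S\<subseteq>Z0. h (\<phi> i S) \<longleftrightarrow> ?\<nu> i \<in> S"
    using point_hom[of ?\<nu>] by (elim meta_impE exE conjE) (assumption, rule that)
  have "h (cell L \<phi> j n)" if "j \<le> k" for j
    using that
  proof (induction j)
    case 0 then show ?case using h cell_0 by simp
  next
    case (Suc j)
    have z: "nz (Suc j) n" "nz j n" using assms Suc.prems nz_mono[of k n] by auto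
    have ph: "\<phi> (Suc j) {n (Suc j)} \<in> carrier A" using z by (intro phi_A) (auto simp: nz_Suc Z0_def)
    have "h (\<phi> (Suc j) {n (Suc j)})" using h(4) z Suc.prems by (auto simp: nz_Suc Z0_def)
    then show ?case
      using Suc h(1) cell_Suc[OF z(1) cell_closed[OF z(2)]] cell_A[OF z(2)] ph by simp
  qed
  then show ?thesis using h(2) by (metis order_refl)
qed

text \<open>
  Every element of \<open>A\<close> is decided by finitely many elements \<open>\<phi> i S\<close>, because such elements form a
  subalgebra; the corresponding coordinates of one ultrafilter then bound a cell below it.
\<close>

lemma cell_below_A:
  assumes x: "x \<in> carrier A" "x \<noteq> \<bottom>"
  shows "\<exists>k n. nz k n \<and> cell L \<phi> k n \<sqsubseteq> x"
proof -
  define dec where "dec \<Phi> x \<longleftrightarrow> finite \<Phi> \<and> \<Phi> \<subseteq> {1..} \<times> Pow Z0 \<and>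
    (\<forall>u v. ultra L u \<and> ultra L v \<and> (\<forall>(i, S)\<in>\<Phi>. \<phi> i S \<in> u \<longleftrightarrow> \<phi> i S \<in> v) \<longrightarrow> (x \<in> u \<longleftrightarrow> x \<in> v))" for \<Phi> x
  have dec_Un: "dec (\<Phi> \<union> \<Psi>) x" if "dec \<Phi> x" "finite \<Psi>" "\<Psi> \<subseteq> {1..} \<times> Pow Z0" for \<Phi> \<Psi> x
    using that unfolding dec_def by (auto 0 3)
  have decI: "dec (\<Phi> \<union> \<Psi>) z"
    if "dec \<Phi> x" "dec \<Psi> y" "\<And>u v. ultra L u \<Longrightarrow> ultra L v \<Longrightarrow> x \<in> u \<longleftrightarrow> x \<in> v \<Longrightarrow> y \<in> u \<longleftrightarrow> y \<in> v \<Longrightarrow> z \<in> u \<longleftrightarrow> z \<in> v" for \<Phi> \<Psi> x y z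
    using that unfolding dec_def by (auto 0 3)
  have "{x \<in> carrier A. \<exists>\<Phi>. dec \<Phi> x} = carrier A"
  proof (rule generated)
    fix i T assume iT: "i \<ge> (1::nat)" "T \<subseteq> Z0"
    then have "dec {(i, T)} (\<phi> i T)" by (auto simp: dec_def)
    then show "\<phi> i T \<in> {x \<in> carrier A. \<exists>\<Phi>. dec \<Phi> x}" using iT phi_A by blast
  next
    have "dec {} \<bottom>" "dec {} \<top>" by (auto simp: dec_def L.ultraD)
    then show "\<bottom> \<in> {x \<in> carrier A. \<exists>\<Phi>. dec \<Phi> x}" "\<top> \<in> {x \<in> carrier A. \<exists>\<Phi>. dec \<Phi> x}"
      using A_closed by blast+
  next
    fix x assume "x \<in> {x \<in> carrier A. \<exists>\<Phi>. dec \<Phi> x}"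
    then obtain \<Phi> where x: "x \<in> carrier A" "dec \<Phi> x" by blast
    have "dec (\<Phi> \<union> \<Phi>) (cmpl L x)"
      using x A_sub by (intro decI[OF x(2) x(2)]) (auto simp: L.ultraD subset_iff)
    then show "cmpl L x \<in> {x \<in> carrier A. \<exists>\<Phi>. dec \<Phi> x}" using x A_closed by blast
  next
    fix x y assume "x \<in> {x \<in> carrier A. \<exists>\<Phi>. dec \<Phi> x}" "y \<in> {x \<in> carrier A. \<exists>\<Phi>. dec \<Phi> x}"
    then obtain \<Phi> \<Psi> where xy: "x \<in> carrier A" "dec \<Phi> x" "y \<in> carrier A" "dec \<Psi> y" by blast
    then have c: "x \<in> carrier L" "y \<in> carrier L" using A_sub by auto
    have "dec (\<Phi> \<union> \<Psi>) (x \<sqinter> y)" "dec (\<Phi> \<union> \<Psi>) (x \<squnion> y)"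
      using c by (auto intro!: decI[OF xy(2,4)] simp: L.ultraD)
    then show "x \<sqinter> y \<in> {x \<in> carrier A. \<exists>\<Phi>. dec \<Phi> x}" "x \<squnion> y \<in> {x \<in> carrier A. \<exists>\<Phi>. dec \<Phi> x}"
      using xy A_closed by blast+
  qed blast
  then obtain \<Phi> where \<Phi>: "dec \<Phi> x" using x by blast
  have xc: "x \<in> carrier L" using x A_sub by blast
  have "\<bottom> \<noteq> x" using x by simp
  then obtain u where u: "ultra L u" "x \<in> u"
    using L.ultrafilter_extension[of "{x}"] xc by auto
  \<comment> \<open>\<open>T i\<close> is a finite intersection of sets \<open>S\<close> or
    \<open>Z0 - S\<close> whose images lie in \<open>u\<close>. Its own image then lies in
    \<open>u\<close>, so it contains a coordinate that behaves like \<open>u\<close> on all of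
    \<Phi>.\<close>
  define T where "T i = {p \<in> Z0. \<forall>S. (i, S) \<in> \<Phi> \<longrightarrow> (p \<in> S \<longleftrightarrow> \<phi> i S \<in> u)}" for i
  have fin: "finite \<Phi>" "\<Phi> \<subseteq> {1..} \<times> Pow Z0" using \<Phi> by (auto simp: dec_def)
  have "T i \<noteq> {}" if i: "i \<ge> 1" for i
  proof -
    have "\<phi> i {p \<in> Z0. \<forall>S. (i, S) \<in> \<Psi> \<longrightarrow> (p \<in> S \<longleftrightarrow> \<phi> i S \<in> u)} \<in> u"
      if "finite \<Psi>" "\<Psi> \<subseteq> {1..} \<times> Pow Z0" for \<Psi>
      using that
    proof (induction \<Psi>)
      case empty then show ?case using phi_ultra(2)[OF u(1) i] by simp
    next
      case (insert q \<Psi>)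
      obtain j S where q: "q = (j, S)" by force
      let ?R = "\<lambda>\<Psi>. {p \<in> Z0. \<forall>S. (i, S) \<in> \<Psi> \<longrightarrow> (p \<in> S \<longleftrightarrow> \<phi> i S \<in> u)}"
      have IH: "\<phi> i (?R \<Psi>) \<in> u" using insert by simp
      show ?case
      proof (cases "j = i")
        case False
        then have "?R (insert q \<Psi>) = ?R \<Psi>" using q by auto
        then show ?thesis using IH by simp
      next
        case True
        let ?S = "if \<phi> i S \<in> u then S else Z0 - S"
        have S: "S \<subseteq> Z0" using insert.prems q by auto
        have "\<phi> i ?S \<in> u" using phi_ultra(3)[OF u(1) i S] by simp
        moreover have "?R (insert q \<Psi>) = ?R \<Psi> \<inter> ?S" using q True S by auto
        moreover have "?R \<Psi> \<subseteq> Z0" "?S \<subseteq> Z0" using S by auto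
        ultimately show ?thesis using phi_ultra(4)[OF u(1) i, of "?R \<Psi>" ?S] IH by metis
      qed
    qed
    from this[OF fin] have "\<phi> i (T i) \<in> u" by (simp add: T_def)
    then show ?thesis using phi_ultra(1)[OF u(1) i] by auto
  qed
  then have "\<forall>i. \<exists>p. i \<ge> 1 \<longrightarrow> p \<in> T i" by blast
  then obtain n where n: "\<And>i. i \<ge> 1 \<Longrightarrow> n i \<in> T i" by metis
  obtain k where k: "\<And>i S. (i, S) \<in> \<Phi> \<Longrightarrow> i \<le> k"
  proof
    fix i S assume "(i, S) \<in> \<Phi>"
    then show "i \<le> Max (fst ` \<Phi>)" using fin(1) by (intro Max_ge) force+
  qed
  have nzn: "nz k n" using n by (auto simp: nz_def T_def Z0_def)
  have "x \<in> v" if v: "ultra L v" "cell L \<phi> k n \<in> v" for v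
  proof -
    have "\<phi> i S \<in> u \<longleftrightarrow> \<phi> i S \<in> v" if iS: "(i, S) \<in> \<Phi>" for i S
    proof -
      have i: "i \<ge> 1" "i \<le> k" "S \<subseteq> Z0" using fin iS k by auto
      then have "\<phi> i {n i} \<in> v" using v cell_ultra[OF v(1) nzn] by simp
      moreover have "n i \<noteq> 0" using nzn i by (auto simp: nz_def)
      ultimately have "\<phi> i S \<in> v \<longleftrightarrow> n i \<in> S" using phi_singletons[OF v(1) i(1) _ _ i(3)] by blast
      then show ?thesis using n[OF i(1)] iS by (auto simp: T_def)
    qed
    then show ?thesis using \<Phi> u v(1) unfolding dec_def by blast
  qed
  then have "cell L \<phi> k n \<sqsubseteq> x" using xc nzn by (simp add: L.le_iff_stone)
  then show ?thesis using nzn by blast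
qed

text \<open>By join-density some nonzero element of \<open>A\<close> lies below \<open>a\<close>,
  since otherwise the join of those elements, which is \<open>a\<close>, would be \<bottom>.\<close>

lemma cell_below:
  assumes a: "a \<in> carrier L" "a \<noteq> \<bottom>"
  shows "\<exists>k n. nz k n \<and> cell L \<phi> k n \<sqsubseteq> a"
proof -
  let ?S = "{x \<in> carrier A. x \<sqsubseteq> a}"
  have "\<exists>x\<in>?S. x \<noteq> \<bottom>"
  proof (rule ccontr)
    assume n: "\<not> ?thesis"
    have "\<Squnion>?S \<sqsubseteq> \<bottom>" using n A_sub by (intro LC.sup_least) auto
    then have "a \<sqsubseteq> \<bottom>" using A_dense[OF a(1)] by simp
    then show False using a L.le_antisym[of a "\<bottom>"] L.bottom_lower by auto
  qed
  then obtain x where x: "x \<in> carrier A" "x \<sqsubseteq> a" "x \<noteq> \<bottom>" by blast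
  then obtain k n where kn: "nz k n" "cell L \<phi> k n \<sqsubseteq> x" using cell_below_A by blast
  then have "cell L \<phi> k n \<sqsubseteq> a" using L.le_trans[OF kn(2) x(2)] x a A_sub by auto
  then show ?thesis using kn by blast
qed

end

section \<open>Realising the completed sum on the unit interval\<close>

text \<open>The same lattice carries two contacts in what follows: one read off from the interval,
  for which the representation is immediate, and the constructed one, shown to coincide with it only
  later.\<close>

definition with_contact :: "'a gorder \<Rightarrow> ('a \<Rightarrow> 'a \<Rightarrow> bool) \<Rightarrow> 'a contact_alg" where
  "with_contact L c = \<lparr>carrier = carrier L, eq = eq L, le = le L, contact = c\<rparr>"

lemma with_contact_simps [simp]:
  "carrier (with_contact L c) = carrier L" "eq (with_contact L c) = eq L" "le (with_contact L c) = le L"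
  "contact (with_contact L c) = c"
  by (simp_all add: with_contact_def)

lemma with_contact_ops:
  "\<Squnion>\<^bsub>with_contact L c\<^esub> S = \<Squnion>\<^bsub>L\<^esub> S" "x \<squnion>\<^bsub>with_contact L c\<^esub> y = x \<squnion>\<^bsub>L\<^esub> y"
  "x \<sqinter>\<^bsub>with_contact L c\<^esub> y = x \<sqinter>\<^bsub>L\<^esub> y" "\<bottom>\<^bsub>with_contact L c\<^esub> = \<bottom>\<^bsub>L\<^esub>" "\<top>\<^bsub>with_contact L c\<^esub> = \<top>\<^bsub>L\<^esub>"
  "cmpl (with_contact L c) x = cmpl L x"
  by (simp_all add: sup_def join_def inf_def meet_def least_def greatest_def Upper_def Lower_def
      bottom_def top_def elem_def cmpl_def)

lemma with_contact_partial_order: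
  assumes "partial_order L" shows "partial_order (with_contact L c)"
proof -
  interpret partial_order L by (rule assms)
  show ?thesis
    by (unfold_locales; simp add: eq_is_equal) (meson le_antisym le_trans)+
qed

lemma with_contact_boolean:
  assumes "boolean_alg L" shows "boolean_alg (with_contact L c)"
proof -
  interpret boolean_alg L by (rule assms)
  show ?thesis
    by (rule subalgebra(1)[OF assms with_contact_partial_order[OF partial_order_axioms]])
      (simp_all add: cmpl_props)
qed

lemma with_contact_complete:
  assumes "complete_lattice L" shows "complete_lattice (with_contact L c)"
proof -
  interpret complete_lattice L by (rule assms)
  show ?thesis
  proof (rule partial_order.complete_latticeI[OF with_contact_partial_order[OF partial_order_axioms]])
    fix S assume "S \<subseteq> carrier (with_contact L c)"
    then have S: "S \<subseteq> carrier L" by simp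
    show "\<exists>s. least (with_contact L c) s (Upper (with_contact L c) S)"
      using sup_exists[OF S] by (simp add: least_def Upper_def)
    show "\<exists>s. greatest (with_contact L c) s (Lower (with_contact L c) S)"
      using inf_exists[OF S] by (simp add: greatest_def Lower_def)
  qed
qed

abbreviation unit_top :: "real topology" where
  "unit_top \<equiv> top_of_set {0..1}"

lemma unit_closure: "unit_top closure_of S = {0..1} \<inter> closure ({0..1} \<inter> S)"
  by (simp add: closure_of_subtopology)

lemma unit_closure_open_interval:
  assumes "0 \<le> a" "a < b" "b \<le> (1::real)"
  shows "unit_top closure_of {a<..<b} = {a..b}"
proof -
  have "{0..1} \<inter> {a<..<b} = {a<..<b}" using assms by auto
  then show ?thesis using assms by (auto simp: unit_closure)
qed

lemma unit_open:
  assumes "open U" shows "openin unit_top ({0..1} \<inter> U)"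
  using assms by (auto simp: openin_open)

lemma cell_op_open: "openin unit_top (cell_op k n)"
proof -
  have "cell_op k n = {0..1} \<inter> {lo k n<..<hi k n}"
    using cell_unit(2)[of k n] by (auto simp: cell_op_def)
  then show ?thesis using unit_open[of "{lo k n<..<hi k n}"] by simp
qed

lemma closure_cell_op: "unit_top closure_of (cell_op k n) = cell_cl k n"
  unfolding cell_op_def cell_cl_def using cell_unit(1)[of k n] lo_less_hi[of k n]
  by (intro unit_closure_open_interval) (auto simp: cell_cl_def)

lemma interval_in_ball:
  fixes a b x :: real
  assumes "x \<in> {a..b}" "b - a < \<epsilon>"
  shows "{a..b} \<subseteq> ball x \<epsilon>"
  using assms by (auto simp: dist_real_def)

text \<open>Density of the tree on the side of the interval. The given point may be \<open>0\<close>
  or \<open>1\<close>, so it is first moved to an interior point; if only an interval around a cut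
  point is found, a cell inside it is used.\<close>

lemma open_unit_contains_cell:
  assumes V: "openin unit_top V" "V \<noteq> {}"
  shows "\<exists>k n. is_tuple k n \<and> cell_op k n \<subseteq> V"
proof -
  obtain T where T: "open T" "V = {0..1} \<inter> T" using V by (auto simp: openin_open)
  obtain x0 where x0: "x0 \<in> {0..1}" "x0 \<in> T" using V T by blast
  have "x0 \<in> closure {0<..<1::real}" using x0 by simp
  then obtain x where x: "x \<in> T" "x \<in> {0<..<1}"
    using T(1) x0(2) by (metis disjoint_iff open_Int_closure_eq_empty)
  obtain \<epsilon> where e: "\<epsilon> > 0" "ball x \<epsilon> \<subseteq> T" using T x openE by metis
  from small_neighbourhood[of x \<epsilon>] x e(1) consider
    k n where "is_tuple k n" "x \<in> cell_op k n" "hi k n - lo k n < \<epsilon>"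
    | k n r where "is_tuple k n" "r \<ge> 1" "qlo k n r < x" "x < qhi k n r" "qhi k n r - qlo k n r < \<epsilon>"
    by auto
  then show ?thesis
  proof cases
    case (1 k n)
    then have "cell_cl k n \<subseteq> ball x \<epsilon>"
      unfolding cell_cl_def by (intro interval_in_ball) (auto simp: cell_op_def)
    then have "cell_op k n \<subseteq> V" using cell_op_cl[of k n] cell_unit(1)[of k n] e T by blast
    then show ?thesis using 1 by blast
  next
    case (2 k n r)
    let ?n = "n(Suc k := - int r - 1)"
    have c: "is_tuple (Suc k) ?n" "cell_op (Suc k) ?n \<subseteq> {qlo k n r..qhi k n r}"
      using cell_below_q[OF 2(1,2)] by auto
    have "{qlo k n r..qhi k n r} \<subseteq> ball x \<epsilon>" using 2 by (intro interval_in_ball) auto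
    then have "cell_op (Suc k) ?n \<subseteq> V" using c(2) cell_op_cl[of "Suc k" ?n] cell_unit(1)[of "Suc k" ?n] e T by blast
    then show ?thesis using c by blast
  qed
qed

context completed_sum
begin

section \<open>The order isomorphism between the completed sum and the regular closed sets\<close>

definition cells_below :: "'a \<Rightarrow> real set" where
  "cells_below a = \<Union>{cell_op k n | k n. nz k n \<and> cell L \<phi> k n \<sqsubseteq> a}"

definition erep :: "'a \<Rightarrow> real set" where
  "erep a = unit_top closure_of (cells_below a)"

lemma cells_below_open: "openin unit_top (cells_below a)"
  unfolding cells_below_def using cell_op_open by (intro openin_Union) blast

lemma cell_op_below: "nz k n \<Longrightarrow> cell L \<phi> k n \<sqsubseteq> a \<Longrightarrow> cell_op k n \<subseteq> cells_below a"
  unfolding cells_below_def by blast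

lemma cells_below_subset: "cells_below a \<subseteq> erep a"
  unfolding erep_def by (rule closure_of_subset[OF openin_subset[OF cells_below_open]])

lemma erep_closed: "closedin unit_top (erep a)"
  by (simp add: erep_def)

lemma cell_comparable:
  assumes "nz k n" "nz l n'" "k \<le> l"
  shows "agree k n n' \<and> cell L \<phi> l n' \<sqsubseteq> cell L \<phi> k n \<and> cell_op l n' \<subseteq> cell_op k n \<or>
    cell L \<phi> k n \<sqinter> cell L \<phi> l n' = \<bottom> \<and> cell_op k n \<inter> cell_op l n' = {}"
proof -
  have z: "nz k n'" using assms nz_mono by blast
  have m: "cell L \<phi> l n' \<sqsubseteq> cell L \<phi> k n'" "cell_op l n' \<subseteq> cell_op k n'"
    using cell_mono cell_op_mono assms by auto
  show ?thesis
  proof (cases "agree k n n'")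
    case True
    then show ?thesis using m cell_agree[OF True] cell_cong(2)[OF True] by simp
  next
    case False
    have "cell_op k n \<inter> cell_op l n' = {}"
      using cells_disjoint[OF assms(1) z False] m(2) cell_op_cl[of k n'] by blast
    moreover have "cell L \<phi> k n \<sqinter> cell L \<phi> l n' = \<bottom>"
      using cell_disjoint[OF assms(1) z False] m(1) assms z
      by (simp add: L.le_iff_stone L.eq_iff_stone L.ultraD) blast
    ultimately show ?thesis by blast
  qed
qed

text \<open>Cells are either nested or disjoint, and on both sides the codes alone decide which.
  This transfer of incompatibility carries all comparisons of the two algebras.\<close>

lemma meet_bot_iff:
  assumes "nz k n" "nz l n'"
  shows "cell L \<phi> k n \<sqinter> cell L \<phi> l n' = \<bottom> \<longleftrightarrow> cell_op k n \<inter> cell_op l n' = {}"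
proof -
  have *: "cell L \<phi> k n \<sqinter> cell L \<phi> l n' = \<bottom> \<longleftrightarrow> cell_op k n \<inter> cell_op l n' = {}"
    if "nz k n" "nz l n'" "k \<le> l" for k n l n'
    using cell_comparable[OF that]
  proof
    assume c: "agree k n n' \<and> cell L \<phi> l n' \<sqsubseteq> cell L \<phi> k n \<and> cell_op l n' \<subseteq> cell_op k n"
    then have "cell L \<phi> k n \<sqinter> cell L \<phi> l n' = cell L \<phi> l n'"
      using L.le_iff_join[of "cell L \<phi> l n'" "cell L \<phi> k n"] that by (simp add: meet_comm[of L])
    moreover have "cell_op k n \<inter> cell_op l n' \<noteq> {}"
      using c cell_op_nonempty[of l n'] by blast
    ultimately show ?thesis using cell_nonbot[OF that(2)] by simp
  qed blast
  show ?thesis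
  proof (cases "k \<le> l")
    case True then show ?thesis using * assms by blast
  next
    case False
    then have "l \<le> k" by simp
    from *[OF assms(2,1) this] show ?thesis by (simp add: Int_commute meet_comm[of L])
  qed
qed

lemma meet_nonbot:
  assumes "ultra L u" "x \<in> u" "y \<in> u" "x \<in> carrier L" "y \<in> carrier L"
  shows "x \<sqinter> y \<noteq> \<bottom>"
  using L.ultraD[OF assms(1)] assms by metis

lemma ex_ultra: "x \<in> carrier L \<Longrightarrow> x \<noteq> \<bottom> \<Longrightarrow> \<exists>u. ultra L u \<and> x \<in> u"
  using L.ultrafilter_extension[of "{x}"] by auto

lemma ex_ultra_cell: "nz k n \<Longrightarrow> \<exists>u. ultra L u \<and> cell L \<phi> k n \<in> u"
  using ex_ultra[OF cell_closed cell_nonbot] by blast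

text \<open>Otherwise some cell lies below both the given one and the complement of
  \<open>a\<close>. Its interval meets one of the intervals that are dense in \<open>erep a\<close>,
  and by \<open>meet_bot_iff\<close> the two cells have a nonzero meet, which lies both below
  \<open>a\<close> and below its complement.\<close>

lemma cell_le_if_cell_op_subset:
  assumes a: "a \<in> carrier L" and n: "nz k n" and s: "cell_op k n \<subseteq> erep a"
  shows "cell L \<phi> k n \<sqsubseteq> a"
proof (rule ccontr)
  assume "\<not> cell L \<phi> k n \<sqsubseteq> a"
  then have x: "cell L \<phi> k n \<sqinter> cmpl L a \<noteq> \<bottom>" "cell L \<phi> k n \<sqinter> cmpl L a \<in> carrier L"
    using a n L.cmpl_props(1) by (auto simp: L.le_iff_stone L.eq_iff_stone L.ultraD)
  then obtain l m where m: "nz l m" "cell L \<phi> l m \<sqsubseteq> cell L \<phi> k n \<sqinter> cmpl L a"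
    using cell_below by blast
  have mu: "cell L \<phi> k n \<in> u \<and> a \<notin> u" if "ultra L u" "cell L \<phi> l m \<in> u" for u
    using m that a n L.cmpl_props(1)[OF a] by (simp add: L.le_iff_stone L.ultraD)
  obtain u where u: "ultra L u" "cell L \<phi> l m \<in> u" using ex_ultra_cell[OF m(1)] by blast
  then have "cell_op k n \<inter> cell_op l m \<noteq> {}"
    using meet_bot_iff[OF n m(1)] meet_nonbot[OF u(1) _ u(2)] mu n m by simp
  moreover have o: "openin unit_top (cell_op k n \<inter> cell_op l m)" by (intro openin_Int cell_op_open)
  ultimately have "(cell_op k n \<inter> cell_op l m) \<inter> cells_below a \<noteq> {}"
    using openin_Int_closure_of_eq_empty[OF o, of "cells_below a"] s unfolding erep_def by blast
  then obtain j p where p: "nz j p" "cell L \<phi> j p \<sqsubseteq> a" "cell_op j p \<inter> cell_op l m \<noteq> {}"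
    unfolding cells_below_def by blast
  then have "cell L \<phi> j p \<sqinter> cell L \<phi> l m \<noteq> \<bottom>" using meet_bot_iff m by blast
  then obtain v where v: "ultra L v" "cell L \<phi> j p \<sqinter> cell L \<phi> l m \<in> v"
    using ex_ultra p m by (meson L.meet_closed cell_closed)
  then have "cell L \<phi> j p \<in> v" "cell L \<phi> l m \<in> v" using L.ultraD(4)[OF v(1)] p m by auto
  moreover have "a \<in> v" using p(2) \<open>cell L \<phi> j p \<in> v\<close> v a p by (simp add: L.le_iff_stone)
  ultimately show False using mu v by blast
qed

lemma erep_mono: "a \<in> carrier L \<Longrightarrow> b \<in> carrier L \<Longrightarrow> a \<sqsubseteq> b \<Longrightarrow> erep a \<subseteq> erep b"
  unfolding erep_def
proof (rule closure_of_mono)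
  assume ab: "a \<in> carrier L" "b \<in> carrier L" "a \<sqsubseteq> b"
  show "cells_below a \<subseteq> cells_below b"
  proof
    fix s assume "s \<in> cells_below a"
    then obtain k n where kn: "nz k n" "cell L \<phi> k n \<sqsubseteq> a" "s \<in> cell_op k n"
      unfolding cells_below_def by blast
    then have "cell L \<phi> k n \<sqsubseteq> b" using L.le_trans[OF kn(2) ab(3)] ab by simp
    then show "s \<in> cells_below b" using cell_op_below kn by blast
  qed
qed

lemma erep_le_iff:
  assumes a: "a \<in> carrier L" and b: "b \<in> carrier L"
  shows "a \<sqsubseteq> b \<longleftrightarrow> erep a \<subseteq> erep b"
proof
  assume s: "erep a \<subseteq> erep b"
  show "a \<sqsubseteq> b"
  proof (rule ccontr)
    assume "\<not> a \<sqsubseteq> b"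
    then have x: "a \<sqinter> cmpl L b \<noteq> \<bottom>" "a \<sqinter> cmpl L b \<in> carrier L"
      using a b L.cmpl_props(1) by (auto simp: L.le_iff_stone L.eq_iff_stone L.ultraD)
    then obtain k n where kn: "nz k n" "cell L \<phi> k n \<sqsubseteq> a \<sqinter> cmpl L b"
      using cell_below by blast
    then have "cell L \<phi> k n \<sqsubseteq> a" using a b L.cmpl_props(1)[OF b] by (simp add: L.le_iff_stone L.ultraD)
    then have "cell_op k n \<subseteq> erep b" using cell_op_below[OF kn(1)] cells_below_subset[of a] s by blast
    then have "cell L \<phi> k n \<sqsubseteq> b" by (rule cell_le_if_cell_op_subset[OF b kn(1)])
    moreover obtain u where u: "ultra L u" "cell L \<phi> k n \<in> u" using ex_ultra_cell[OF kn(1)] by blast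
    ultimately show False using kn a b L.cmpl_props(1)[OF b] by (simp add: L.le_iff_stone L.ultraD)
  qed
qed (use assms erep_mono in blast)

text \<open>The witness is the join of the cells whose intervals lie in \<open>F\<close>. An
  interval in the interior of \<open>F\<close> missed by \<open>erep a\<close> would belong to this
  family; a cell interval in \<open>cells_below a\<close> outside \<open>F\<close> would give a cell
  disjoint from the whole family, hence from the join that it lies below.\<close>

lemma erep_surj:
  assumes F: "F \<in> carrier (RC unit_top)"
  shows "\<exists>a\<in>carrier L. erep a = F"
proof -
  let ?S = "{cell L \<phi> k n | k n. nz k n \<and> cell_op k n \<subseteq> F}"
  define a where "a = \<Squnion>?S"
  have S: "?S \<subseteq> carrier L" by auto
  have a: "a \<in> carrier L" using S by (simp add: a_def)
  have up: "x \<sqsubseteq> a" if "x \<in> ?S" for x unfolding a_def by (rule LC.sup_upper[OF S that])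
  have "F \<subseteq> erep a"
  proof -
    have "unit_top interior_of F \<subseteq> erep a"
    proof (rule ccontr)
      assume "\<not> unit_top interior_of F \<subseteq> erep a"
      then have "unit_top interior_of F - erep a \<noteq> {}" by blast
      moreover have "openin unit_top (unit_top interior_of F - erep a)"
        using erep_closed by (intro openin_diff) auto
      ultimately obtain k n where kn: "is_tuple k n" "cell_op k n \<subseteq> unit_top interior_of F - erep a"
        using open_unit_contains_cell by blast
      then have n: "nz k n" by (simp add: is_tuple_iff)
      have "cell_op k n \<subseteq> F" using kn(2) interior_of_subset[of unit_top F] by blast
      then have "cell_op k n \<subseteq> cells_below a" using up n by (intro cell_op_below) blast+
      then show False using kn(2) cells_below_subset[of a] cell_op_nonempty[of k n] by blast
    qed
    then have "unit_top closure_of (unit_top interior_of F) \<subseteq> erep a"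
      by (rule closure_of_minimal[OF _ erep_closed])
    then show ?thesis using RC_closure_interior[OF F] by simp
  qed
  moreover have "cells_below a \<subseteq> F"
  proof
    fix s assume "s \<in> cells_below a"
    then obtain k n where kn: "nz k n" "cell L \<phi> k n \<sqsubseteq> a" "s \<in> cell_op k n"
      unfolding cells_below_def by blast
    have "cell_op k n \<subseteq> F"
    proof (rule ccontr)
      assume "\<not> cell_op k n \<subseteq> F"
      then have "cell_op k n - F \<noteq> {}" by blast
      moreover have "openin unit_top (cell_op k n - F)"
        using RC_closed[OF F] by (intro openin_diff cell_op_open)
      ultimately obtain l m where m: "is_tuple l m" "cell_op l m \<subseteq> cell_op k n - F"
        using open_unit_contains_cell by blast
      then have zm: "nz l m" by (simp add: is_tuple_iff)
      have "x \<sqsubseteq> cmpl L (cell L \<phi> l m)" if xS: "x \<in> ?S" for x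
      proof -
        obtain j p where p: "x = cell L \<phi> j p" "nz j p" "cell_op j p \<subseteq> F" using xS by blast
        then have "x \<sqinter> cell L \<phi> l m = \<bottom>" using meet_bot_iff[OF p(2) zm] m by blast
        then show ?thesis using p zm by (intro L.le_cmpl_if_disjoint) auto
      qed
      then have "a \<sqsubseteq> cmpl L (cell L \<phi> l m)"
        unfolding a_def using S zm L.cmpl_props(1) by (intro LC.sup_least) auto
      moreover have "cell_op l m \<subseteq> cells_below a" using m cell_op_below[OF kn(1,2)] by blast
      then have "cell L \<phi> l m \<sqsubseteq> a"
        using cell_le_if_cell_op_subset[OF a zm] cells_below_subset[of a] by blast
      moreover obtain u where "ultra L u" "cell L \<phi> l m \<in> u" using ex_ultra_cell[OF zm] by blast
      ultimately show False using a zm L.cmpl_props(1)[OF cell_closed[OF zm]] by (auto simp: L.le_iff_stone L.ultraD)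
    qed
    then show "s \<in> F" using kn by blast
  qed
  then have "erep a \<subseteq> F" unfolding erep_def by (rule closure_of_minimal[OF _ RC_closed[OF F]])
  ultimately show ?thesis using a by blast
qed

definition alg :: "'a contact_alg" where
  "alg = with_contact L (\<lambda>a b. erep a \<inter> erep b \<noteq> {})"

lemma alg_simps [simp]: "carrier alg = carrier L" "le alg = le L"
  by (simp_all add: alg_def)

sublocale R: represented alg unit_top erep
proof (intro represented.intro represented_axioms.intro)
  show "boolean_alg alg" unfolding alg_def by (rule with_contact_boolean[OF L.boolean_alg_axioms])
  show "complete_lattice alg" unfolding alg_def by (rule with_contact_complete[OF LC.complete_lattice_axioms])
  show "compact_space unit_top" by (simp add: compact_space_subtopology)
  show "Hausdorff_space unit_top" by (simp add: Hausdorff_space_subtopology)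
  show "bij_betw erep (carrier alg) (carrier (RC unit_top))"
    unfolding bij_betw_def
  proof
    show "inj_on erep (carrier alg)"
      using erep_le_iff L.le_antisym by (intro inj_onI) auto
    show "erep ` carrier alg = carrier (RC unit_top)"
    proof
      show "erep ` carrier alg \<subseteq> carrier (RC unit_top)"
        unfolding erep_def using RC_closure_of_open[OF cells_below_open] by blast
      show "carrier (RC unit_top) \<subseteq> erep ` carrier alg"
        using erep_surj by (intro subsetI) (metis imageI alg_simps(1))
    qed
  qed
qed (simp_all add: erep_le_iff alg_def)

lemmas alg_ops = with_contact_ops[of L "\<lambda>a b. erep a \<inter> erep b \<noteq> {}", folded alg_def]

lemma erep_join: "a \<in> carrier L \<Longrightarrow> b \<in> carrier L \<Longrightarrow> erep (a \<squnion> b) = erep a \<union> erep b"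
  using R.e_join[of a b] by (simp add: alg_ops)

lemma erep_bot: "erep \<bottom> = {}"
  using R.e_bot by (simp add: alg_ops)

lemma erep_finite_sup:
  assumes "finite S" "S \<subseteq> carrier L"
  shows "erep (\<Squnion> S) = (\<Union>s\<in>S. erep s)"
proof -
  have "erep (\<Squnion> S) = unit_top closure_of (\<Union>(R.op ` S))"
    using R.e_sup(2)[of S] assms by (simp add: alg_ops)
  also have "\<dots> = (\<Union>s\<in>S. unit_top closure_of (R.op s))"
    using assms by (simp add: closure_of_Union)
  also have "\<dots> = (\<Union>s\<in>S. erep s)" using assms R.closure_op by (intro SUP_cong) auto
  finally show ?thesis .
qed

text \<open>To compute \<open>erep x\<close> it suffices to use a family of cells whose join is \<open>x\<close>.\<close>

lemma erep_eq:
  assumes x: "x \<in> carrier L" and F: "\<And>k n. (k, n) \<in> F \<Longrightarrow> nz k n \<and> cell L \<phi> k n \<sqsubseteq> x"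
    and dense: "\<And>l m. nz l m \<Longrightarrow> cell L \<phi> l m \<sqsubseteq> x \<Longrightarrow>
      \<exists>(k, n)\<in>F. cell L \<phi> l m \<sqinter> cell L \<phi> k n \<noteq> \<bottom>"
  shows "erep x = unit_top closure_of (\<Union>(k, n)\<in>F. cell_op k n)"
proof
  let ?U = "\<Union>(k, n)\<in>F. cell_op k n"
  have "?U \<subseteq> cells_below x" using F cell_op_below by fast
  then show "unit_top closure_of ?U \<subseteq> erep x" unfolding erep_def by (rule closure_of_mono)
  have "cells_below x \<subseteq> unit_top closure_of ?U"
  proof
    fix s assume "s \<in> cells_below x"
    then obtain k n where kn: "nz k n" "cell L \<phi> k n \<sqsubseteq> x" "s \<in> cell_op k n"
      unfolding cells_below_def by blast
    have "cell_op k n \<subseteq> unit_top closure_of ?U"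
    proof (rule ccontr)
      assume "\<not> cell_op k n \<subseteq> unit_top closure_of ?U"
      then have "cell_op k n - unit_top closure_of ?U \<noteq> {}" by blast
      moreover have "openin unit_top (cell_op k n - unit_top closure_of ?U)"
        by (intro openin_diff cell_op_open) simp
      ultimately obtain l m where m: "is_tuple l m" "cell_op l m \<subseteq> cell_op k n - unit_top closure_of ?U"
        using open_unit_contains_cell by blast
      then have zm: "nz l m" by (simp add: is_tuple_iff)
      have "cell_op l m \<subseteq> cells_below x" using m cell_op_below[OF kn(1,2)] by blast
      then have "cell L \<phi> l m \<sqsubseteq> x"
        using cell_le_if_cell_op_subset[OF x zm] cells_below_subset[of x] by blast
      then obtain j p where p: "(j, p) \<in> F" "cell L \<phi> l m \<sqinter> cell L \<phi> j p \<noteq> \<bottom>"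
        using dense zm by blast
      then have "cell_op l m \<inter> cell_op j p \<noteq> {}" using meet_bot_iff[OF zm, of j p] F by blast
      moreover have "?U \<subseteq> topspace unit_top" using openin_subset[OF cell_op_open] by fast
      then have "cell_op j p \<subseteq> unit_top closure_of ?U" using closure_of_subset p(1) by blast
      ultimately show False using m(2) by blast
    qed
    then show "s \<in> unit_top closure_of ?U" using kn by blast
  qed
  then show "erep x \<subseteq> unit_top closure_of ?U"
    unfolding erep_def by (rule closure_of_minimal) simp
qed

lemma erep_cell:
  assumes n: "nz k n" shows "erep (cell L \<phi> k n) = cell_cl k n"
proof -
  have "erep (cell L \<phi> k n) = unit_top closure_of (\<Union>(k, n)\<in>{(k, n)}. cell_op k n)"
  proof (rule erep_eq)
    fix l m assume m: "nz l m" "cell L \<phi> l m \<sqsubseteq> cell L \<phi> k n"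
    obtain u where u: "ultra L u" "cell L \<phi> l m \<in> u" using ex_ultra_cell[OF m(1)] by blast
    then have "cell L \<phi> k n \<in> u" using m n by (simp add: L.le_iff_stone)
    then show "\<exists>(k, n)\<in>{(k, n)}. cell L \<phi> l m \<sqinter> cell L \<phi> k n \<noteq> \<bottom>"
      using meet_nonbot[OF u(1,2)] m n by simp
  qed (use n in auto)
  then show ?thesis by (simp add: closure_cell_op)
qed

lemma erep_cell_meet:
  assumes n: "nz k n" and S: "S \<subseteq> Z0"
  shows "erep (cell L \<phi> k n \<sqinter> \<phi> (Suc k) S) = unit_top closure_of (\<Union>p\<in>S. cell_op (Suc k) (n(Suc k := p)))"
proof -
  let ?x = "cell L \<phi> k n \<sqinter> \<phi> (Suc k) S"
  let ?F = "(\<lambda>p. (Suc k, n(Suc k := p))) ` S"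
  have z: "nz (Suc k) (n(Suc k := p))" if "p \<in> S" for p
    using n S that by (auto simp: nz_def Z0_def)
  have x: "?x \<in> carrier L" using n S by simp
  have "erep ?x = unit_top closure_of (\<Union>(k, n)\<in>?F. cell_op k n)"
  proof (rule erep_eq[OF x])
    fix k' n' assume "(k', n') \<in> ?F"
    then obtain p where p: "p \<in> S" "k' = Suc k" "n' = n(Suc k := p)" by auto
    have "?x \<in> u" if u: "ultra L u" "cell L \<phi> (Suc k) (n(Suc k := p)) \<in> u" for u
    proof -
      have a: "\<forall>i\<in>{1..Suc k}. \<phi> i {(n(Suc k := p)) i} \<in> u" using u cell_ultra z[OF p(1)] by blast
      have "\<forall>i\<in>{1..k}. \<phi> i {n i} \<in> u"
      proof
        fix i assume "i \<in> {1..k}"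
        then show "\<phi> i {n i} \<in> u" using bspec[OF a, of i] by simp
      qed
      then have "cell L \<phi> k n \<in> u" using cell_ultra[OF u(1) n] by blast
      moreover have "\<phi> (Suc k) {p} \<in> u" using bspec[OF a, of "Suc k"] by simp
      then have "\<phi> (Suc k) S \<in> u" using phi_ultra(5)[OF u(1), of "Suc k" "{p}" S] p S by simp
      ultimately show ?thesis using L.ultraD(4)[OF u(1)] n S by simp
    qed
    then show "nz k' n' \<and> cell L \<phi> k' n' \<sqsubseteq> ?x"
      using p z x by (simp add: L.le_iff_stone)
  next
    fix l m assume m: "nz l m" "cell L \<phi> l m \<sqsubseteq> ?x"
    \<comment> \<open>The code is prolonged by the arbitrary value \<open>1\<close> to depth at
      least \<open>Suc k\<close>, so that an ultrafilter through the longer cell has a definite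
      coordinate at \<open>Suc k\<close>.\<close>
    let ?m = "\<lambda>i. if i \<le> l then m i else 1"
    let ?l = "max l (Suc k)"
    have zm: "nz ?l ?m" using m by (auto simp: nz_def)
    obtain u where u: "ultra L u" "cell L \<phi> ?l ?m \<in> u" using ex_ultra_cell[OF zm] by blast
    have ph: "\<phi> i {?m i} \<in> u" if "i \<in> {1..?l}" for i using u cell_ultra zm that by blast
    have "\<forall>i\<in>{1..l}. \<phi> i {m i} \<in> u"
    proof
      fix i assume "i \<in> {1..l}" then show "\<phi> i {m i} \<in> u" using ph[of i] by (simp add: max_def split: if_splits)
    qed
    then have lm: "cell L \<phi> l m \<in> u" using cell_ultra[OF u(1) m(1)] by blast
    then have "?x \<in> u" using m x u by (simp add: L.le_iff_stone)
    then have kn: "cell L \<phi> k n \<in> u" "\<phi> (Suc k) S \<in> u" using L.ultraD(4)[OF u(1)] n S by auto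
    define p where "p = ?m (Suc k)"
    have p: "\<phi> (Suc k) {p} \<in> u" "p \<noteq> 0" using ph[of "Suc k"] zm by (auto simp: p_def nz_def)
    then have pS: "p \<in> S" using phi_singletons[OF u(1) _ p(2,1) S] kn by simp
    have "cell L \<phi> (Suc k) (n(Suc k := p)) \<in> u"
      using kn(1) p(1) cell_ultra[OF u(1) n] cell_ultra[OF u(1) z[OF pS]] by (auto simp: le_Suc_eq)
    then have "cell L \<phi> l m \<sqinter> cell L \<phi> (Suc k) (n(Suc k := p)) \<noteq> \<bottom>"
      using meet_nonbot[OF u(1) lm] m z[OF pS] by simp
    then show "\<exists>(k, n)\<in>?F. cell L \<phi> l m \<sqinter> cell L \<phi> k n \<noteq> \<bottom>" using pS by auto
  qed
  then show ?thesis by (simp add: image_image)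
qed

end

section \<open>The intervals that realise the generators\<close>

lemma pt_locate:
  assumes "lo k n < y" "y < hi k n"
  shows "\<exists>m. pt k n m \<le> y \<and> y < pt k n (m + 1)"
proof -
  let ?s = "(y - lo k n) / wid k n"
  have "0 < ?s" "?s < 1" using assms wid_pos[of k n] by (auto simp: hi_def)
  then obtain m where m: "tick m \<le> ?s" "?s < tick (m + 1)" using tick_locate by blast
  then show ?thesis
    using wid_pos[of k n] by (intro exI[of _ m]) (simp add: pt_def field_simps)
qed

lemma cell_child: "lo (Suc k) (n(Suc k := p)) = pt k n (idx p)" "hi (Suc k) (n(Suc k := p)) = pt k n (idx p + 1)"
  unfolding lo_Suc hi_Suc using pt_cong[OF agree_upd[of k n p]] by simp_all

text \<open>The closed children cover the open interval from \<open>a\<close> to \<open>b\<close>,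
  and the closure supplies its ends, one of which may be only a limit of cut points.\<close>

lemma closure_children:
  assumes ab: "0 \<le> a" "a < b" "b \<le> 1"
    and le: "\<And>p. p \<in> S \<Longrightarrow> a \<le> pt k n (idx p) \<and> pt k n (idx p + 1) \<le> b"
    and ex: "\<And>y. a < y \<Longrightarrow> y < b \<Longrightarrow> \<exists>p\<in>S. pt k n (idx p) \<le> y \<and> y \<le> pt k n (idx p + 1)"
  shows "unit_top closure_of (\<Union>p\<in>S. cell_op (Suc k) (n(Suc k := p))) = {a..b}"
proof
  let ?U = "\<Union>p\<in>S. cell_op (Suc k) (n(Suc k := p))"
  have "?U \<subseteq> {a..b}" 
  proof
    fix y assume "y \<in> ?U"
    then obtain p where "p \<in> S" "y \<in> cell_op (Suc k) (n(Suc k := p))" by blast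
    then show "y \<in> {a..b}" using le[of p] by (simp add: cell_op_def cell_child del: lo.simps)
  qed
  moreover have cl: "closedin unit_top {a..b}" using ab by (intro closed_subset) auto
  ultimately show "unit_top closure_of ?U \<subseteq> {a..b}" by (rule closure_of_minimal)
  have "{a<..<b} \<subseteq> unit_top closure_of ?U"
  proof
    fix y assume "y \<in> {a<..<b}"
    then obtain p where p: "p \<in> S" "pt k n (idx p) \<le> y" "y \<le> pt k n (idx p + 1)" using ex by auto
    then have "y \<in> unit_top closure_of (cell_op (Suc k) (n(Suc k := p)))"
      by (simp add: closure_cell_op cell_cl_def cell_child del: lo.simps)
    moreover have "cell_op (Suc k) (n(Suc k := p)) \<subseteq> ?U" using p by blast
    ultimately show "y \<in> unit_top closure_of ?U" using closure_of_mono by blast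
  qed
  then have "unit_top closure_of {a<..<b} \<subseteq> unit_top closure_of ?U"
    by (rule closure_of_minimal) simp
  then show "{a..b} \<subseteq> unit_top closure_of ?U" using unit_closure_open_interval[OF ab] by simp
qed

lemma lo_hi_unit: "0 \<le> lo k n" "hi k n \<le> 1"
  using cell_unit(1)[of k n] lo_less_hi[of k n] by (auto simp: cell_cl_def)

context completed_sum
begin

lemma erep_right:
  assumes n: "nz k n" and r: "r \<ge> 1"
  shows "erep (cell L \<phi> k n \<sqinter> \<phi> (Suc k) (succs (int r))) = {pt k n (int r)..hi k n}"
proof -
  have S: "succs (int r) \<subseteq> Z0" by (auto simp: succs_def)
  show ?thesis
    unfolding erep_cell_meet[OF n S]
  proof (rule closure_children)
    show "0 \<le> pt k n (int r)" "pt k n (int r) < hi k n" "hi k n \<le> 1"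
      using lo_hi_unit[of k n] pt_bounds[of k n "int r"] by auto
    fix p assume "p \<in> succs (int r)"
    then show "pt k n (int r) \<le> pt k n (idx p) \<and> pt k n (idx p + 1) \<le> hi k n"
      using r pt_bounds(2)[of k n "idx p + 1"] by (auto simp: pt_le_iff succs_def idx_def)
  next
    fix y assume y: "pt k n (int r) < y" "y < hi k n"
    then obtain m where m: "pt k n m \<le> y" "y < pt k n (m + 1)"
      using pt_locate[of k n y] pt_bounds(1)[of k n "int r"] by auto
    then have "int r < m + 1" using y pt_less_iff[of k n "int r" "m + 1"] by linarith
    \<comment> \<open>For nonnegative \<open>m\<close> the child between the cut points
      \<open>m\<close> and \<open>m + 1\<close> has the code \<open>m + 1\<close>, because the codes
      skip \<open>0\<close>.\<close>
    then show "\<exists>p\<in>succs (int r). pt k n (idx p) \<le> y \<and> y \<le> pt k n (idx p + 1)"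
      using m r by (intro bexI[of _ "m + 1"]) (auto simp: idx_def succs_def Z0_def)
  qed
qed

lemma erep_left:
  assumes n: "nz k n" and r: "r \<ge> 1"
  shows "erep (cell L \<phi> k n \<sqinter> \<phi> (Suc k) (preds (- int r))) = {lo k n..pt k n (- int r)}"
proof -
  have S: "preds (- int r) \<subseteq> Z0" by (auto simp: preds_def)
  show ?thesis
    unfolding erep_cell_meet[OF n S]
  proof (rule closure_children)
    show "0 \<le> lo k n" "lo k n < pt k n (- int r)" "pt k n (- int r) \<le> 1"
      using lo_hi_unit[of k n] pt_bounds[of k n "- int r"] by auto
    fix p assume "p \<in> preds (- int r)"
    then show "lo k n \<le> pt k n (idx p) \<and> pt k n (idx p + 1) \<le> pt k n (- int r)"
      using r pt_bounds(1)[of k n "idx p"] by (auto simp: pt_le_iff preds_def idx_def)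
  next
    fix y assume y: "lo k n < y" "y < pt k n (- int r)"
    then obtain m where m: "pt k n m \<le> y" "y < pt k n (m + 1)"
      using pt_locate[of k n y] pt_bounds(2)[of k n "- int r"] by auto
    then have "m < - int r" using y pt_less_iff[of k n m "- int r"] by linarith
    then show "\<exists>p\<in>preds (- int r). pt k n (idx p) \<le> y \<and> y \<le> pt k n (idx p + 1)"
      using m r by (intro bexI[of _ m]) (auto simp: idx_def preds_def Z0_def)
  qed
qed

lemma nz_prd: "is_tuple k n \<Longrightarrow> nz k (n(k := prd (n k)))"
  using prd_nonzero by (auto simp: is_tuple_iff nz_def)

lemma ray_closed: "succs m \<subseteq> Z0" "preds m \<subseteq> Z0"
  by (auto simp: succs_def preds_def)

lemma qelem_closed: "is_tuple k n \<Longrightarrow> qelem L \<phi> k n r \<in> carrier L"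
  using nz_prd[of k n] ray_closed by (simp add: qelem_def is_tuple_iff)

lemma erep_qelem:
  assumes t: "is_tuple k n" and r: "r \<ge> 1"
  shows "erep (qelem L \<phi> k n r) = qset k n r"
proof -
  obtain j where k: "k = Suc j" using t by (cases k) (auto simp: is_tuple_iff)
  let ?m = "n(k := prd (n k))"
  have z: "nz k n" "nz k ?m" "n k \<noteq> 0" using t nz_prd[of k n] by (auto simp: is_tuple_iff nz_def)
  have "erep (qelem L \<phi> k n r) = {pt k ?m (int r)..hi k ?m} \<union> {lo k n..pt k n (- int r)}"
    unfolding qelem_def using z r ray_closed
    by (simp add: erep_join erep_right erep_left)
  also have "\<dots> = qset k n r"
    using hi_prd[of n j] z k pt_bounds[of k n "- int r"] pt_bounds[of k ?m "int r"]
    by (auto simp: qset_def qlo_def qhi_def simp del: lo.simps)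
  finally show ?thesis .
qed

lemma erep_rays:
  assumes r: "r \<ge> 1"
  shows "erep (\<phi> 1 (succs (int r))) = {tick (int r)..1}" "erep (\<phi> 1 (preds (- int r))) = {0..tick (- int r)}"
proof -
  have z: "nz 0 n" for n by (simp add: nz_def)
  have t: "cell L \<phi> 0 n \<sqinter> x = x" if "x \<in> carrier L" for n x
    using L.meet_top[OF that] by (simp add: cell_0 meet_comm[of L])
  have p: "pt 0 n m = tick m" "lo 0 n = 0" "hi 0 n = 1" for n m by (simp_all add: pt_def hi_def)
  show "erep (\<phi> 1 (succs (int r))) = {tick (int r)..1}" "erep (\<phi> 1 (preds (- int r))) = {0..tick (- int r)}"
    using erep_right[OF z r] erep_left[OF z r] t[of "\<phi> 1 (succs (int r))"] t[of "\<phi> 1 (preds (- int r))"] ray_closed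
    by (simp_all add: p)
qed

section \<open>Contact of the generators and separation by finite covers\<close>

abbreviation "G01 \<equiv> B0 L \<phi> \<union> B1 L \<phi>"
abbreviation "G \<equiv> G01 \<union> B2 \<phi>"

lemma G01_carrier: "G01 \<subseteq> carrier L"
  using qelem_closed by (auto simp: B0_def B1_def is_tuple_iff)

lemma G_carrier: "G \<subseteq> carrier L"
  using G01_carrier ray_closed by (auto simp: B2_def)

lemma cell_cl_inside: "is_tuple k n \<Longrightarrow> cell_cl k n \<subseteq> {0<..<1}"
  using cell_cl_subset_op[of 0 k n] cell_unit(2)[of 0 n] by (auto simp: is_tuple_iff)

lemma qset_inside:
  assumes "is_tuple k n" "r \<ge> 1"
  shows "qset k n r \<subseteq> {0<..<1}"
proof -
  obtain j where k: "k = Suc j" using assms by (cases k) (auto simp: is_tuple_iff)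
  then show ?thesis
    using qset_subset[of n j r] cell_unit(2)[of j n] assms by (auto simp: is_tuple_iff nz_Suc)
qed

lemma q_less: "is_tuple k n \<Longrightarrow> r \<ge> 1 \<Longrightarrow> qlo k n r < qhi k n r"
  using q_nonempty[of n "k - 1" r] by (cases k) (auto simp: is_tuple_iff nz_Suc)

lemma G01_inside:
  assumes "g \<in> G01"
  shows "erep g \<subseteq> {0<..<1}"
proof -
  from assms consider k n where "is_tuple k n" "g = cell L \<phi> k n"
    | k n r where "is_tuple k n" "r \<ge> 1" "g = qelem L \<phi> k n r"
    unfolding B0_def B1_def by blast
  then show ?thesis
  proof cases
    case (1 k n)
    then show ?thesis using cell_cl_inside[of k n] erep_cell[of k n] by (simp add: is_tuple_iff)
  next
    case (2 k n r)
    then show ?thesis using qset_inside[of k n r] erep_qelem[of k n r] by simp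
  qed
qed

lemma G_interval:
  assumes "g \<in> G"
  shows "\<exists>a b. erep g = {a..b} \<and> 0 \<le> a \<and> a < b \<and> b \<le> 1"
proof -
  from assms consider k n where "is_tuple k n" "g = cell L \<phi> k n"
    | k n r where "is_tuple k n" "r \<ge> 1" "g = qelem L \<phi> k n r"
    | r where "r \<ge> 1" "g = \<phi> 1 (succs (int r))" | r where "r \<ge> 1" "g = \<phi> 1 (preds (- int r))"
    unfolding B0_def B1_def B2_def by blast
  then show ?thesis
  proof cases
    case (1 k n)
    then show ?thesis
      using lo_less_hi[of k n] lo_hi_unit[of k n]
      by (intro exI[of _ "lo k n"] exI[of _ "hi k n"]) (simp add: erep_cell is_tuple_iff cell_cl_def)
  next
    case (2 k n r)
    then have q: "qlo k n r < qhi k n r" "qset k n r \<subseteq> {0<..<1}" using q_less qset_inside by auto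
    then have "qlo k n r \<in> {0<..<1}" "qhi k n r \<in> {0<..<1}"
      unfolding qset_def by (simp_all add: subset_iff)
    then show ?thesis
      using 2 q(1) by (intro exI[of _ "qlo k n r"] exI[of _ "qhi k n r"]) (auto simp: erep_qelem qset_def)
  next
    case (3 r)
    then show ?thesis
      using tick_bounds[of "int r"] erep_rays(1)[of r]
      by (intro exI[of _ "tick (int r)"] exI[of _ 1]) simp
  next
    case (4 r)
    then show ?thesis
      using tick_bounds[of "- int r"] erep_rays(2)[of r]
      by (intro exI[of _ 0] exI[of _ "tick (- int r)"]) simp
  qed
qed

text \<open>\<open>erep\<close> depends on the element and not on its code, so the rules cannot lead
  to different answers for different codes of one element. The three lemmas on meeting intervals
  then match the rules one by one, up to symmetry.\<close>

lemma sigma_base_iff: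
  assumes x: "x \<in> G01" and y: "y \<in> G01"
  shows "sigma_base L \<phi> x y \<longleftrightarrow> erep x \<inter> erep y \<noteq> {}"
proof
  assume "sigma_base L \<phi> x y"
  then show "erep x \<inter> erep y \<noteq> {}"
  proof induction
    case (bb k n l n')
    then show ?case using meets_cell_cell[of k n l n'] by (simp add: erep_cell is_tuple_iff)
  next
    case (qq k n l n' r r')
    then show ?case using meets_q_q[of k n l n' r r'] by (simp add: erep_qelem)
  next
    case (qb k n l n' r)
    then show ?case using meets_q_cell[of k n l n' r] by (simp add: erep_qelem erep_cell is_tuple_iff)
  next
    case (sym x y)
    then show ?case by (simp add: Int_commute)
  qed
next
  assume m: "erep x \<inter> erep y \<noteq> {}"
  from x consider (b) k n where "is_tuple k n" "x = cell L \<phi> k n"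
    | (q) k n r where "is_tuple k n" "r \<ge> 1" "x = qelem L \<phi> k n r" unfolding B0_def B1_def by blast
  note xc = this
  from y consider (b) l n' where "is_tuple l n'" "y = cell L \<phi> l n'"
    | (q) l n' r' where "is_tuple l n'" "r' \<ge> 1" "y = qelem L \<phi> l n' r'" unfolding B0_def B1_def by blast
  note yc = this
  have bb: "sigma_base L \<phi> (cell L \<phi> k n) (cell L \<phi> l n')"
    if "is_tuple k n" "is_tuple l n'" "cell_cl k n \<inter> cell_cl l n' \<noteq> {}" for k n l n'
  proof (cases "k \<le> l")
    case True then show ?thesis using meets_cell_cell that sigma_base.bb by blast
  next
    case False
    then have "l \<le> k" by simp
    then have "sigma_base L \<phi> (cell L \<phi> l n') (cell L \<phi> k n)"
      using meets_cell_cell[of l n' k n] that sigma_base.bb by blast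
    then show ?thesis by (rule sigma_base.sym)
  qed
  have qq: "sigma_base L \<phi> (qelem L \<phi> k n r) (qelem L \<phi> l n' r')"
    if "is_tuple k n" "is_tuple l n'" "r \<ge> 1" "r' \<ge> 1" "qset k n r \<inter> qset l n' r' \<noteq> {}" for k n l n' r r'
  proof (cases "k \<le> l")
    case True then show ?thesis using meets_q_q[of k n l n' r r'] that sigma_base.qq by blast
  next
    case False
    then have "l \<le> k" by simp
    then have "sigma_base L \<phi> (qelem L \<phi> l n' r') (qelem L \<phi> k n r)"
      using meets_q_q[of l n' k n r' r] that sigma_base.qq by blast
    then show ?thesis by (rule sigma_base.sym)
  qed
  have qb: "sigma_base L \<phi> (qelem L \<phi> k n r) (cell L \<phi> l n')"
    if "is_tuple k n" "is_tuple l n'" "r \<ge> 1" "qset k n r \<inter> cell_cl l n' \<noteq> {}" for k n l n' r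
    using meets_q_cell[of k n l n' r] that sigma_base.qb by blast
  show "sigma_base L \<phi> x y"
  proof (cases rule: xc)
    case xb: (b k n)
    show ?thesis
    proof (cases rule: yc)
      case yb: (b l n')
      show ?thesis using bb xb yb m by (simp add: erep_cell is_tuple_iff)
    next
      case yq: (q l n' r')
      have "sigma_base L \<phi> y x" using qb xb yq m by (simp add: erep_cell erep_qelem is_tuple_iff Int_commute)
      then show ?thesis by (rule sigma_base.sym)
    qed
  next
    case xq: (q k n r)
    show ?thesis
    proof (cases rule: yc)
      case yb: (b l n')
      show ?thesis using qb xq yb m by (simp add: erep_cell erep_qelem is_tuple_iff)
    next
      case yq: (q l n' r')
      show ?thesis using qq xq yq m by (simp add: erep_qelem)
    qed
  qed
qed

text \<open>The images of \<open>H\<close> contain a neighbourhood base at \<open>p\<close>,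
  relative to the unit interval. The covering arguments use the generators only through this
  property.\<close>

definition small_at :: "'a set \<Rightarrow> real \<Rightarrow> bool" where
  "small_at H p \<longleftrightarrow> (\<forall>\<epsilon>>0. \<exists>h\<in>H. \<exists>V. open V \<and> p \<in> V \<and> {0..1} \<inter> V \<subseteq> erep h \<and> erep h \<subseteq> ball p \<epsilon>)"

lemma small_at_G01:
  assumes "0 < p" "p < 1"
  shows "small_at G01 p"
  unfolding small_at_def
proof (intro allI impI)
  fix \<epsilon> :: real assume e: "\<epsilon> > 0"
  from small_neighbourhood[OF assms e] consider
    k n where "is_tuple k n" "p \<in> cell_op k n" "hi k n - lo k n < \<epsilon>"
    | k n r where "is_tuple k n" "r \<ge> 1" "qlo k n r < p" "p < qhi k n r" "qhi k n r - qlo k n r < \<epsilon>"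
    by blast
  then show "\<exists>h\<in>G01. \<exists>V. open V \<and> p \<in> V \<and> {0..1} \<inter> V \<subseteq> erep h \<and> erep h \<subseteq> ball p \<epsilon>"
  proof cases
    case (1 k n)
    have "cell L \<phi> k n \<in> G01" using 1 by (auto simp: B0_def)
    moreover have "cell_cl k n \<subseteq> ball p \<epsilon>"
      unfolding cell_cl_def using 1 by (intro interval_in_ball) (auto simp: cell_op_def)
    moreover have "erep (cell L \<phi> k n) = cell_cl k n" using 1 erep_cell by (simp add: is_tuple_iff)
    moreover have "open {lo k n<..<hi k n}" "p \<in> {lo k n<..<hi k n}" using 1 by (auto simp: cell_op_def)
    moreover have "{0..1} \<inter> {lo k n<..<hi k n} \<subseteq> cell_cl k n" by (auto simp: cell_cl_def)
    ultimately show ?thesis by metis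
  next
    case (2 k n r)
    have "qelem L \<phi> k n r \<in> G01" using 2 by (auto simp: B1_def)
    moreover have "qset k n r \<subseteq> ball p \<epsilon>"
      unfolding qset_def using 2 by (intro interval_in_ball) auto
    moreover have "erep (qelem L \<phi> k n r) = qset k n r" using 2 erep_qelem by simp
    moreover have "open {qlo k n r<..<qhi k n r}" "p \<in> {qlo k n r<..<qhi k n r}" using 2 by auto
    moreover have "{0..1} \<inter> {qlo k n r<..<qhi k n r} \<subseteq> qset k n r" by (auto simp: qset_def)
    ultimately show ?thesis by metis
  qed
qed

lemma small_at_G:
  assumes "p \<in> {0..1}"
  shows "small_at G p"
proof -
  consider "0 < p" "p < 1" | "p = 0" | "p = 1" using assms by force
  then show ?thesis
  proof cases
    case 1 then show ?thesis using small_at_G01[OF 1] unfolding small_at_def by (meson UnI1)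
  next
    case 2
    show ?thesis
      unfolding small_at_def
    proof (intro allI impI)
      fix \<epsilon> :: real assume "\<epsilon> > 0"
      then obtain r where r: "r \<ge> 1" "tick (- int r) < \<epsilon>" using tick_limits by blast
      have "\<phi> 1 (preds (- int r)) \<in> G" using r by (auto simp: B2_def)
      moreover have "open {..<tick (- int r)}" "p \<in> {..<tick (- int r)}"
        "{0..1} \<inter> {..<tick (- int r)} \<subseteq> {0..tick (- int r)}" "{0..tick (- int r)} \<subseteq> ball p \<epsilon>"
        using 2 r tick_bounds[of "- int r"] by (auto simp: dist_real_def)
      ultimately show "\<exists>h\<in>G. \<exists>V. open V \<and> p \<in> V \<and> {0..1} \<inter> V \<subseteq> erep h \<and> erep h \<subseteq> ball p \<epsilon>"
        using erep_rays(2)[OF r(1)] by metis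
    qed
  next
    case 3
    show ?thesis
      unfolding small_at_def
    proof (intro allI impI)
      fix \<epsilon> :: real assume "\<epsilon> > 0"
      then obtain r where r: "r \<ge> 1" "1 - tick (int r) < \<epsilon>" using tick_limits by blast
      have "\<phi> 1 (succs (int r)) \<in> G" using r by (auto simp: B2_def)
      moreover have "open {tick (int r)<..}" "p \<in> {tick (int r)<..}"
        "{0..1} \<inter> {tick (int r)<..} \<subseteq> {tick (int r)..1}" "{tick (int r)..1} \<subseteq> ball p \<epsilon>"
        using 3 r tick_bounds[of "int r"] by (auto simp: dist_real_def)
      ultimately show "\<exists>h\<in>G. \<exists>V. open V \<and> p \<in> V \<and> {0..1} \<inter> V \<subseteq> erep h \<and> erep h \<subseteq> ball p \<epsilon>"
        using erep_rays(1)[OF r(1)] by metis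
    qed
  qed
qed

text \<open>Compactness picks finitely many of the neighbourhoods. Each chosen image remains close
  to some point of \<open>K\<close>, which gives the metric control needed for separation.\<close>

lemma small_at_cover:
  assumes K: "compact K" "K \<subseteq> {0..1}" "K \<noteq> {}" and f: "\<And>p. p \<in> K \<Longrightarrow> small_at H p" and d: "d > 0"
  shows "\<exists>S. finite S \<and> S \<noteq> {} \<and> S \<subseteq> H \<and> K \<subseteq> (\<Union>s\<in>S. erep s) \<and> (\<forall>s\<in>S. \<exists>p\<in>K. erep s \<subseteq> ball p d)"
proof -
  have "\<forall>p\<in>K. \<exists>h V. h \<in> H \<and> open V \<and> p \<in> V \<and> {0..1} \<inter> V \<subseteq> erep h \<and> erep h \<subseteq> ball p d"
    using f d unfolding small_at_def by meson
  then obtain h V where hV: "\<And>p. p \<in> K \<Longrightarrow> h p \<in> H \<and> open (V p) \<and> p \<in> V p \<and> {0..1} \<inter> V p \<subseteq> erep (h p) \<and> erep (h p) \<subseteq> ball p d"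
    by metis
  obtain D where D: "D \<subseteq> K" "finite D" "K \<subseteq> (\<Union>p\<in>D. V p)"
    using compactE_image[OF K(1), of K V] hV by blast
  have "D \<noteq> {}" using D K by auto
  moreover have "K \<subseteq> (\<Union>s\<in>h ` D. erep s)"
  proof
    fix x assume x: "x \<in> K"
    then obtain p where "p \<in> D" "x \<in> V p" using D by blast
    then show "x \<in> (\<Union>s\<in>h ` D. erep s)" using hV[of p] D x K(2) by blast
  qed
  ultimately show ?thesis using D hV by (intro exI[of _ "h ` D"]) blast
qed

text \<open>Disjoint compact sets have a positive distance \<open>d\<close>; pieces within
  \<open>d/2\<close> of the one and of the other cannot meet.\<close>

lemma separated_cover:
  assumes K: "compact K" "K \<subseteq> {0..1}" "K \<noteq> {}" and K': "compact K'" "K' \<subseteq> {0..1}" "K' \<noteq> {}"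
    and f: "\<And>p. p \<in> K \<union> K' \<Longrightarrow> small_at H p" and dj: "K \<inter> K' = {}"
  shows "\<exists>S T. finite S \<and> finite T \<and> S \<noteq> {} \<and> T \<noteq> {} \<and> S \<subseteq> H \<and> T \<subseteq> H \<and>
    K \<subseteq> (\<Union>s\<in>S. erep s) \<and> K' \<subseteq> (\<Union>s\<in>T. erep s) \<and> (\<forall>x\<in>S. \<forall>y\<in>T. erep x \<inter> erep y = {})"
proof -
  obtain d where d: "d > 0" "\<And>x y. x \<in> K \<Longrightarrow> y \<in> K' \<Longrightarrow> d \<le> dist x y"
    using separate_compact_closed[OF K(1) compact_imp_closed[OF K'(1)] dj] by blast
  obtain S where S: "finite S" "S \<noteq> {}" "S \<subseteq> H" "K \<subseteq> (\<Union>s\<in>S. erep s)" "\<forall>s\<in>S. \<exists>p\<in>K. erep s \<subseteq> ball p (d/2)"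
    using small_at_cover[OF K, of H "d/2"] f d by auto
  obtain T where T: "finite T" "T \<noteq> {}" "T \<subseteq> H" "K' \<subseteq> (\<Union>s\<in>T. erep s)" "\<forall>s\<in>T. \<exists>p\<in>K'. erep s \<subseteq> ball p (d/2)"
    using small_at_cover[OF K', of H "d/2"] f d by auto
  have "erep x \<inter> erep y = {}" if xy: "x \<in> S" "y \<in> T" for x y
  proof (rule ccontr)
    assume "erep x \<inter> erep y \<noteq> {}"
    then obtain z where z: "z \<in> erep x" "z \<in> erep y" by blast
    obtain p where p: "p \<in> K" "erep x \<subseteq> ball p (d/2)" using S(5) xy by blast
    obtain q where q: "q \<in> K'" "erep y \<subseteq> ball q (d/2)" using T(5) xy by blast
    have "dist p z < d/2" "dist q z < d/2" using z p q by auto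
    then have "dist p q < d" using dist_triangle_half_r[of z p d q] by (simp add: dist_commute)
    then show False using d(2)[OF p(1) q(1)] by simp
  qed
  then show ?thesis using S T by blast
qed

lemma erep_compact: "compact (erep a)" and erep_unit: "erep a \<subseteq> {0..1}"
proof -
  show "compact (erep a)" using closedin_compact[OF _ erep_closed[of a]] by simp
  show "erep a \<subseteq> {0..1}" using closedin_subset[OF erep_closed[of a]] by simp
qed

text \<open>The compact sets \<open>K\<close> and \<open>K'\<close> enlarge the images of
  \<open>c\<close> and \<open>d\<close> where necessary: \<open>separated\<close> asks for nonempty
  families, whereas the image of \<bottom> is empty.\<close>

lemma separated_iff:
  assumes H: "H \<subseteq> carrier L" and c: "c \<in> carrier L" "d \<in> carrier L"
    and R: "\<And>x y. x \<in> H \<Longrightarrow> y \<in> H \<Longrightarrow> R x y \<longleftrightarrow> erep x \<inter> erep y \<noteq> {}"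
    and K: "compact K" "K \<subseteq> {0..1}" "K \<noteq> {}" "erep c \<subseteq> K" and K': "compact K'" "K' \<subseteq> {0..1}" "K' \<noteq> {}" "erep d \<subseteq> K'"
    and f: "\<And>p. p \<in> K \<union> K' \<Longrightarrow> small_at H p" and KK: "erep c \<inter> erep d = {} \<Longrightarrow> K \<inter> K' = {}"
  shows "separated L H R c d \<longleftrightarrow> erep c \<inter> erep d = {}"
proof
  assume "separated L H R c d"
  then obtain S T where ST: "finite S" "finite T" "S \<subseteq> H" "T \<subseteq> H" "c \<sqsubseteq> \<Squnion> S" "d \<sqsubseteq> \<Squnion> T"
    "\<forall>x\<in>S. \<forall>y\<in>T. \<not> R x y"
    unfolding separated_def by blast
  have cl: "S \<subseteq> carrier L" "T \<subseteq> carrier L" using ST H by auto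
  have "erep c \<subseteq> (\<Union>s\<in>S. erep s)" "erep d \<subseteq> (\<Union>s\<in>T. erep s)"
    using erep_mono[OF c(1) _ ST(5)] erep_mono[OF c(2) _ ST(6)] cl ST(1,2)
    by (simp_all add: erep_finite_sup)
  moreover have "erep x \<inter> erep y = {}" if "x \<in> S" "y \<in> T" for x y using R[of x y] ST that by blast
  ultimately show "erep c \<inter> erep d = {}" by blast
next
  assume dj: "erep c \<inter> erep d = {}"
  obtain S T where ST: "finite S" "finite T" "S \<noteq> {}" "T \<noteq> {}" "S \<subseteq> H" "T \<subseteq> H"
    "K \<subseteq> (\<Union>s\<in>S. erep s)" "K' \<subseteq> (\<Union>s\<in>T. erep s)" "\<forall>x\<in>S. \<forall>y\<in>T. erep x \<inter> erep y = {}"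
    using separated_cover[OF K(1-3) K'(1-3) f KK[OF dj]] by auto
  have cl: "S \<subseteq> carrier L" "T \<subseteq> carrier L" using ST H by auto
  have "c \<sqsubseteq> \<Squnion> S" "d \<sqsubseteq> \<Squnion> T"
    using c cl ST(1,2,7,8) K(4) K'(4) by (simp_all add: erep_le_iff erep_finite_sup)
  moreover have "\<not> R x y" if "x \<in> S" "y \<in> T" for x y using R[of x y] ST(5,6,9) that by blast
  ultimately show "separated L H R c d" unfolding separated_def using ST by blast
qed

text \<open>The elements whose images avoid \<open>0\<close> and \<open>1\<close> form an ideal, and
  it contains the generators.\<close>

lemma BB_inside:
  assumes "c \<in> BB L \<phi>"
  shows "c \<in> carrier L" "erep c \<subseteq> {0<..<1}"
proof -
  let ?J = "{c \<in> carrier L. erep c \<subseteq> {0<..<1}}"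
  have "is_ideal L ?J"
    unfolding is_ideal_def
  proof (intro conjI ballI impI)
    fix x y assume "x \<in> ?J" "y \<in> carrier L" "y \<sqsubseteq> x"
    then show "y \<in> ?J" using erep_mono[of y x] by blast
  qed (auto simp: erep_bot erep_join)
  moreover have "G01 \<subseteq> ?J" using G01_carrier G01_inside by blast
  ultimately have "c \<in> ?J" using assms unfolding BB_def ideal_generated_def by blast
  then show "c \<in> carrier L" "erep c \<subseteq> {0<..<1}" by auto
qed

lemma BB_below: "g \<in> G01 \<Longrightarrow> x \<in> carrier L \<Longrightarrow> x \<sqsubseteq> g \<Longrightarrow> x \<in> BB L \<phi>"
  unfolding BB_def ideal_generated_def is_ideal_def by blast

lemma separated_G01_iff:
  assumes c: "c \<in> carrier L" "erep c \<subseteq> {0<..<1}" and d: "d \<in> carrier L" "erep d \<subseteq> {0<..<1}"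
  shows "separated L G01 (sigma_base L \<phi>) c d \<longleftrightarrow> erep c \<inter> erep d = {}"
proof -
  have ex: "\<exists>q. q \<in> {0<..<1} \<and> q \<notin> M" if "compact M" "M \<subseteq> {0<..<1}" for M :: "real set"
  proof (rule ccontr)
    assume "\<not> ?thesis"
    then have "M = {0<..<1}" using that by blast
    then have "closed {0<..<1::real}" using that(1) compact_imp_closed by blast
    then have "closure {0<..<1::real} = {0<..<1}" by (rule closure_closed)
    then show False by auto
  qed
  \<comment> \<open>An empty image is replaced by a point off the other image; one exists because a
    compact set cannot exhaust the open unit interval.\<close>
  define K where "K = (if erep c = {} then {SOME q. q \<in> {0<..<1} \<and> q \<notin> erep d} else erep c)"
  have K: "compact K" "K \<subseteq> {0<..<1}" "K \<noteq> {}" "erep c \<subseteq> K" "erep c \<inter> erep d = {} \<Longrightarrow> K \<inter> erep d = {}"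
    using someI_ex[OF ex[OF erep_compact d(2)]] c(2) erep_compact[of c] by (auto simp: K_def)
  \<comment> \<open>The point avoids \<open>K\<close> rather than \<open>erep c\<close>, so that
    \<open>K\<close> and \<open>K'\<close> stay disjoint even when both images are empty.\<close>
  define K' where "K' = (if erep d = {} then {SOME q. q \<in> {0<..<1} \<and> q \<notin> K} else erep d)"
  have K': "compact K'" "K' \<subseteq> {0<..<1}" "K' \<noteq> {}" "erep d \<subseteq> K'" "erep c \<inter> erep d = {} \<Longrightarrow> K \<inter> K' = {}"
    using someI_ex[OF ex[OF K(1,2)]] d(2) erep_compact[of d] K(5) by (auto simp: K'_def)
  show ?thesis
  proof (rule separated_iff[OF G01_carrier c(1) d(1) sigma_base_iff K(1) _ K(3,4) K'(1) _ K'(3,4) _ K'(5)])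
    show "K \<subseteq> {0..1}" "K' \<subseteq> {0..1}" using K(2) K'(2) by (meson greaterThanLessThan_subseteq_atLeastAtMost_iff order_refl order_trans)+
    fix p assume "p \<in> K \<union> K'"
    then have "p \<in> {0<..<1}" using K(2) K'(2) by blast
    then show "small_at G01 p" using small_at_G01 by simp
  qed
qed

text \<open>Elements of the ideal never reach \<open>0\<close> or \<open>1\<close>, hence the
  restriction to interior points. Conversely, cutting both elements down by a generator that is a
  neighbourhood of a common interior point produces two members of the ideal still in contact
  there.\<close>

lemma sigma_tilde_iff:
  assumes a: "a \<in> carrier L" and b: "b \<in> carrier L"
  shows "sigma_tilde L \<phi> a b \<longleftrightarrow> erep a \<inter> erep b \<inter> {0<..<1} \<noteq> {}"
proof
  assume "sigma_tilde L \<phi> a b"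
  then obtain c d where cd: "c \<in> BB L \<phi>" "d \<in> BB L \<phi>" "c \<sqsubseteq> a" "d \<sqsubseteq> b"
    "\<not> separated L G01 (sigma_base L \<phi>) c d"
    unfolding sigma_tilde_def by blast
  note c = BB_inside[OF cd(1)] and d = BB_inside[OF cd(2)]
  have "erep c \<inter> erep d \<noteq> {}" using separated_G01_iff[OF c d] cd(5) by blast
  then show "erep a \<inter> erep b \<inter> {0<..<1} \<noteq> {}"
    using erep_mono[OF c(1) a cd(3)] erep_mono[OF d(1) b cd(4)] c(2) by blast
next
  assume "erep a \<inter> erep b \<inter> {0<..<1} \<noteq> {}"
  then obtain x where x: "x \<in> erep a" "x \<in> erep b" "0 < x" "x < 1" by auto
  obtain g V where g: "g \<in> G01" "open V" "x \<in> V" "{0..1} \<inter> V \<subseteq> erep g"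
    using small_at_G01[OF x(3,4)] unfolding small_at_def by (meson zero_less_one)
  have gc: "g \<in> carrier L" using g G01_carrier by blast
  \<comment> \<open>Membership in a closure is local: near \<open>x\<close> the set
    \<open>R.op y\<close> may be replaced by its intersection with the neighbourhood
    \<open>V\<close>, which \<open>g\<close> covers inside the unit interval.\<close>
  have xin: "x \<in> erep (y \<sqinter> g)" if y: "y \<in> carrier L" "x \<in> erep y" for y
  proof -
    let ?W = "{0..1} \<inter> V"
    have W: "openin unit_top ?W" using g(2) by (rule unit_open)
    then have "?W \<subseteq> R.op g" unfolding R.op_def using g(4) by (simp add: interior_of_maximal)
    then have "unit_top closure_of (?W \<inter> R.op y) \<subseteq> unit_top closure_of (R.op y \<inter> R.op g)"
      by (intro closure_of_mono) blast
    moreover have "x \<in> ?W \<inter> unit_top closure_of (R.op y)"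
      using x g y R.closure_op[of y] by simp
    then have "x \<in> unit_top closure_of (?W \<inter> R.op y)"
      using openin_Int_closure_of_subset[OF W] by blast
    ultimately show ?thesis using R.e_meet[of y g] y gc by (auto simp: alg_ops)
  qed
  have m: "y \<sqinter> g \<in> BB L \<phi>" if "y \<in> carrier L" for y
    using that gc by (intro BB_below[OF g(1)]) (auto intro: L.meet_right)
  have "\<not> separated L G01 (sigma_base L \<phi>) (a \<sqinter> g) (b \<sqinter> g)"
    using separated_G01_iff[OF BB_inside[OF m[OF a]] BB_inside[OF m[OF b]]] xin[OF a x(1)] xin[OF b x(2)] by blast
  then show "sigma_tilde L \<phi> a b"
    unfolding sigma_tilde_def
    by (intro bexI[OF _ m[OF a]] bexI[OF _ m[OF b]] conjI L.meet_left a b gc)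
qed

text \<open>Losing contact at \<open>0\<close> and \<open>1\<close> does no harm on generators: they
  are nondegenerate closed intervals, so two of them that share \<open>0\<close> or \<open>1\<close>
  also share an interior point.\<close>

lemma sigma_tilde_G:
  assumes "x \<in> G" "y \<in> G"
  shows "sigma_tilde L \<phi> x y \<longleftrightarrow> erep x \<inter> erep y \<noteq> {}"
proof -
  obtain a b where x: "erep x = {a..b}" "0 \<le> a" "a < b" "b \<le> 1" using G_interval[OF assms(1)] by blast
  obtain c d where y: "erep y = {c..d}" "0 \<le> c" "c < d" "d \<le> 1" using G_interval[OF assms(2)] by blast
  have "erep x \<inter> erep y \<inter> {0<..<1} \<noteq> {}" if ne: "erep x \<inter> erep y \<noteq> {}"
  proof -
    have le: "a \<le> d" "c \<le> b" using ne x y by auto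
    consider "max a c > 0" | "max a c = 0" "min b d < 1" | "max a c = 0" "min b d = 1"
      using x y max.cobounded1[of a c] min.cobounded1[of b d] by linarith
    then show ?thesis
    proof cases
      case 1
      then have "max a c \<in> erep x \<inter> erep y \<inter> {0<..<1}" using x y le by auto
      then show ?thesis by blast
    next
      case 2
      then have "min b d \<in> erep x \<inter> erep y \<inter> {0<..<1}" using x y le by auto
      then show ?thesis by blast
    next
      case 3
      then have "1/2 \<in> erep x \<inter> erep y \<inter> {0<..<1}" using x y le by auto
      then show ?thesis by blast
    qed
  qed
  then show ?thesis using sigma_tilde_iff[of x y] assms G_carrier by blast
qed

lemma sigma_tilde'_iff:
  assumes c: "c \<in> carrier L" and d: "d \<in> carrier L"
  shows "sigma_tilde' L \<phi> c d \<longleftrightarrow> erep c \<inter> erep d \<noteq> {}"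
proof (cases "c = \<bottom> \<or> d = \<bottom>")
  case True
  then show ?thesis by (auto simp: sigma_tilde'_def erep_bot)
next
  case False
  then have ne: "erep c \<noteq> {}" "erep d \<noteq> {}"
    using R.e_eq_iff[of c "\<bottom>"] R.e_eq_iff[of d "\<bottom>"] c d by (auto simp: erep_bot)
  have "separated L G (sigma_tilde L \<phi>) c d \<longleftrightarrow> erep c \<inter> erep d = {}"
    by (rule separated_iff[OF G_carrier c d sigma_tilde_G erep_compact erep_unit ne(1) order_refl
          erep_compact erep_unit ne(2) order_refl])
      (use small_at_G erep_unit in blast)+
  then show ?thesis using False by (simp add: sigma_tilde'_def)
qed

lemma represented_tilde_alg: "represented (tilde_alg L \<phi>) unit_top erep"
proof (intro represented.intro represented_axioms.intro)
  have eq: "tilde_alg L \<phi> = with_contact L (sigma_tilde' L \<phi>)" by (simp add: tilde_alg_def with_contact_def)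
  show "boolean_alg (tilde_alg L \<phi>)" unfolding eq by (rule with_contact_boolean[OF L.boolean_alg_axioms])
  show "complete_lattice (tilde_alg L \<phi>)" unfolding eq by (rule with_contact_complete[OF LC.complete_lattice_axioms])
  show "compact_space unit_top" by (rule R.compact)
  show "Hausdorff_space unit_top" by (rule R.Hausdorff)
  show "bij_betw erep (carrier (tilde_alg L \<phi>)) (carrier (RC unit_top))"
    using R.bij by (simp add: eq)
qed (simp_all add: tilde_alg_def erep_le_iff sigma_tilde'_iff)

end

section \<open>Sums in DHC are products of spaces\<close>

text \<open>A test object is represented by its ends, which turns the given morphisms into
  continuous maps to \<open>X\<close>. These combine into a single map to the product, and
  \<open>dual_inj\<close> converts uniqueness of the morphism into uniqueness of that map.\<close>

lemma dhc_sum_product: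
  fixes A :: "'a contact_alg" and X :: "'x topology" and S :: "'s contact_alg" and I :: "'i set"
  defines "P \<equiv> product_topology (\<lambda>_. X) I"
  assumes A: "represented A X a" and S: "represented S P s"
  shows "dhc_sum TYPE('t) I (\<lambda>_. A) S (\<lambda>i. represented_pair.dual A X a S P s (\<lambda>x. x i))"
  unfolding dhc_sum_def
proof (intro conjI ballI allI impI)
  interpret AS: represented_pair A X a S P s
    using A S by (rule represented_pair.intro)
  show "cnca S" by (rule AS.B.cnca)
  show "cnca A" by (rule AS.A.cnca)
  have proj: "continuous_map P X (\<lambda>x. x i)" if "i \<in> I" for i
    unfolding P_def using that by (rule continuous_map_product_projection)
  show "AS.dual (\<lambda>x. x i) \<in> dhc_hom A S" if "i \<in> I" for i
    using AS.dual_in_dhc_hom[OF proj[OF that]] .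
  fix T :: "'t contact_alg" and f
  assume Tf: "cnca T \<and> (\<forall>i\<in>I. f i \<in> dhc_hom A T)"
  define Y where "Y = cnca.end_space T"
  define t where "t = cnca.end_rep T"
  have T: "represented T Y t" unfolding Y_def t_def using Tf represented_ends by blast
  interpret triple: represented_triple A X a S P s T Y t
    using A S T by (intro represented_triple.intro represented_pair.intro)
  have "\<forall>i\<in>I. \<exists>g. continuous_map Y X g \<and> f i = triple.AC.dual g"
    using Tf triple.AC.dhc_hom_is_dual by blast
  then obtain g where g: "\<And>i. i \<in> I \<Longrightarrow> continuous_map Y X (g i)" "\<And>i. i \<in> I \<Longrightarrow> f i = triple.AC.dual (g i)"
    by metis
  define G where "G y = (\<lambda>i\<in>I. g i y)" for y
  have G: "continuous_map Y P G"
    unfolding P_def continuous_map_componentwise using g(1) by (auto simp: G_def)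
  show "\<exists>!h. h \<in> dhc_hom S T \<and> (\<forall>i\<in>I. dhc_comp A T h (AS.dual (\<lambda>x. x i)) = f i)"
  proof (rule ex1I[of _ "triple.BC.dual G"], intro conjI ballI)
    show "triple.BC.dual G \<in> dhc_hom S T" by (rule triple.BC.dual_in_dhc_hom[OF G])
    fix i assume i: "i \<in> I"
    have "dhc_comp A T (triple.BC.dual G) (AS.dual (\<lambda>x. x i)) = triple.AC.dual ((\<lambda>x. x i) \<circ> G)"
      by (rule triple.dhc_comp_dual[OF proj[OF i] G])
    also have "\<dots> = triple.AC.dual (g i)"
      by (rule triple.AC.dual_cong) (simp add: G_def i)
    finally show "dhc_comp A T (triple.BC.dual G) (AS.dual (\<lambda>x. x i)) = f i" using g i by simp
  next
    fix h assume h: "h \<in> dhc_hom S T \<and> (\<forall>i\<in>I. dhc_comp A T h (AS.dual (\<lambda>x. x i)) = f i)"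
    then obtain G' where G': "continuous_map Y P G'" "h = triple.BC.dual G'"
      using triple.BC.dhc_hom_is_dual by blast
    have eq: "G' y = G y" if y: "y \<in> topspace Y" for y
    proof
      fix i
      have "G' y \<in> topspace P" using G'(1) y by (auto simp: continuous_map_def)
      then have ext: "G' y \<in> extensional I" by (simp add: P_def PiE_def)
      show "G' y i = G y i"
      proof (cases "i \<in> I")
        case i: True
        have "triple.AC.dual ((\<lambda>x. x i) \<circ> G') = triple.AC.dual (g i)"
          using h i g(2)[OF i] triple.dhc_comp_dual[OF proj[OF i] G'(1)] G'(2) by simp
        then show ?thesis
          using triple.AC.dual_inj[OF continuous_map_compose[OF G'(1) proj[OF i]] g(1)[OF i] _ y] i
          by (simp add: G_def)
      next
        case False
        then show ?thesis using ext by (simp add: G_def extensional_def)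
      qed
    qed
    show "h = triple.BC.dual G" unfolding G'(2) by (rule triple.BC.dual_cong[OF eq])
  qed
qed

lemma homeomorphic_maps_if_inverse:
  assumes "continuous_map X Y f" "continuous_map Y X g"
    and "\<And>x. x \<in> topspace X \<Longrightarrow> g (f x) = x" "\<And>y. y \<in> topspace Y \<Longrightarrow> f (g y) = y"
  shows "homeomorphic_map X Y f"
proof -
  have "homeomorphic_maps X Y f g" using assms by (simp add: homeomorphic_maps_def)
  then show ?thesis using homeomorphic_map_maps by blast
qed

text \<open>Two test types suffice. Testing on \<open>RC P\<close> yields a map \<open>K\<close>
  from \<open>P\<close> to the ends of \<open>S\<close>, and the coordinates show that
  \<open>G \<circ> K\<close> is the identity. Testing on \<open>S\<close> itself shows the same for
  \<open>K \<circ> G\<close>, because its dual and that of the identity both reproduce the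
  injections.\<close>

lemma dhc_sum_unique:
  fixes A :: "'a contact_alg" and X :: "'x topology" and S :: "'s contact_alg" and I :: "'i set"
  defines "P \<equiv> product_topology (\<lambda>_. X) I"
  assumes A: "represented A X a" and R: "represented (RC P) P (\<lambda>F. F)"
    and S1: "dhc_sum TYPE('s) I (\<lambda>_. A) S \<iota>" and S2: "dhc_sum TYPE(('i \<Rightarrow> 'x) set) I (\<lambda>_. A) S \<iota>"
  shows "\<exists>s. represented S P s"
proof -
  define Y where "Y = cnca.end_space S"
  define s where "s = cnca.end_rep S"
  have "cnca S" using S1 by (simp add: dhc_sum_def)
  then have S: "represented S Y s" unfolding Y_def s_def by (rule represented_ends)
  interpret ASR: represented_triple A X a S Y s "RC P" P "\<lambda>F. F"
    using A S R by (intro represented_triple.intro represented_pair.intro)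
  interpret ARS: represented_triple A X a "RC P" P "\<lambda>F. F" S Y s
    using A S R by (intro represented_triple.intro represented_pair.intro)
  interpret ASS: represented_triple A X a S Y s S Y s
    using A S by (intro represented_triple.intro represented_pair.intro)
  define \<pi> where "\<pi> i = (\<lambda>x :: 'i \<Rightarrow> 'x. x i)" for i
  have proj: "continuous_map P X (\<pi> i)" if "i \<in> I" for i
    unfolding P_def \<pi>_def using that by (rule continuous_map_product_projection)
  have "\<forall>i\<in>I. \<exists>u. continuous_map Y X u \<and> \<iota> i = ASR.AB.dual u"
    using S1 ASR.AB.dhc_hom_is_dual unfolding dhc_sum_def by blast
  then obtain u where u: "\<And>i. i \<in> I \<Longrightarrow> continuous_map Y X (u i)" "\<And>i. i \<in> I \<Longrightarrow> \<iota> i = ASR.AB.dual (u i)"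
    by metis
  have "\<exists>h. h \<in> dhc_hom S (RC P) \<and> (\<forall>i\<in>I. dhc_comp A (RC P) h (\<iota> i) = ASR.AC.dual (\<pi> i))"
  proof -
    have "cnca (RC P) \<and> (\<forall>i\<in>I. ASR.AC.dual (\<pi> i) \<in> dhc_hom A (RC P))"
      using ASR.BC.B.cnca ASR.AC.dual_in_dhc_hom[OF proj] by simp
    from S2[unfolded dhc_sum_def, THEN conjunct2, THEN conjunct2, rule_format, OF this]
    show ?thesis by (rule ex1_implies_ex)
  qed
  then obtain K where K: "continuous_map P Y K"
    "\<And>i. i \<in> I \<Longrightarrow> dhc_comp A (RC P) (ASR.BC.dual K) (\<iota> i) = ASR.AC.dual (\<pi> i)"
    using ASR.BC.dhc_hom_is_dual by blast
  have uK: "u i (K x) = \<pi> i x" if "i \<in> I" "x \<in> topspace P" for i x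
    using ASR.AC.dual_inj[OF continuous_map_compose[OF K(1) u(1)] proj _ that(2)] K(2) u(2)
      ASR.dhc_comp_dual[OF u(1) K(1)] that by simp
  define G where "G y = (\<lambda>i\<in>I. u i y)" for y
  have G: "continuous_map Y P G"
    unfolding P_def continuous_map_componentwise using u(1) by (auto simp: G_def)
  have GK: "G (K x) = x" if x: "x \<in> topspace P" for x
  proof
    fix i show "G (K x) i = x i"
      using uK[of i x] x by (cases "i \<in> I") (auto simp: G_def \<pi>_def P_def PiE_def extensional_def)
  qed
  have KG: "continuous_map Y Y (K \<circ> G)" using G K(1) by (rule continuous_map_compose)
  have id: "continuous_map Y Y (\<lambda>y. y)" by simp
  have c1: "dhc_comp A S (ASS.BC.dual (K \<circ> G)) (\<iota> i) = \<iota> i" if i: "i \<in> I" for i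
  proof -
    have "G y \<in> topspace P" if "y \<in> topspace Y" for y using G that by (auto simp: continuous_map_def)
    then have "ASR.AB.dual (u i \<circ> (K \<circ> G)) = ASR.AB.dual (u i)"
      using uK[OF i] i by (intro ASR.AB.dual_cong) (simp add: \<pi>_def G_def)
    then show ?thesis using ASS.dhc_comp_dual[OF u(1)[OF i] KG] u(2)[OF i] by simp
  qed
  have c2: "dhc_comp A S (ASS.BC.dual (\<lambda>y. y)) (\<iota> i) = \<iota> i" if i: "i \<in> I" for i
    using ASS.dhc_comp_dual[OF u(1)[OF i] id] u(2)[OF i] by (simp add: comp_def)
  have "\<exists>!h. h \<in> dhc_hom S S \<and> (\<forall>i\<in>I. dhc_comp A S h (\<iota> i) = \<iota> i)"
    using S1 unfolding dhc_sum_def by blast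
  then have "ASS.BC.dual (K \<circ> G) = ASS.BC.dual (\<lambda>y. y)"
    using ASS.BC.dual_in_dhc_hom[OF KG] ASS.BC.dual_in_dhc_hom[OF id] c1 c2 by blast
  then have "K (G y) = y" if "y \<in> topspace Y" for y
    using ASS.BC.dual_inj[OF KG id _ that] by simp
  then have "homeomorphic_map Y P G" by (intro homeomorphic_maps_if_inverse[OF G K(1)] GK)
  from represented_homeomorphic[OF S this] show ?thesis by (rule exI[of "represented S P"])
qed

text \<open>The identity of \<open>A\<close>, read between the two representations in each
  direction, is the dual of a continuous map. The two maps are mutually inverse by injectivity of
  duals.\<close>

lemma represented_unique:
  assumes X: "represented A X e" and Y: "represented A Y e'"
  shows "X homeomorphic_space Y"
proof -
  define id where "id = (\<lambda>a\<in>carrier A. a)"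
  have dual_id: "represented_pair.dual A Z f A Z f (\<lambda>z. z) = id"
    if Z: "represented A Z f" for Z :: "'z topology" and f
  proof -
    interpret Z: represented_pair A Z f A Z f using Z Z by (rule represented_pair.intro)
    have c: "continuous_map Z Z (\<lambda>z. z)" by simp
    show ?thesis
    proof
      fix a show "Z.dual (\<lambda>z. z) a = id a"
      proof (cases "a \<in> carrier A")
        case a: True
        have "Z.A.op a \<subseteq> topspace Z" by (rule openin_subset[OF Z.A.op_open])
        then have "Z.preim (\<lambda>z. z) a = Z.A.op a" by (auto simp: Z.preim_def)
        then have "f (Z.dual (\<lambda>z. z) a) = f a" using Z.e_dual[OF c a] Z.A.closure_op[OF a] by simp
        then show ?thesis using Z.A.e_eq_iff[OF Z.dual_closed[OF c a] a] a by (simp add: id_def)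
      next
        case False then show ?thesis using Z.dual_ext by (simp add: id_def)
      qed
    qed
  qed
  have compose: "\<exists>g. continuous_map Y' X' g \<and> represented_pair.dual A X' f A Y' f' g = id"
    if X': "represented A X' f" and Y': "represented A Y' f'"
    for X' :: "'u topology" and f and Y' :: "'v topology" and f'
  proof -
    interpret P: represented_pair A X' f A Y' f' using X' Y' by (rule represented_pair.intro)
    interpret Q: represented_pair A X' f A X' f using X' X' by (rule represented_pair.intro)
    have "id \<in> dhc_hom A A"
      using Q.dual_in_dhc_hom[of "\<lambda>x. x"] dual_id[OF X'] by simp
    then show ?thesis using P.dhc_hom_is_dual by blast
  qed
  have inverse: "g (g' x) = x"
    if X': "represented A X' f" and Y': "represented A Y' f'"
      and g: "continuous_map Y' X' g" "represented_pair.dual A X' f A Y' f' g = id"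
      and g': "continuous_map X' Y' g'" "represented_pair.dual A Y' f' A X' f g' = id"
      and x: "x \<in> topspace X'"
    for X' :: "'u topology" and f and Y' :: "'v topology" and f' g g' x
  proof -
    interpret T: represented_triple A X' f A Y' f' A X' f
      using X' Y' by (intro represented_triple.intro represented_pair.intro)
    interpret U: represented_triple A X' f A X' f A X' f
      using X' by (intro represented_triple.intro represented_pair.intro)
    have c: "continuous_map X' X' (\<lambda>x. x)" by simp
    \<comment> \<open>The DHC-composite of \<open>id\<close> with itself is evaluated twice, once
      through \<open>Y'\<close> and once within \<open>X'\<close>; comparing the results identifies
      \<open>g \<circ> g'\<close> with the identity map.\<close>
    have "T.AC.dual (g \<circ> g') = dhc_comp A A id id" using T.dhc_comp_dual[OF g(1) g'(1)] g g' by simp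
    also have "\<dots> = T.AC.dual (\<lambda>x. x)"
      using U.dhc_comp_dual[OF c c] dual_id[OF X'] by (simp add: comp_def)
    finally show ?thesis
      using T.AC.dual_inj[OF continuous_map_compose[OF g'(1) g(1)] c _ x] by simp
  qed
  obtain g where g: "continuous_map Y X g" "represented_pair.dual A X e A Y e' g = id"
    using compose[OF X Y] by blast
  obtain g' where g': "continuous_map X Y g'" "represented_pair.dual A Y e' A X e g' = id"
    using compose[OF Y X] by blast
  have "homeomorphic_map X Y g'"
    using inverse[OF X Y g g'] inverse[OF Y X g' g] by (intro homeomorphic_maps_if_inverse[OF g'(1) g(1)])
  then show ?thesis by (rule homeomorphic_map_imp_homeomorphic_space)
qed

lemma represented_isomorphic:
  assumes S: "represented S X s" and Y: "compact_space Y" "Hausdorff_space Y"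
    and iso: "CA_isomorphic (RC Y) S"
  shows "\<exists>e. represented (RC Y) X e"
proof -
  interpret S: represented S X s by (rule S)
  interpret Y: represented "RC Y" Y "\<lambda>F. F" by (rule represented_RC[OF Y])
  obtain f where f: "f \<in> bool_hom (RC Y) S" "bij_betw f (carrier (RC Y)) (carrier S)"
    "\<forall>F\<in>carrier (RC Y). \<forall>G\<in>carrier (RC Y). contact (RC Y) F G \<longleftrightarrow> contact S (f F) (f G)"
    using iso unfolding CA_isomorphic_def by blast
  have fc: "f F \<in> carrier S" if "F \<in> carrier (RC Y)" for F
    using f(2) that by (meson bij_betwE)
  \<comment> \<open>A Boolean homomorphism is specified through operations, so the order is
    recovered from meets and injectivity.\<close>
  have le: "le (RC Y) F G \<longleftrightarrow> le S (f F) (f G)" if "F \<in> carrier (RC Y)" "G \<in> carrier (RC Y)" for F G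
  proof -
    have "le (RC Y) F G \<longleftrightarrow> F = F \<sqinter>\<^bsub>RC Y\<^esub> G" by (rule Y.le_iff_join[OF that])
    also have "\<dots> \<longleftrightarrow> f F = f (F \<sqinter>\<^bsub>RC Y\<^esub> G)"
      using inj_on_eq_iff[OF bij_betw_imp_inj_on[OF f(2)] that(1) Y.meet_closed[OF that]] by blast
    also have "\<dots> \<longleftrightarrow> f F = f F \<sqinter>\<^bsub>S\<^esub> f G" using f(1) that by (simp add: bool_hom_def del: RC_simps(1))
    also have "\<dots> \<longleftrightarrow> le S (f F) (f G)" by (rule S.le_iff_join[OF fc[OF that(1)] fc[OF that(2)], symmetric])
    finally show ?thesis .
  qed
  have "represented (RC Y) X (\<lambda>F. s (f F))"
  proof (intro represented.intro represented_axioms.intro)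
    show "bij_betw (\<lambda>F. s (f F)) (carrier (RC Y)) (carrier (RC X))"
      using bij_betw_trans[OF f(2) S.bij] by (simp add: comp_def)
    show "le (RC Y) F G \<longleftrightarrow> s (f F) \<subseteq> s (f G)" if "F \<in> carrier (RC Y)" "G \<in> carrier (RC Y)" for F G
      unfolding le[OF that] by (rule S.le_iff[OF fc[OF that(1)] fc[OF that(2)]])
    show "contact (RC Y) F G \<longleftrightarrow> s (f F) \<inter> s (f G) \<noteq> {}" if "F \<in> carrier (RC Y)" "G \<in> carrier (RC Y)" for F G
      using f(3) S.contact_iff[OF fc[OF that(1)] fc[OF that(2)]] that by blast
  qed (rule Y.boolean_alg_axioms Y.complete S.compact S.Hausdorff)+
  then show ?thesis by blast
qed

theorem theorem5p8:
  fixes I :: "'i set"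
    and A L :: "'a gorder"
    and \<phi> :: "nat \<Rightarrow> int set \<Rightarrow> 'a"
  assumes sum: "boolean_sum TYPE('a) {1..} (\<lambda>_. powerset_Z0) A \<phi>"
    and mono: "\<And>i. i \<ge> 1 \<Longrightarrow> inj_on (\<phi> i) (carrier powerset_Z0)"
    and completion: "macneille_completion A L"
  shows "(\<exists>\<iota>. dhc_sum TYPE('t) I (\<lambda>_. tilde_alg L \<phi>) (RC (tychonoff_cube I)) \<iota> \<and>
              dhc_sum TYPE(('i \<Rightarrow> real) set) I (\<lambda>_. tilde_alg L \<phi>) (RC (tychonoff_cube I)) \<iota>)
    \<and> (\<forall>(S :: 's contact_alg) \<iota>.
          dhc_sum TYPE('s) I (\<lambda>_. tilde_alg L \<phi>) S \<iota> \<and>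
          dhc_sum TYPE(('i \<Rightarrow> real) set) I (\<lambda>_. tilde_alg L \<phi>) S \<iota> \<longrightarrow>
          CA_isomorphic (RC (tychonoff_cube I)) S \<and>
          (\<forall>Y :: 'y topology. compact_space Y \<and> Hausdorff_space Y \<and> CA_isomorphic (RC Y) S \<longrightarrow>
             Y homeomorphic_space tychonoff_cube I))"
proof -
  interpret completed_sum L A \<phi>
    using sum mono completion by (rule completed_sum.intro)
  note A = represented_tilde_alg
  have cube: "compact_space (tychonoff_cube I)" "Hausdorff_space (tychonoff_cube I)"
    unfolding tychonoff_cube_def using R.compact R.Hausdorff
    by (auto simp: compact_space_product_topology Hausdorff_space_product_topology)
  note RC = represented_RC[OF cube]
  note R = RC[unfolded tychonoff_cube_def]
  show ?thesis
  proof (intro conjI allI impI)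
    show "\<exists>\<iota>. dhc_sum TYPE('t) I (\<lambda>_. tilde_alg L \<phi>) (RC (tychonoff_cube I)) \<iota> \<and>
        dhc_sum TYPE(('i \<Rightarrow> real) set) I (\<lambda>_. tilde_alg L \<phi>) (RC (tychonoff_cube I)) \<iota>"
      unfolding tychonoff_cube_def by (intro exI conjI) (rule dhc_sum_product[OF A R])+
    fix S :: "'s contact_alg" and \<iota>
    assume S: "dhc_sum TYPE('s) I (\<lambda>_. tilde_alg L \<phi>) S \<iota> \<and>
      dhc_sum TYPE(('i \<Rightarrow> real) set) I (\<lambda>_. tilde_alg L \<phi>) S \<iota>"
    obtain s where s: "represented S (tychonoff_cube I) s"
      using dhc_sum_unique[OF A R, of S \<iota>] S unfolding tychonoff_cube_def by blast
    show "CA_isomorphic (RC (tychonoff_cube I)) S" by (rule represented.CA_isomorphic_RC[OF s])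
    fix Y :: "'y topology"
    assume Y: "compact_space Y \<and> Hausdorff_space Y \<and> CA_isomorphic (RC Y) S"
    then obtain e where e: "represented (RC Y) (tychonoff_cube I) e"
      using represented_isomorphic[OF s, of Y] by blast
    show "Y homeomorphic_space tychonoff_cube I"
      by (rule represented_unique[OF represented_RC e]) (use Y in blast)+
  qed
qed

end
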